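(* Let $n\ge2$ and let $\psi\in L^2(\mathbb R^n)$ be an admissible shearlet with admissibility constant $C_\psi$. Then for every Schwartz function $f\in\mathcal S(\mathbb R^n)$, $$\int_{\mathbb S}\ln|t|\,\big|\mathcal{SH}_{\psi}f(a,s,t)\big|^{2}\,d\eta+C_{\psi}\int_{\mathbb R^{n}}\ln|\xi|\,|\hat f(\xi)|^2\,d\xi\;\ge\; C_{\psi}\left[\frac{\Gamma'(n/4)}{\Gamma(n/4)}-\ln\pi\right]\|f\|_{2}^{2}.$$
   Context: Fourier transform: $\hat f(\xi)=\mathscr F[f](\xi)=\int_{\mathbb R^n}f(x)e^{-2\pi i\,\xi\cdot x}\,dx$, extended to $L^2(\mathbb R^n)$ by Plancherel. $|\cdot|$ is the Euclidean norm on $\mathbb R^n$, and $\Gamma$ is Euler's gamma function. Integrals are understood in the extended sense (the first integral may equal $+\infty$). For $a\in\mathbb R\setminus\{0\}$ and $s\in\mathbb R^{n-1}$ let $$A_a=\begin{pmatrix} a & 0\\ 0 & \operatorname{sgn}(a)|a|^{1/n}I_{n-1}\end{pmatrix},\qquad S_s=\begin{pmatrix}1 & s^T\\ 0 & I_{n-1}\end{pmatrix},\qquad M_{sa}=S_sA_a,$$ so $|\det M_{sa}|=|\det A_a|=|a|^{2-1/n}$. For $\psi\in L^2(\mathbb R^n)$ and $t\in\mathbb R^n$ put $\psi_{a,s,t}(x)=|\det M_{sa}|^{-1/2}\psi\big(M_{sa}^{-1}(x-t)\big)$. The continuous shearlet transform of $f\in L^2(\mathbb R^n)$ is $\mathcal{SH}_\psi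 f(a,s,t)=\langle f,\psi_{a,s,t}\rangle=\int_{\mathbb R^n}f(x)\overline{\psi_{a,s,t}(x)}\,dx$. Let $\mathbb S=(\mathbb R\setminus\{0\})\times\mathbb R^{n-1}\times\mathbb R^n$ with the measure $d\eta=\dfrac{da\,ds\,dt}{|a|^{n+1}}$. The function $\psi\in L^2(\mathbb R^n)$ is an admissible shearlet if $$C_\psi=\int_{\mathbb R^{n-1}}\int_{\mathbb R\setminus\{0\}}\frac{|\hat\psi(M_{sa}^T\xi)|^2}{|a|^{(n^2-n+1)/n}}\,da\,ds<\infty;$$ this quantity has the same value for every $\xi\in\mathbb R^n$ with $\xi_1\neq0$. *)

theory Defs
  imports "HOL-Analysis.Analysis"
begin

text \<open>
  Euclidean space of dimension n \<open>\<ge>\<close> 2 is \<^typ>\<open>(real, 'm option) vec\<close> with \<^typ>\<open>'m\<close> an arbitrary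
  finite (hence nonempty) type: n = \<open>CARD('m option)\<close> = \<open>CARD('m)\<close> + 1, the index \<^term>\<open>None\<close> is the
  distinguished first coordinate, and the indices \<open>Some i\<close> are the remaining n - 1 coordinates.
\<close>

subsection \<open>Square integrable functions and the Fourier transform\<close>

definition square_integrable :: "('a::euclidean_space \<Rightarrow> complex) \<Rightarrow> bool" where
  "square_integrable f \<longleftrightarrow>
     f \<in> borel_measurable lebesgue \<and> integrable lebesgue (\<lambda>x. (norm (f x))\<^sup>2)"

definition fourier :: "('a::euclidean_space \<Rightarrow> complex) \<Rightarrow> 'a \<Rightarrow> complex" where
  "fourier f \<xi> =
     (LINT x|lebesgue. f x * exp (- 2 * complex_of_real pi * \<i> * complex_of_real (\<xi> \<bullet> x)))"

text \<open>
  \<open>g\<close> represents the Fourier transform of the square integrable function \<open>f\<close>, i.e. the value at \<open>f\<close>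
  of the continuous extension to L2 of the Fourier transform on the intersection of L1 and L2.
  It is determined by \<open>f\<close> up to a null set; a Borel measurable representative is taken.
\<close>

definition is_fourier_L2 ::
    "('a::euclidean_space \<Rightarrow> complex) \<Rightarrow> ('a \<Rightarrow> complex) \<Rightarrow> bool" where
  "is_fourier_L2 f g \<longleftrightarrow>
     g \<in> borel_measurable borel \<and> square_integrable g \<and>
     (\<exists>F :: nat \<Rightarrow> 'a \<Rightarrow> complex.
        (\<forall>k. integrable lebesgue (F k) \<and> square_integrable (F k)) \<and>
        (\<lambda>k. \<integral>\<^sup>+x. ennreal ((norm (F k x - f x))\<^sup>2) \<partial>lebesgue) \<longlonglongrightarrow> 0 \<and>
        (\<lambda>k. \<integral>\<^sup>+\<xi>. ennreal ((norm (fourier (F k) \<xi> - g \<xi>))\<^sup>2) \<partial>lebesgue) \<longlonglongrightarrow> 0)"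

definition fourier_L2 :: "('a::euclidean_space \<Rightarrow> complex) \<Rightarrow> 'a \<Rightarrow> complex" where
  "fourier_L2 f = (SOME g. is_fourier_L2 f g)"

subsection \<open>Schwartz functions\<close>

text \<open>Iterated partial derivatives; a multi-index is given as a list of coordinate directions.\<close>

primrec partials :: "'n list \<Rightarrow> (real ^ 'n \<Rightarrow> complex) \<Rightarrow> real ^ 'n \<Rightarrow> complex" where
  "partials [] f = f"
| "partials (i # is) f = (\<lambda>x. frechet_derivative (partials is f) (at x) (axis i 1))"

definition schwartz :: "(real ^ 'n \<Rightarrow> complex) \<Rightarrow> bool" where
  "schwartz f \<longleftrightarrow>
     (\<forall>is x. partials is f differentiable (at x)) \<and>
     (\<forall>is k. \<exists>B. \<forall>x. norm x ^ k * norm (partials is f x) \<le> B)"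

subsection \<open>Extended integrals\<close>

text \<open>
  The integral of a real function with values in the extended reals. If the negative part has
  infinite integral the value is set to \<open>-\<infinity>\<close>, so a lower bound on the integral by a real number
  includes the claim that its negative part is finite (whereas \<open>\<infinity> - \<infinity> = \<infinity>\<close> in type \<^typ>\<open>ereal\<close>).
\<close>

definition ext_integral :: "'a measure \<Rightarrow> ('a \<Rightarrow> real) \<Rightarrow> ereal" where
  "ext_integral M g =
     (let P = (\<integral>\<^sup>+x. ennreal (g x) \<partial>M); N = (\<integral>\<^sup>+x. ennreal (- g x) \<partial>M)
      in if N = \<infinity> then - \<infinity> else enn2ereal P - enn2ereal N)"

subsection \<open>The shearlet transform\<close>

definition dil_matrix :: "real \<Rightarrow> ((real, 'm::finite option) vec, 'm option) vec" where
  "dil_matrix a =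
     (\<chi> i j. if i \<noteq> j then 0
             else case i of None \<Rightarrow> a
                  | Some k \<Rightarrow> sgn a * \<bar>a\<bar> powr (1 / real CARD('m option)))"

definition shear_matrix ::
    "real ^ 'm \<Rightarrow> ((real, 'm::finite option) vec, 'm option) vec" where
  "shear_matrix s =
     (\<chi> i j. if i = j then 1
             else case (i, j) of (None, Some k) \<Rightarrow> s $ k | _ \<Rightarrow> 0)"

definition shearlet_matrix ::
    "real ^ 'm \<Rightarrow> real \<Rightarrow> ((real, 'm::finite option) vec, 'm option) vec" where
  "shearlet_matrix s a = shear_matrix s ** dil_matrix a"

definition shearlet ::
    "((real, 'm::finite option) vec \<Rightarrow> complex) \<Rightarrow>
     real \<Rightarrow> real ^ 'm \<Rightarrow> (real, 'm option) vec \<Rightarrow> (real, 'm option) vec \<Rightarrow> complex" where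
  "shearlet \<psi> a s t x =
     complex_of_real (\<bar>det (shearlet_matrix s a)\<bar> powr (- (1/2))) *
     \<psi> (matrix_inv (shearlet_matrix s a) *v (x - t))"

definition shearlet_transform ::
    "((real, 'm::finite option) vec \<Rightarrow> complex) \<Rightarrow> ((real, 'm option) vec \<Rightarrow> complex) \<Rightarrow>
     real \<Rightarrow> real ^ 'm \<Rightarrow> (real, 'm option) vec \<Rightarrow> complex" where
  "shearlet_transform \<psi> f a s t = (LINT x|lebesgue. f x * cnj (shearlet \<psi> a s t x))"

definition shearlet_measure ::
    "(real \<times> (real ^ 'm) \<times> (real, 'm::finite option) vec) measure" where
  "shearlet_measure =
     density lborel
       (\<lambda>(a, s, t). indicator (- {0}) a * ennreal (1 / \<bar>a\<bar> ^ (CARD('m option) + 1)))"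

text \<open>
  The admissibility integral does not depend on the point \<open>\<xi>\<close>, as long as its first coordinate is
  nonzero; the point is kept as a parameter.
\<close>

definition admissibility_integral ::
    "((real, 'm::finite option) vec \<Rightarrow> complex) \<Rightarrow> (real, 'm option) vec \<Rightarrow> ennreal" where
  "admissibility_integral \<psi> \<xi> =
     (\<integral>\<^sup>+s. (\<integral>\<^sup>+a. indicator (- {0}) a *
        ennreal ((norm (fourier_L2 \<psi> (transpose (shearlet_matrix (s :: real ^ 'm) a) *v \<xi>)))\<^sup>2 /
          \<bar>a\<bar> powr (((real CARD('m option))\<^sup>2 - real CARD('m option) + 1) / real CARD('m option)))
        \<partial>lborel) \<partial>lborel)"

definition admissible_shearlet :: "((real, 'm::finite option) vec \<Rightarrow> complex) \<Rightarrow> bool" where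
  "admissible_shearlet \<psi> \<longleftrightarrow>
     square_integrable \<psi> \<and> (\<exists>\<xi>. \<xi> $ None \<noteq> 0 \<and> admissibility_integral \<psi> \<xi> < \<infinity>)"

end

theory Submission
  imports Defs "HOL-Probability.Characteristic_Functions"
begin

text \<open>
  The Fourier transform in \<open>t\<close> of the shearlet transform of \<open>f\<close> is, for each \<open>(a, s)\<close>, the product of
  the transform of \<open>f\<close> with the conjugated dilated transform of \<open>\<psi>\<close>, and the admissibility integral is
  exactly the integral over \<open>(a, s)\<close> of the squared modulus of the second factor. Applying the sharp inequality of
  Pitt in \<open>t\<close>, with weights \<open>|t|\<close> to the power \<open>- \<alpha>\<close> and \<open>|\<xi>|\<close> to the power \<open>\<alpha>\<close>, and integrating over
  \<open>(a, s)\<close> gives a Pitt inequality for the shearlet transform; for \<open>\<alpha> = 0\<close> it is the Plancherel identity.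
  The elementary bound \<open>ln r \<ge> (1 - r powr - \<alpha>) / \<alpha>\<close> turns this into a lower bound on the first integral
  for every \<open>\<alpha> > 0\<close>, and \<open>\<alpha> \<rightarrow> 0\<close> only concerns the rapidly decaying transform of \<open>f\<close>. The constant is
  minus the derivative at \<open>\<alpha> = 0\<close> of the constant of Pitt.

  Pitt's inequality itself is a Schur test: writing \<open>|t|\<close> to the power \<open>- \<alpha>\<close> as a superposition of Gaussians,
  the weighted mean square of a Fourier integral becomes a quadratic form with a Riesz kernel,
  for which the weight \<open>|\<xi>|\<close> to the power \<open>- (n + \<alpha>) / 2\<close> is an eigenfunction up to the factor \<open>|\<xi>|\<close> to the
  power \<open>\<alpha>\<close>.
\<close>

subsection \<open>Gaussian integrals\<close>

text \<open>What drives the argument is that \<open>pitt_const n 0 = 1\<close>: the deficit between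
  the Plancherel identity and Pitt's inequality is then of order \<alpha>, and dividing it by
  \<alpha> leaves a finite limit. A constant exceeding 1 at \<alpha> = 0 would make the lower bound
  degenerate. The logarithm changes sign and its integral over the group may be infinite, so no
  Fubini argument is run on it. Exchanges over the group concern nonnegative integrands, with powers
  of \<open>norm t\<close> and \<open>norm \<xi>\<close>; the logarithm is only bounded below by an
  integrable function, which also shows that its negative part is finite. \<open>\<psi>\<close> is
  merely square integrable. For fixed \<open>(a, s)\<close> the spectrum is nevertheless integrable,
  being a product of two square integrable functions, so its Fourier integral exists at every
  \<open>t\<close>. The Gaussian mean squares behind Pitt's inequality also yield both halves of
  Plancherel's theorem. The Gamma integral serves throughout to replace a negative power by
  exponentials, whose integrals over space are explicit.\<close>

lemma nn_integral_Gamma_scaled: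
  fixes p c :: real
  assumes "p > 0" "c > 0"
  shows "(\<integral>\<^sup>+s\<in>{0<..}. ennreal (s powr (p - 1) * exp (- (c * s))) \<partial>lborel) = ennreal (Gamma p * c powr - p)"
proof -
  have "ennreal (Gamma p) = (\<integral>\<^sup>+t. ennreal (indicator {0..} t * t powr (p - 1) / exp t) \<partial>lborel)"
    using Gamma_conv_nn_integral_real[OF assms(1)] .
  also have "\<dots> = \<bar>c\<bar> * (\<integral>\<^sup>+t. ennreal (indicator {0..} (0 + c * t) * (0 + c * t) powr (p - 1) / exp (0 + c * t)) \<partial>lborel)"
    using assms by (intro nn_integral_real_affine) auto
  also have "\<dots> = \<bar>c\<bar> * (\<integral>\<^sup>+t. ennreal (c powr (p-1)) * (ennreal (t powr (p - 1) * exp (- (c * t))) * indicator {0<..} t) \<partial>lborel)"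
    using assms
    by (intro arg_cong2[where f="(*)"] refl nn_integral_cong)
       (auto simp: indicator_def powr_mult exp_minus field_simps zero_le_mult_iff ennreal_mult' [symmetric])
  also have "\<dots> = \<bar>c\<bar> * (ennreal (c powr (p-1)) * (\<integral>\<^sup>+t\<in>{0<..}. ennreal (t powr (p - 1) * exp (- (c * t))) \<partial>lborel))"
    by (subst nn_integral_cmult) auto
  also have "\<dots> = ennreal (c powr p) * (\<integral>\<^sup>+t\<in>{0<..}. ennreal (t powr (p - 1) * exp (- (c * t))) \<partial>lborel)"
    using assms by (simp add: mult.assoc[symmetric] ennreal_mult'[symmetric] powr_mult_base)
  finally have *: "ennreal (Gamma p) = ennreal (c powr p) * (\<integral>\<^sup>+t\<in>{0<..}. ennreal (t powr (p - 1) * exp (- (c * t))) \<partial>lborel)" .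
  have "ennreal (c powr - p) * ennreal (Gamma p) =
     (ennreal (c powr - p) * ennreal (c powr p)) * (\<integral>\<^sup>+t\<in>{0<..}. ennreal (t powr (p - 1) * exp (- (c * t))) \<partial>lborel)"
    by (simp add: * mult.assoc)
  also have "ennreal (c powr - p) * ennreal (c powr p) = 1"
    using assms by (simp add: ennreal_mult'[symmetric] powr_minus)
  finally show ?thesis
    using assms by (simp add: ennreal_mult'[symmetric] mult.commute)
qed

lemma borel_measurable_cis [measurable]: "cis \<in> borel_measurable borel"
  by (intro borel_measurable_continuous_onI) (auto intro!: continuous_intros)

lemma borel_measurable_cnj [measurable (raw)]:
  "f \<in> borel_measurable M \<Longrightarrow> (\<lambda>x. cnj (f x)) \<in> borel_measurable M"
  by (rule borel_measurable_continuous_on[where f = cnj]) (auto intro!: continuous_intros)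

text \<open>This is the characteristic function of the standard normal law after a change of
  scale.\<close>

lemma fourier_gaussian_1:
  fixes l z :: real
  assumes l: "l > 0"
  shows "integrable lborel (\<lambda>t. exp (- (pi * l * t\<^sup>2)) *\<^sub>R cis (2 * pi * (z * t)))" (is ?I)
    and "(LINT t|lborel. exp (- (pi * l * t\<^sup>2)) *\<^sub>R cis (2 * pi * (z * t)))
           = of_real (l powr (- 1 / 2) * exp (- (pi * z\<^sup>2 / l)))" (is ?E)
proof -
  \<comment> \<open>The scale for which x = c t turns exp (- x^2 / 2) into exp (- pi l t^2);
    \<open>u\<close> is the frequency that becomes 2 pi z under it.\<close>
  define c where "c = sqrt (2 * pi * l)"
  define u where "u = 2 * pi * z / c"
  have c: "c > 0" and c2: "c\<^sup>2 = 2 * pi * l"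
    using l by (auto simp: c_def)
  have I0: "integrable lborel (\<lambda>x. std_normal_density x *\<^sub>R cis (u * x))"
    by (rule Bochner_Integration.integrable_bound[OF integrable_normal_density[where \<mu>=0 and \<sigma>=1]]) auto
  have E0: "(LINT x|lborel. std_normal_density x *\<^sub>R cis (u * x)) = of_real (exp (- (u\<^sup>2) / 2))"
    using fun_cong[OF char_std_normal_distribution, of u]
    by (simp add: char_def integral_density cis_conv_exp)
  have cx: "std_normal_density (0 + c * x) *\<^sub>R cis (u * (0 + c * x)) =
      (1 / sqrt (2 * pi)) *\<^sub>R (exp (- (pi * l * x\<^sup>2)) *\<^sub>R cis (2 * pi * (z * x)))" for x
    using c by (simp add: std_normal_density_def power_mult_distrib c2 u_def mult_ac)
  have I1: "integrable lborel (\<lambda>x. (1 / sqrt (2 * pi)) *\<^sub>R (exp (- (pi * l * x\<^sup>2)) *\<^sub>R cis (2 * pi * (z * x))))"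
    using lborel_integrable_real_affine[OF I0, of c 0] c unfolding cx by simp
  then have "integrable lborel (\<lambda>x. sqrt (2 * pi) *\<^sub>R (1 / sqrt (2 * pi)) *\<^sub>R (exp (- (pi * l * x\<^sup>2)) *\<^sub>R cis (2 * pi * (z * x))))"
    by (rule integrable_scaleR_right)
  then show ?I by simp
  have "of_real (exp (- (u\<^sup>2) / 2)) = \<bar>c\<bar> *\<^sub>R (LINT x|lborel. (1 / sqrt (2 * pi)) *\<^sub>R (exp (- (pi * l * x\<^sup>2)) *\<^sub>R cis (2 * pi * (z * x))))"
    using lborel_integral_real_affine[of c "\<lambda>x. std_normal_density x *\<^sub>R cis (u * x)" 0] c
    unfolding cx E0 by simp
  also have "\<dots> = \<bar>c\<bar> *\<^sub>R ((1 / sqrt (2 * pi)) *\<^sub>R (LINT x|lborel. exp (- (pi * l * x\<^sup>2)) *\<^sub>R cis (2 * pi * (z * x))))"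
    by (simp only: integral_scaleR_right)
  also have "\<dots> = sqrt l *\<^sub>R (LINT x|lborel. exp (- (pi * l * x\<^sup>2)) *\<^sub>R cis (2 * pi * (z * x)))"
    using c by (simp add: c_def real_sqrt_mult)
  finally have *: "of_real (exp (- (u\<^sup>2) / 2)) = sqrt l *\<^sub>R (LINT x|lborel. exp (- (pi * l * x\<^sup>2)) *\<^sub>R cis (2 * pi * (z * x)))" .
  have "u\<^sup>2 / 2 = pi * z\<^sup>2 / l"
    using l by (simp add: u_def power_divide c2 power_mult_distrib) (simp add: power2_eq_square field_simps)
  with * have "of_real (exp (- (pi * z\<^sup>2 / l))) = sqrt l *\<^sub>R (LINT x|lborel. exp (- (pi * l * x\<^sup>2)) *\<^sub>R cis (2 * pi * (z * x)))"
    by simp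
  then have "(1 / sqrt l) *\<^sub>R complex_of_real (exp (- (pi * z\<^sup>2 / l))) = (LINT x|lborel. exp (- (pi * l * x\<^sup>2)) *\<^sub>R cis (2 * pi * (z * x)))"
    using l by (simp only: scaleR_scaleR) simp
  moreover have "1 / sqrt l = l powr (- 1 / 2)"
    using l by (simp add: powr_minus_divide powr_half_sqrt)
  ultimately show ?E by (simp add: scaleR_conv_of_real)
qed

lemma integral_lborel_prod:
  fixes f :: "'a::euclidean_space \<Rightarrow> real \<Rightarrow> 'b::{real_normed_field,banach,second_countable_topology}"
  assumes "\<And>b. b \<in> Basis \<Longrightarrow> integrable lborel (f b)"
  shows "integrable lborel (\<lambda>x. \<Prod>b\<in>Basis. f b (x \<bullet> b))"
    and "(LINT x|lborel. (\<Prod>b\<in>Basis. f b (x \<bullet> b))) = (\<Prod>b\<in>Basis. (LINT x|lborel. f b x))"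
proof -
  interpret product_sigma_finite "\<lambda>_::'a. lborel :: real measure" by standard
  have [measurable]: "f b \<in> borel_measurable borel" if "b \<in> Basis" for b
    using assms[OF that] by auto
  have eq: "(\<Prod>b\<in>Basis. f b ((\<Sum>i\<in>Basis. y i *\<^sub>R i) \<bullet> b)) = (\<Prod>b\<in>Basis. f b (y b))" for y
    by (intro prod.cong) auto
  show "integrable lborel (\<lambda>x. \<Prod>b\<in>Basis. f b (x \<bullet> b))"
    unfolding lborel_eq[where 'a='a]
    by (subst integrable_distr_eq) (auto simp: eq intro!: product_integrable_prod assms)
  show "(LINT x|lborel. (\<Prod>b\<in>Basis. f b (x \<bullet> b))) = (\<Prod>b\<in>Basis. (LINT x|lborel. f b x))"
    unfolding lborel_eq[where 'a='a]
    by (subst integral_distr) (auto simp: eq intro!: product_integral_prod assms)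
qed

lemma prod_cis: "finite A \<Longrightarrow> (\<Prod>b\<in>A. cis (g b)) = cis (\<Sum>b\<in>A. g b)"
  by (induction A rule: finite_induct) (auto simp: cis_mult)

lemma fourier_gaussian:
  fixes z :: "'a::euclidean_space" and l :: real
  assumes l: "l > 0"
  shows "integrable lborel (\<lambda>t. exp (- (pi * l * (norm t)\<^sup>2)) *\<^sub>R cis (2 * pi * (z \<bullet> t)))" (is ?I)
    and "(LINT t|lborel. exp (- (pi * l * (norm t)\<^sup>2)) *\<^sub>R cis (2 * pi * (z \<bullet> t)))
           = of_real (l powr (- real DIM('a) / 2) * exp (- (pi * (norm z)\<^sup>2 / l)))" (is ?E)
proof -
  define f where "f b t = exp (- (pi * l * t\<^sup>2)) *\<^sub>R cis (2 * pi * ((z \<bullet> b) * t))" for b :: 'a and t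
  have n2: "(norm t)\<^sup>2 = (\<Sum>b\<in>Basis. (t \<bullet> b)\<^sup>2)" for t :: 'a
    by (subst power2_norm_eq_inner, subst euclidean_inner) (simp add: power2_eq_square)
  have eq: "exp (- (pi * l * (norm t)\<^sup>2)) *\<^sub>R cis (2 * pi * (z \<bullet> t)) = (\<Prod>b\<in>Basis. f b (t \<bullet> b))" for t
    by (simp add: f_def scaleR_conv_of_real prod.distrib prod_cis n2 euclidean_inner[of z t]
        sum_distrib_left exp_sum[symmetric] of_real_prod[symmetric] sum_negf[symmetric] del: of_real_exp)
  show ?I unfolding eq
    by (rule integral_lborel_prod) (auto simp: f_def intro: fourier_gaussian_1 l)
  have "(LINT t|lborel. (\<Prod>b\<in>Basis. f b (t \<bullet> b))) = (\<Prod>b\<in>Basis. (LINT t|lborel. f b t))"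
    by (rule integral_lborel_prod) (auto simp: f_def intro: fourier_gaussian_1 l)
  also have "\<dots> = (\<Prod>b\<in>Basis. of_real (l powr (- 1 / 2) * exp (- (pi * (z \<bullet> b)\<^sup>2 / l))))"
    by (simp add: f_def fourier_gaussian_1(2)[OF l, simplified])
  also have "\<dots> = of_real (l powr (- real DIM('a) / 2) * exp (- (pi * (norm z)\<^sup>2 / l)))"
  proof -
    have "(\<Prod>b\<in>(Basis::'a set). l powr (- 1 / 2)) = l powr (- real DIM('a) / 2)"
      using l by (simp add: powr_realpow[symmetric] powr_powr)
    moreover have "(\<Prod>b\<in>Basis. exp (- (pi * (z \<bullet> b)\<^sup>2 / l))) = exp (- (pi * (norm z)\<^sup>2 / l))"
      by (simp add: n2 sum_distrib_left sum_divide_distrib exp_sum[symmetric] sum_negf[symmetric])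
    ultimately show ?thesis
      by (simp only: of_real_prod[symmetric] prod.distrib)
  qed
  finally show ?E unfolding eq .
qed

lemma nn_integral_gaussian:
  fixes c :: real and z :: "'a::euclidean_space"
  assumes c: "c > 0"
  shows "(\<integral>\<^sup>+x. ennreal (exp (- (c * (norm (x - z))\<^sup>2))) \<partial>lborel) = ennreal ((pi / c) powr (DIM('a) / 2))"
proof -
  have "(\<integral>\<^sup>+x. ennreal (exp (- (c * (norm (x - z))\<^sup>2))) \<partial>lborel)
     = (\<integral>\<^sup>+x. ennreal (exp (- (c * (norm (x - z))\<^sup>2))) \<partial>distr lborel borel ((+) z))"
    by (simp add: lborel_distr_plus)
  also have "\<dots> = (\<integral>\<^sup>+x. ennreal (exp (- (c * (norm (x::'a))\<^sup>2))) \<partial>lborel)"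
    by (subst nn_integral_distr) auto
  also have "\<dots> = ennreal (LINT x::'a|lborel. exp (- (c * (norm x)\<^sup>2)))"
  proof (rule nn_integral_eq_integral)
    show "integrable lborel (\<lambda>x::'a. exp (- (c * (norm x)\<^sup>2)))"
      using integrable_norm[OF fourier_gaussian(1)[of "c/pi" "0::'a"]] c by simp
  qed auto
  also have "(LINT x::'a|lborel. exp (- (c * (norm x)\<^sup>2))) = (pi / c) powr (DIM('a) / 2)"
  proof -
    have "complex_of_real (LINT x::'a|lborel. exp (- (c * (norm x)\<^sup>2))) = of_real ((c/pi) powr (- real DIM('a) / 2))"
      using fourier_gaussian(2)[of "c/pi" "0::'a"] c
      by (simp add: scaleR_conv_of_real flip: of_real_exp)
    also have "(c/pi) powr (- real DIM('a) / 2) = (pi / c) powr (DIM('a) / 2)"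
      using c by (simp add: powr_minus powr_divide)
    finally show ?thesis by (simp only: of_real_eq_iff)
  qed
  finally show ?thesis .
qed

lemma nn_integral_gaussian_convolution:
  fixes a b :: real and z :: "'a::euclidean_space"
  assumes a: "a > 0" and b: "b > 0"
  shows "(\<integral>\<^sup>+x. ennreal (exp (- (a * (norm (z - x))\<^sup>2)) * exp (- (b * (norm x)\<^sup>2))) \<partial>lborel)
     = ennreal ((pi / (a + b)) powr (DIM('a) / 2) * exp (- (a * b / (a + b) * (norm z)\<^sup>2)))"
proof -
  \<comment> \<open>Completing the square in x: the exponent is a Gaussian centred at the weighted
    mean a z / (a + b), plus a term free of x.\<close>
  have sq: "a * (norm (z - x))\<^sup>2 + b * (norm x)\<^sup>2 = (a + b) * (norm (x - (a / (a + b)) *\<^sub>R z))\<^sup>2 + a * b / (a + b) * (norm z)\<^sup>2" for x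
  proof -
    have ab: "a + b \<noteq> 0" using a b by simp
    define X where "X = x \<bullet> x" define Z where "Z = z \<bullet> z" define Y where "Y = x \<bullet> z"
    have "a * (Z - 2 * Y + X) + b * X = (a + b) * (X - 2 * (a / (a+b)) * Y + (a/(a+b)) * (a/(a+b)) * Z) + a * b / (a+b) * Z"
      using ab by (simp add: divide_simps) algebra
    then show ?thesis
      by (simp add: power2_norm_eq_inner inner_diff_left inner_diff_right X_def Y_def Z_def inner_commute algebra_simps)
  qed
  have "(\<integral>\<^sup>+x. ennreal (exp (- (a * (norm (z - x))\<^sup>2)) * exp (- (b * (norm x)\<^sup>2))) \<partial>lborel)
      = (\<integral>\<^sup>+x. ennreal (exp (- ((a + b) * (norm (x - (a / (a + b)) *\<^sub>R z))\<^sup>2))) * ennreal (exp (- (a * b / (a + b) * (norm z)\<^sup>2))) \<partial>lborel)"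
  proof (intro nn_integral_cong)
    fix x :: 'a
    have "exp (- (a * (norm (z - x))\<^sup>2)) * exp (- (b * (norm x)\<^sup>2)) =
        exp (- ((a + b) * (norm (x - (a / (a + b)) *\<^sub>R z))\<^sup>2)) * exp (- (a * b / (a + b) * (norm z)\<^sup>2))"
      unfolding exp_add[symmetric] using sq[of x] by (intro arg_cong[where f=exp]) linarith
    then show "ennreal (exp (- (a * (norm (z - x))\<^sup>2)) * exp (- (b * (norm x)\<^sup>2))) =
        ennreal (exp (- ((a + b) * (norm (x - (a / (a + b)) *\<^sub>R z))\<^sup>2))) * ennreal (exp (- (a * b / (a + b) * (norm z)\<^sup>2)))"
      by (simp only: ennreal_mult'[OF exp_ge_zero])
  qed
  also have "\<dots> = ennreal ((pi / (a + b)) powr (DIM('a) / 2)) * ennreal (exp (- (a * b / (a + b) * (norm z)\<^sup>2)))"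
    using a b by (subst nn_integral_multc) (auto simp: nn_integral_gaussian)
  finally show ?thesis by (simp add: ennreal_mult')
qed

text \<open>Multiply by Gamma (p + q), write Gamma (p + q) (1 + v)^(-p - q) as the integral of s^(p
  + q - 1) exp (- (1 + v) s), and exchange: the v-integral gives Gamma p s^(-p), the s-integral then
  gives Gamma q.\<close>

lemma nn_integral_Beta_half_line:
  fixes p q :: real
  assumes p: "p > 0" and q: "q > 0"
  shows "(\<integral>\<^sup>+v\<in>{0<..}. ennreal (v powr (p - 1) * (1 + v) powr - (p + q)) \<partial>lborel)
    = ennreal (Gamma p * Gamma q / Gamma (p + q))"
proof -
  let ?I = "\<integral>\<^sup>+v\<in>{0<..}. ennreal (v powr (p - 1) * (1 + v) powr - (p + q)) \<partial>lborel"
  define h where "h v s = ennreal (v powr (p - 1) * (s powr (p + q - 1) * exp (- ((1 + v) * s))))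
      * indicator {0<..} v * indicator {0<..} s" for v s :: real
  have hm[measurable]: "(\<lambda>(v, s). h v s) \<in> borel_measurable (lborel \<Otimes>\<^sub>M lborel)"
    unfolding h_def by measurable
  have "ennreal (Gamma (p + q)) * ?I = (\<integral>\<^sup>+v. ennreal (Gamma (p + q)) * (ennreal (v powr (p - 1) * (1 + v) powr - (p + q)) * indicator {0<..} v) \<partial>lborel)"
    by (subst nn_integral_cmult) auto
  also have "\<dots> = (\<integral>\<^sup>+v. (\<integral>\<^sup>+s. h v s \<partial>lborel) \<partial>lborel)"
  proof (intro nn_integral_cong)
    fix v :: real
    show "ennreal (Gamma (p + q)) * (ennreal (v powr (p - 1) * (1 + v) powr - (p + q)) * indicator {0<..} v) = (\<integral>\<^sup>+s. h v s \<partial>lborel)"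
    proof (cases "v > 0")
      case True
      have "(\<integral>\<^sup>+s. h v s \<partial>lborel) = (\<integral>\<^sup>+s. ennreal (v powr (p - 1)) * (ennreal (s powr (p + q - 1) * exp (- ((1 + v) * s))) * indicator {0<..} s) \<partial>lborel)"
        using True by (intro nn_integral_cong) (auto simp: h_def indicator_def ennreal_mult')
      also have "\<dots> = ennreal (v powr (p - 1)) * ennreal (Gamma (p + q) * (1 + v) powr - (p + q))"
        using True p q nn_integral_Gamma_scaled[of "p + q" "1 + v"] by (subst nn_integral_cmult) auto
      finally show ?thesis
        using True p q by (simp add: ennreal_mult'[symmetric] mult_ac)
    qed (auto simp: h_def)
  qed
  also have "\<dots> = (\<integral>\<^sup>+s. (\<integral>\<^sup>+v. h v s \<partial>lborel) \<partial>lborel)"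
    by (rule lborel_pair.Fubini'[symmetric]) fact
  also have "\<dots> = (\<integral>\<^sup>+s. ennreal (Gamma p) * (ennreal (s powr (q - 1) * exp (- (1 * s))) * indicator {0<..} s) \<partial>lborel)"
  proof (intro nn_integral_cong)
    fix s :: real
    show "(\<integral>\<^sup>+v. h v s \<partial>lborel) = ennreal (Gamma p) * (ennreal (s powr (q - 1) * exp (- (1 * s))) * indicator {0<..} s)"
    proof (cases "s > 0")
      case True
      have "(\<integral>\<^sup>+v. h v s \<partial>lborel) = (\<integral>\<^sup>+v. ennreal (s powr (p + q - 1) * exp (- s)) * (ennreal (v powr (p - 1) * exp (- (s * v))) * indicator {0<..} v) \<partial>lborel)"
        using True by (intro nn_integral_cong) (auto simp: h_def indicator_def ennreal_mult'[symmetric] ring_distribs exp_add exp_diff exp_minus field_simps)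
      also have "\<dots> = ennreal (s powr (p + q - 1) * exp (- s)) * ennreal (Gamma p * s powr - p)"
        using True p nn_integral_Gamma_scaled[of p s] by (subst nn_integral_cmult) auto
      also have "\<dots> = ennreal ((s powr (p + q - 1) * exp (- s)) * (Gamma p * s powr - p))"
        by (intro ennreal_mult'[symmetric]) simp
      also have "(s powr (p + q - 1) * exp (- s)) * (Gamma p * s powr - p) = Gamma p * (s powr (q - 1) * exp (- (1 * s)))"
      proof -
        have x: "s powr (q - 1) = s powr (p + q - 1) * s powr - p"
          by (simp add: powr_add[symmetric])
        show ?thesis unfolding x by (simp add: mult_ac)
      qed
      also have "ennreal \<dots> = ennreal (Gamma p) * ennreal (s powr (q - 1) * exp (- (1 * s)))"
        using p by (intro ennreal_mult') (simp add: less_imp_le Gamma_real_pos)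
      finally show ?thesis using True by simp
    qed (auto simp: h_def)
  qed
  also have "\<dots> = ennreal (Gamma p) * ennreal (Gamma q)"
    using q nn_integral_Gamma_scaled[of q 1] by (subst nn_integral_cmult) auto
  finally have *: "ennreal (Gamma (p + q)) * ?I = ennreal (Gamma p * Gamma q)"
    using p q by (simp add: ennreal_mult' Gamma_real_pos less_imp_le)
  have G: "Gamma (p + q) > 0" using p q by (simp add: Gamma_real_pos)
  then have "?I = ennreal (1 / Gamma (p + q)) * (ennreal (Gamma (p + q)) * ?I)"
    by (simp add: mult.assoc[symmetric] ennreal_mult'[symmetric])
  also have "\<dots> = ennreal (Gamma p * Gamma q / Gamma (p + q))"
    unfolding * using G by (subst ennreal_mult'[symmetric]) auto
  finally show ?thesis .
qed

text \<open>The Fourier transform of the Gaussian exp (- pi l |t|^2) at \<open>z\<close>, that is,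
  the heat kernel at time l / (4 pi). As l tends to 0 it concentrates at 0 with mass 1; integrated
  against l^(\<alpha>/2 - 1) with \<alpha> < n it gives a multiple of the Riesz kernel |z|^(\<alpha>
  - n).\<close>

definition gker :: "real \<Rightarrow> 'a::euclidean_space \<Rightarrow> real" where
  "gker l z = l powr (- real DIM('a) / 2) * exp (- (pi * (norm z)\<^sup>2 / l))"

lemma gker_nonneg [simp]: "gker l z \<ge> 0"
  by (simp add: gker_def)

lemma borel_measurable_gker [measurable]:
  assumes [measurable]: "f \<in> borel_measurable M" "g \<in> M \<rightarrow>\<^sub>M borel"
  shows "(\<lambda>x. gker (f x) (g x :: 'a::euclidean_space)) \<in> borel_measurable M"
  unfolding gker_def by measurable

lemma gker_sym: "gker l (x - y) = gker l (y - x)"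
  by (simp add: gker_def norm_minus_commute)

lemma nn_integral_gker:
  fixes z :: "'a::euclidean_space"
  assumes l: "l > 0"
  shows "(\<integral>\<^sup>+x. ennreal (gker l (z - x)) \<partial>lborel) = 1"
proof -
  have "(\<integral>\<^sup>+x. ennreal (gker l (z - x)) \<partial>lborel) = (\<integral>\<^sup>+x. ennreal (l powr (- real DIM('a) / 2)) * ennreal (exp (- (pi / l * (norm (x - z))\<^sup>2))) \<partial>lborel)"
    by (intro nn_integral_cong) (simp add: gker_def ennreal_mult' norm_minus_commute)
  also have "\<dots> = ennreal (l powr (- real DIM('a) / 2)) * ennreal ((pi / (pi / l)) powr (DIM('a) / 2))"
    using l nn_integral_gaussian[of "pi / l" z] by (subst nn_integral_cmult) auto
  also have "\<dots> = 1"
    using l by (simp add: ennreal_mult'[symmetric] powr_add[symmetric])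
  finally show ?thesis .
qed

text \<open>Parameters combine as for independent normal variables: reciprocals add to 1/m + l,
  whence the new parameter m / (1 + l m) in the exponent.\<close>

lemma nn_integral_gker_gaussian:
  fixes z :: "'a::euclidean_space"
  assumes l: "l > 0" and m: "m > 0"
  shows "(\<integral>\<^sup>+x. ennreal (gker l (z - x) * exp (- (pi * m * (norm x)\<^sup>2))) \<partial>lborel)
    = ennreal ((1 + l * m) powr (- real DIM('a) / 2) * exp (- (pi * m * (norm z)\<^sup>2 / (1 + l * m))))"
proof -
  have lm: "l * m > 0" using l m by simp
  have pos: "pi / l > 0" "pi * m > 0" using l m by auto
  have "(\<integral>\<^sup>+x. ennreal (gker l (z - x) * exp (- (pi * m * (norm x)\<^sup>2))) \<partial>lborel)
     = (\<integral>\<^sup>+x. ennreal (l powr (- real DIM('a) / 2)) * ennreal (exp (- (pi / l * (norm (z - x))\<^sup>2)) * exp (- (pi * m * (norm x)\<^sup>2))) \<partial>lborel)"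
    by (intro nn_integral_cong) (simp add: gker_def ennreal_mult'[symmetric] mult_ac)
  also have "\<dots> = ennreal (l powr (- real DIM('a) / 2)) * ennreal ((pi / (pi / l + pi * m)) powr (DIM('a) / 2) * exp (- ((pi / l) * (pi * m) / (pi / l + pi * m) * (norm z)\<^sup>2)))"
    using nn_integral_gaussian_convolution[OF pos, of z] by (subst nn_integral_cmult) (auto simp del: times_divide_eq_left times_divide_eq_right)
  also have sum: "pi / l + pi * m = pi * (1 + l * m) / l" using l by (simp add: field_simps)
  also have "pi / (pi * (1 + l * m) / l) = l / (1 + l * m)"
    by simp
  also have "(pi / l) * (pi * m) / (pi * (1 + l * m) / l) * (norm z)\<^sup>2 = pi * m * (norm z)\<^sup>2 / (1 + l * m)"
    using l lm by simp
  also have "(l / (1 + l * m)) powr (DIM('a) / 2) = l powr (DIM('a) / 2) * (1 + l * m) powr (- real DIM('a) / 2)"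
    using l lm by (simp add: powr_divide powr_minus field_simps)
  finally have *: "(\<integral>\<^sup>+x. ennreal (gker l (z - x) * exp (- (pi * m * (norm x)\<^sup>2))) \<partial>lborel) =
    ennreal (l powr (- real DIM('a) / 2) * (l powr (DIM('a) / 2) * (1 + l * m) powr (- real DIM('a) / 2) * exp (- (pi * m * (norm z)\<^sup>2 / (1 + l * m)))))"
    by (subst ennreal_mult') auto
  have "l powr (- real DIM('a) / 2) * l powr (DIM('a) / 2) = 1"
    using l by (simp add: powr_add[symmetric])
  then show ?thesis
    unfolding * by (simp add: mult.assoc[symmetric])
qed

text \<open>The weight of the Schur test, \<open>|x|\<close> to the power \<open>- (n + \<alpha>) / 2\<close>; the constant makes it a
  superposition of Gaussians.\<close>

definition riesz_weight :: "real \<Rightarrow> 'a::euclidean_space \<Rightarrow> real" where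
  "riesz_weight \<alpha> x = Gamma ((real DIM('a) + \<alpha>) / 4) * (pi * (norm x)\<^sup>2) powr (- ((real DIM('a) + \<alpha>) / 4))"

lemma borel_measurable_riesz_weight [measurable]: "riesz_weight \<alpha> \<in> borel_measurable borel"
  unfolding riesz_weight_def by measurable

lemma riesz_weight_pos:
  fixes x :: "'a::euclidean_space"
  assumes "\<alpha> > 0" "x \<noteq> 0" shows "riesz_weight \<alpha> x > 0"
proof -
  have "(real DIM('a) + \<alpha>) / 4 > 0"
    using assms by (auto intro!: add_nonneg_pos divide_pos_pos)
  then show ?thesis
  using assms by (simp add: riesz_weight_def Gamma_real_pos)
qed

lemma riesz_weight_eq:
  fixes x :: "'a::euclidean_space"
  assumes "\<alpha> > 0" "x \<noteq> 0"
  shows "ennreal (riesz_weight \<alpha> x) =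
    (\<integral>\<^sup>+m\<in>{0<..}. ennreal (m powr ((real DIM('a) + \<alpha>) / 4 - 1) * exp (- (pi * m * (norm x)\<^sup>2))) \<partial>lborel)"
proof -
  have "(real DIM('a) + \<alpha>) / 4 > 0" "pi * (norm x)\<^sup>2 > 0"
    using assms by (auto intro!: add_nonneg_pos divide_pos_pos)
  from nn_integral_Gamma_scaled[OF this] show ?thesis
    by (simp add: riesz_weight_def mult_ac)
qed

text \<open>With the weight written as Gaussians of parameter m, the convolution with
  \<open>gker l\<close> is explicit and a double integral in l and m is left. In the variables v = l
  m and m, the m-integral is a Gamma integral and the remaining v-integral a Beta integral; each
  contributes one factor Gamma ((n - \<alpha>) / 4).\<close>

lemma nn_integral_gker_riesz_weight:
  fixes z :: "'a::euclidean_space" and \<alpha> :: real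
  assumes a: "0 < \<alpha>" "\<alpha> < DIM('a)" and z: "z \<noteq> 0"
  shows "(\<integral>\<^sup>+l\<in>{0<..}. ennreal (l powr (\<alpha> / 2 - 1)) * (\<integral>\<^sup>+x. ennreal (gker l (z - x) * riesz_weight \<alpha> x) \<partial>lborel) \<partial>lborel)
    = ennreal (Gamma (\<alpha> / 2) * (Gamma ((real DIM('a) - \<alpha>) / 4))\<^sup>2 / Gamma ((real DIM('a) + \<alpha>) / 4) * (pi * (norm z)\<^sup>2) powr (- ((real DIM('a) - \<alpha>) / 4)))"
proof -
  define n where "n = real DIM('a)"
  have n: "n > 0" "\<alpha> < n" using a by (auto simp: n_def)
  define p where "p = \<alpha> / 2"
  define r where "r = (n + \<alpha>) / 4"
  define q where "q = (n - \<alpha>) / 4"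
  have pos: "p > 0" "r > 0" "q > 0" and pq: "p + q = r" "r - p = q" "n / 2 = q + r" using n a by (auto simp: p_def q_def r_def field_simps)
  define N where "N = pi * (norm z)\<^sup>2"
  have N: "N > 0" using z by (simp add: N_def)
  define I where "I = (indicator {0<..} :: real \<Rightarrow> ennreal)"
  have [measurable]: "I \<in> borel_measurable borel" by (simp add: I_def)
  define h where "h l m = I l * I m * ennreal (l powr (p - 1) * (m powr (r - 1) * ((1 + l * m) powr - (n / 2) * exp (- (m * N / (1 + l * m))))))" for l m
  have hm[measurable]: "(\<lambda>(l, m). h l m) \<in> borel_measurable (lborel \<Otimes>\<^sub>M lborel)"
    unfolding h_def by measurable
  define k where "k v m = I v * I m * ennreal (v powr (p - 1) * ((1 + v) powr - (n / 2) * (m powr (q - 1) * exp (- (N / (1 + v) * m)))))" for v m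
  have km[measurable]: "(\<lambda>(v, m). k v m) \<in> borel_measurable (lborel \<Otimes>\<^sub>M lborel)"
    unfolding k_def by measurable
  have inner: "(\<integral>\<^sup>+x. ennreal (gker l (z - x) * riesz_weight \<alpha> x) \<partial>lborel) = (\<integral>\<^sup>+m. ennreal (m powr (r - 1) * ((1 + l * m) powr - (n / 2) * exp (- (m * N / (1 + l * m))))) * I m \<partial>lborel)"
    if l: "l > 0" for l
  proof -
    have "(\<integral>\<^sup>+x. ennreal (gker l (z - x) * riesz_weight \<alpha> x) \<partial>lborel)
      = (\<integral>\<^sup>+x. (\<integral>\<^sup>+m. ennreal (gker l (z - x)) * (ennreal (m powr (r - 1) * exp (- (pi * m * (norm x)\<^sup>2))) * I m) \<partial>lborel) \<partial>lborel)"
    \<comment> \<open>The origin has to be left out: \<open>riesz_weight \<alpha> 0\<close> is 0,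
      since \<open>0 powr y = 0\<close>, whereas the superposition of Gaussians diverges
      there.\<close>
    proof (intro nn_integral_cong_AE eventually_mono[OF AE_lborel_singleton[of "0::'a"]])
      fix x :: 'a assume "x \<noteq> 0"
      then show "ennreal (gker l (z - x) * riesz_weight \<alpha> x) = (\<integral>\<^sup>+m. ennreal (gker l (z - x)) * (ennreal (m powr (r - 1) * exp (- (pi * m * (norm x)\<^sup>2))) * I m) \<partial>lborel)"
        using a(1) by (subst nn_integral_cmult) (auto simp: ennreal_mult' riesz_weight_eq r_def n_def I_def)
    qed
    also have "\<dots> = (\<integral>\<^sup>+m. (\<integral>\<^sup>+x. ennreal (gker l (z - x)) * (ennreal (m powr (r - 1) * exp (- (pi * m * (norm x)\<^sup>2))) * I m) \<partial>lborel) \<partial>lborel)"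
      by (rule lborel_pair.Fubini'[symmetric]) measurable
    also have "\<dots> = (\<integral>\<^sup>+m. ennreal (m powr (r - 1) * ((1 + l * m) powr - (n / 2) * exp (- (m * N / (1 + l * m))))) * I m \<partial>lborel)"
    proof (intro nn_integral_cong)
      fix m :: real
      show "(\<integral>\<^sup>+x. ennreal (gker l (z - x)) * (ennreal (m powr (r - 1) * exp (- (pi * m * (norm x)\<^sup>2))) * I m) \<partial>lborel) =
        ennreal (m powr (r - 1) * ((1 + l * m) powr - (n / 2) * exp (- (m * N / (1 + l * m))))) * I m"
      proof (cases "m > 0")
        case True
        have "(\<integral>\<^sup>+x. ennreal (gker l (z - x)) * (ennreal (m powr (r - 1) * exp (- (pi * m * (norm x)\<^sup>2))) * I m) \<partial>lborel)
         = (\<integral>\<^sup>+x. ennreal (m powr (r - 1)) * ennreal (gker l (z - x) * exp (- (pi * m * (norm x)\<^sup>2))) \<partial>lborel)"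
          using True by (intro nn_integral_cong) (auto simp: I_def ennreal_mult' mult_ac)
        also have "\<dots> = ennreal (m powr (r - 1)) * ennreal ((1 + l * m) powr (- (n / 2)) * exp (- (m * N / (1 + l * m))))"
          using nn_integral_gker_gaussian[OF l True, of z] by (subst nn_integral_cmult) (auto simp: n_def N_def mult_ac)
        finally show ?thesis using True by (simp add: I_def ennreal_mult')
      qed (auto simp: I_def)
    qed
    finally show ?thesis .
  qed
  \<comment> \<open>Substituting l = v / m turns 1 + l m into 1 + v, so that m survives only in a
    power and an exponential.\<close>
  have sub: "(\<integral>\<^sup>+l. h l m \<partial>lborel) = (\<integral>\<^sup>+v. k v m \<partial>lborel)" for m
  proof (cases "m > 0")
    case True
    have "(\<integral>\<^sup>+l. h l m \<partial>lborel) = \<bar>1 / m\<bar> * (\<integral>\<^sup>+v. h (0 + 1 / m * v) m \<partial>lborel)"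
      using True by (intro nn_integral_real_affine) auto
    also have "\<dots> = (\<integral>\<^sup>+v. ennreal \<bar>1 / m\<bar> * h (0 + 1 / m * v) m \<partial>lborel)"
      by (subst nn_integral_cmult) auto
    also have "\<dots> = (\<integral>\<^sup>+v. k v m \<partial>lborel)"
    proof (intro nn_integral_cong)
      fix v :: real
      show "ennreal \<bar>1 / m\<bar> * h (0 + 1 / m * v) m = k v m"
      proof (cases "v > 0")
        case v: True
        have "\<bar>1 / m\<bar> * ((1 / m * v) powr (p - 1) * (m powr (r - 1) * ((1 + 1 / m * v * m) powr - (n / 2) * exp (- (m * N / (1 + 1 / m * v * m))))))
          = v powr (p - 1) * ((1 + v) powr - (n / 2) * (m powr (q - 1) * exp (- (N / (1 + v) * m))))"
        proof -
          have e1: "\<bar>1 / m\<bar> * (1 / m) powr (p - 1) * m powr (r - 1) = m powr (q - 1)"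
          proof -
            have "\<bar>1 / m\<bar> = m powr (- 1)" "(1 / m) powr (p - 1) = m powr (- (p - 1))"
              using True by (simp_all add: powr_minus_divide powr_divide del: minus_diff_eq)
            then have "\<bar>1 / m\<bar> * (1 / m) powr (p - 1) * m powr (r - 1) = m powr (- 1 + - (p - 1) + (r - 1))"
              by (simp only: powr_add)
            moreover have "- 1 + - (p - 1) + (r - 1) = q - 1"
              using pq by simp
            ultimately show ?thesis
              by (simp only:)
          qed
          have e2: "(1 / m * v) powr (p - 1) = (1 / m) powr (p - 1) * v powr (p - 1)"
            using True v by (subst powr_mult) auto
          have e3: "1 + 1 / m * v * m = 1 + v" using True by simp
          have "\<bar>1 / m\<bar> * ((1 / m * v) powr (p - 1) * (m powr (r - 1) * ((1 + 1 / m * v * m) powr - (n / 2) * exp (- (m * N / (1 + 1 / m * v * m))))))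
            = (\<bar>1 / m\<bar> * (1 / m) powr (p - 1) * m powr (r - 1)) * (v powr (p - 1) * ((1 + v) powr - (n / 2) * exp (- (m * N / (1 + v)))))"
            unfolding e2 e3 by (simp only: mult_ac)
          then show ?thesis unfolding e1 by (simp add: mult_ac)
        qed
        then show ?thesis using True v unfolding h_def k_def by (simp add: I_def ennreal_mult'[symmetric])
      qed (use True in \<open>auto simp: h_def k_def I_def zero_less_divide_iff\<close>)
    qed
    finally show ?thesis .
  qed (auto simp: h_def k_def I_def)
  have "(\<integral>\<^sup>+l\<in>{0<..}. ennreal (l powr (\<alpha> / 2 - 1)) * (\<integral>\<^sup>+x. ennreal (gker l (z - x) * riesz_weight \<alpha> x) \<partial>lborel) \<partial>lborel)
     = (\<integral>\<^sup>+l. (\<integral>\<^sup>+m. h l m \<partial>lborel) \<partial>lborel)"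
  proof (intro nn_integral_cong)
    fix l :: real
    show "ennreal (l powr (\<alpha> / 2 - 1)) * (\<integral>\<^sup>+x. ennreal (gker l (z - x) * riesz_weight \<alpha> x) \<partial>lborel) * indicator {0<..} l = (\<integral>\<^sup>+m. h l m \<partial>lborel)"
    proof (cases "l > 0")
      case True
      then have "(\<integral>\<^sup>+m. h l m \<partial>lborel) = (\<integral>\<^sup>+m. ennreal (l powr (p - 1)) * (ennreal (m powr (r - 1) * ((1 + l * m) powr - (n / 2) * exp (- (m * N / (1 + l * m))))) * I m) \<partial>lborel)"
        by (intro nn_integral_cong) (auto simp: h_def I_def ennreal_mult' indicator_def)
      also have "\<dots> = ennreal (l powr (p - 1)) * (\<integral>\<^sup>+m. ennreal (m powr (r - 1) * ((1 + l * m) powr - (n / 2) * exp (- (m * N / (1 + l * m))))) * I m \<partial>lborel)"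
        by (subst nn_integral_cmult) auto
      finally show ?thesis using True by (simp add: inner p_def)
    qed (auto simp: h_def I_def)
  qed
  also have "\<dots> = (\<integral>\<^sup>+m. (\<integral>\<^sup>+l. h l m \<partial>lborel) \<partial>lborel)"
    by (rule lborel_pair.Fubini'[symmetric]) fact
  also have "\<dots> = (\<integral>\<^sup>+m. (\<integral>\<^sup>+v. k v m \<partial>lborel) \<partial>lborel)"
    by (simp add: sub)
  also have "\<dots> = (\<integral>\<^sup>+v. (\<integral>\<^sup>+m. k v m \<partial>lborel) \<partial>lborel)"
    by (rule lborel_pair.Fubini') fact
  also have "\<dots> = (\<integral>\<^sup>+v. ennreal (Gamma q * N powr - q) * (ennreal (v powr (p - 1) * (1 + v) powr - (p + q)) * indicator {0<..} v) \<partial>lborel)"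
  proof (intro nn_integral_cong)
    fix v :: real
    show "(\<integral>\<^sup>+m. k v m \<partial>lborel) = ennreal (Gamma q * N powr - q) * (ennreal (v powr (p - 1) * (1 + v) powr - (p + q)) * indicator {0<..} v)"
    proof (cases "v > 0")
      case True
      have "(\<integral>\<^sup>+m. k v m \<partial>lborel) = (\<integral>\<^sup>+m. ennreal (v powr (p - 1) * (1 + v) powr - (n / 2)) * (ennreal (m powr (q - 1) * exp (- (N / (1 + v) * m))) * indicator {0<..} m) \<partial>lborel)"
        using True by (intro nn_integral_cong) (auto simp: k_def I_def indicator_def ennreal_mult'[symmetric] mult_ac)
      also have "\<dots> = ennreal (v powr (p - 1) * (1 + v) powr - (n / 2)) * ennreal (Gamma q * (N / (1 + v)) powr - q)"
        using True pos N nn_integral_Gamma_scaled[of q "N / (1 + v)"] by (subst nn_integral_cmult) auto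
      also have "\<dots> = ennreal ((v powr (p - 1) * (1 + v) powr - (n / 2)) * (Gamma q * (N / (1 + v)) powr - q))"
        by (rule ennreal_mult'[symmetric]) simp
      also have "(v powr (p - 1) * (1 + v) powr - (n / 2)) * (Gamma q * (N / (1 + v)) powr - q) = Gamma q * N powr - q * (v powr (p - 1) * (1 + v) powr - (p + q))"
      proof -
        have "(N / (1 + v)) powr - q = N powr - q * (1 + v) powr q"
          using True N by (simp add: powr_divide powr_minus field_simps)
        moreover have "(1 + v) powr - (n / 2) * (1 + v) powr q = (1 + v) powr - (p + q)"
        proof -
          have "- (n / 2) + q = - (p + q)" using pq by linarith
          then show ?thesis by (simp only: powr_add[symmetric])
        qed
        ultimately show ?thesis by (simp add: mult_ac)
      qed
      also have "ennreal \<dots> = ennreal (Gamma q * N powr - q) * ennreal (v powr (p - 1) * (1 + v) powr - (p + q))"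
        using pos by (intro ennreal_mult') (simp add: less_imp_le Gamma_real_pos)
      finally show ?thesis using True by simp
    qed (auto simp: k_def I_def)
  qed
  also have "\<dots> = ennreal (Gamma q * N powr - q) * ennreal (Gamma p * Gamma q / Gamma (p + q))"
    using pos nn_integral_Beta_half_line[of p q] by (subst nn_integral_cmult) auto
  also have "\<dots> = ennreal ((Gamma q * N powr - q) * (Gamma p * Gamma q / Gamma (p + q)))"
    using pos by (intro ennreal_mult'[symmetric]) (simp add: less_imp_le Gamma_real_pos)
  finally show ?thesis unfolding pq(1) by (simp add: p_def q_def r_def N_def n_def power2_eq_square mult_ac)
qed

subsection \<open>The Schur test and Pitt's inequality\<close>

lemma nn_integral_Fatou_bound:
  assumes [measurable]: "\<And>k. u k \<in> borel_measurable M"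
    and lim: "AE x in M. (\<lambda>k. u k x) \<longlonglongrightarrow> v x"
    and le: "\<And>k::nat. (\<integral>\<^sup>+x. u k x \<partial>M) \<le> C k" and C: "C \<longlonglongrightarrow> c"
  shows "(\<integral>\<^sup>+x. v x \<partial>M) \<le> c"
proof -
  have "(\<integral>\<^sup>+x. v x \<partial>M) = (\<integral>\<^sup>+x. liminf (\<lambda>k. u k x) \<partial>M)"
    by (intro nn_integral_cong_AE eventually_mono[OF lim]) (simp add: lim_imp_Liminf)
  also have "\<dots> \<le> liminf (\<lambda>k. \<integral>\<^sup>+x. u k x \<partial>M)"
    by (rule nn_integral_liminf) simp
  also have "\<dots> \<le> liminf C"
    by (intro Liminf_mono always_eventually allI le)
  also have "\<dots> = c"
    using C by (simp add: lim_imp_Liminf)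
  finally show ?thesis .
qed

text \<open>The inequality 2 u(x) u(y) \<le> u(x)^2 w(y) / w(x) + u(y)^2 w(x) / w(y) is a square,
  and by the symmetry of \<open>K\<close> its two halves have the same double integral. The bound is
  useful for a weight on which the kernel acts explicitly.\<close>

lemma schur_test:
  fixes K :: "'a::euclidean_space \<Rightarrow> 'a \<Rightarrow> real" and u w :: "'a \<Rightarrow> real"
  assumes Km: "(\<lambda>(x, y). K x y) \<in> borel_measurable (lborel \<Otimes>\<^sub>M lborel)"
    and [measurable]: "u \<in> borel_measurable borel" "w \<in> borel_measurable borel"
    and K: "\<And>x y. K x y \<ge> 0" "\<And>x y. K x y = K y x"
    and u: "\<And>x. u x \<ge> 0" and w: "AE x in lborel. w x > 0"
  shows "(\<integral>\<^sup>+x. (\<integral>\<^sup>+y. ennreal (u x * u y * K x y) \<partial>lborel) \<partial>lborel)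
     \<le> (\<integral>\<^sup>+x. ennreal ((u x)\<^sup>2 / w x) * (\<integral>\<^sup>+y. ennreal (K x y * w y) \<partial>lborel) \<partial>lborel)"
proof -
  note Km[measurable]
  have Kx[measurable]: "(\<lambda>y. K x y) \<in> borel_measurable borel" for x
    using measurable_compose[OF measurable_Pair1' Km, of x] by simp
  define A where "A x y = ennreal ((u x)\<^sup>2 / w x * (K x y * w y))" for x y
  have Am[measurable]: "(\<lambda>(x, y). A x y) \<in> borel_measurable (lborel \<Otimes>\<^sub>M lborel)"
    unfolding A_def by measurable
  let ?T = "\<integral>\<^sup>+x. (\<integral>\<^sup>+y. A x y \<partial>lborel) \<partial>lborel"
  have "(\<integral>\<^sup>+x. (\<integral>\<^sup>+y. ennreal (u x * u y * K x y) \<partial>lborel) \<partial>lborel)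
    \<le> (\<integral>\<^sup>+x. (\<integral>\<^sup>+y. ennreal (1/2) * A x y + ennreal (1/2) * A y x \<partial>lborel) \<partial>lborel)"
  proof (rule nn_integral_mono_AE, use w in eventually_elim, rule nn_integral_mono_AE, use w in eventually_elim)
    fix x y :: 'a assume wx: "w x > 0" and wy: "w y > 0"
    have "0 \<le> (u x * w y - u y * w x)\<^sup>2" by simp
    then have "2 * (u x * u y) \<le> (u x)\<^sup>2 * w y / w x + (u y)\<^sup>2 * w x / w y"
      using wx wy by (simp add: field_simps power2_eq_square)
    then have "K x y * (2 * (u x * u y)) \<le> K x y * ((u x)\<^sup>2 * w y / w x + (u y)\<^sup>2 * w x / w y)"
      using K(1) by (rule mult_left_mono)
    moreover have "1/2 * ((u x)\<^sup>2 / w x * (K x y * w y)) + 1/2 * ((u y)\<^sup>2 / w y * (K y x * w x))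
       = 1/2 * (K x y * ((u x)\<^sup>2 * w y / w x + (u y)\<^sup>2 * w x / w y))"
      unfolding K(2)[of y x] by (simp add: algebra_simps)
    moreover have "u x * u y * K x y = 1/2 * (K x y * (2 * (u x * u y)))"
      by simp
    ultimately have "u x * u y * K x y \<le> 1/2 * ((u x)\<^sup>2 / w x * (K x y * w y)) + 1/2 * ((u y)\<^sup>2 / w y * (K y x * w x))"
      by (simp only: mult_le_cancel_left_pos[of "1/2::real"])
    then have "ennreal (u x * u y * K x y) \<le> ennreal (1/2 * ((u x)\<^sup>2 / w x * (K x y * w y)) + 1/2 * ((u y)\<^sup>2 / w y * (K y x * w x)))"
      by (rule ennreal_leI)
    also have "\<dots> = ennreal (1/2) * A x y + ennreal (1/2) * A y x"
      using wx wy K(1) unfolding A_def by (subst ennreal_plus) (auto simp: ennreal_mult'[symmetric] simp del: ennreal_half)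
    finally show "ennreal (u x * u y * K x y) \<le> ennreal (1/2) * A x y + ennreal (1/2) * A y x" .
  qed
  also have "\<dots> = ennreal (1/2) * ?T + ennreal (1/2) * (\<integral>\<^sup>+x. (\<integral>\<^sup>+y. A y x \<partial>lborel) \<partial>lborel)"
    by (simp add: nn_integral_add nn_integral_cmult)
  also have "(\<integral>\<^sup>+x. (\<integral>\<^sup>+y. A y x \<partial>lborel) \<partial>lborel) = ?T"
    by (rule lborel_pair.Fubini') fact
  also have "ennreal (1/2) * ?T + ennreal (1/2) * ?T = ?T"
  proof -
    have "ennreal (1/2) * ?T + ennreal (1/2) * ?T = (ennreal (1/2) + ennreal (1/2)) * ?T"
      by (simp only: distrib_right)
    also have "ennreal (1/2) + ennreal (1/2) = 1"
      by (subst ennreal_plus[symmetric]) auto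
    finally show ?thesis by simp
  qed
  also have "?T = (\<integral>\<^sup>+x. ennreal ((u x)\<^sup>2 / w x) * (\<integral>\<^sup>+y. ennreal (K x y * w y) \<partial>lborel) \<partial>lborel)"
  proof (rule nn_integral_cong_AE, use w in eventually_elim)
    fix x assume "w x > 0"
    then show "(\<integral>\<^sup>+y. A x y \<partial>lborel) = ennreal ((u x)\<^sup>2 / w x) * (\<integral>\<^sup>+y. ennreal (K x y * w y) \<partial>lborel)"
      unfolding A_def by (subst nn_integral_cmult[symmetric]) (auto intro!: nn_integral_cong simp: ennreal_mult'[symmetric])
  qed
  finally show ?thesis .
qed

text \<open>The sign is that of the inverse transform, because the shearlet transform is recovered
  from its spectrum; \<open>fourier\<close> is this integral taken at - \<xi>. The measure is
  \<open>lborel\<close>, where Borel measurability and the product theorems apply directly.\<close>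

definition ift :: "('a::euclidean_space \<Rightarrow> complex) \<Rightarrow> 'a \<Rightarrow> complex" where
  "ift G t = (LINT x|lborel. G x * cis (2 * pi * (x \<bullet> t)))"

lemma borel_measurable_ift [measurable]:
  assumes [measurable]: "G \<in> borel_measurable borel"
  shows "ift G \<in> borel_measurable borel"
  unfolding ift_def by measurable

lemma integrable_mult_cis:
  fixes G :: "'a::euclidean_space \<Rightarrow> complex"
  assumes G: "integrable lborel G" and [measurable]: "h \<in> borel_measurable borel"
  shows "integrable lborel (\<lambda>x. G x * cis (h x))"
  using borel_measurable_integrable[OF G]
  by (intro Bochner_Integration.integrable_bound[OF G]) (auto simp: norm_mult)

lemma norm_ift_le:
  assumes G: "integrable lborel G"
  shows "norm (ift G t) \<le> (LINT x|lborel. norm (G x))"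
  unfolding ift_def by (rule order.trans[OF integral_norm_bound]) (simp add: norm_mult)

lemma integrable_lborel_pair_mult:
  fixes f :: "'a::euclidean_space \<Rightarrow> complex" and g :: "'b::euclidean_space \<Rightarrow> complex"
  assumes f: "integrable lborel f" and g: "integrable lborel g"
  shows "integrable (lborel \<Otimes>\<^sub>M lborel) (\<lambda>(x, y). f x * g y)"
    and "(LINT p|(lborel \<Otimes>\<^sub>M lborel). (case p of (x, y) \<Rightarrow> f x * g y)) = (LINT x|lborel. f x) * (LINT y|lborel. g y)"
proof -
  have [measurable]: "f \<in> borel_measurable borel" "g \<in> borel_measurable borel"
    using f g by auto
  show I: "integrable (lborel \<Otimes>\<^sub>M lborel) (\<lambda>(x, y). f x * g y)"
    using f g by (intro lborel_pair.Fubini_integrable) (auto simp: norm_mult)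
  show "(LINT p|(lborel \<Otimes>\<^sub>M lborel). (case p of (x, y) \<Rightarrow> f x * g y)) = (LINT x|lborel. f x) * (LINT y|lborel. g y)"
    using lborel_pair.integral_fst'[OF I] by simp
qed

text \<open>Expand |ift G|^2 into a double integral and integrate the Gaussian against the phase in
  t, which produces \<open>gker l (x - y)\<close>. The Gaussian factor is what makes the triple
  integrand \<open>H\<close> absolutely integrable, so that Fubini applies.\<close>

lemma gaussian_mean_square_ift:
  fixes G :: "'a::euclidean_space \<Rightarrow> complex"
  assumes G: "integrable lborel G" and l: "l > 0"
  shows "integrable lborel (\<lambda>t. exp (- (pi * l * (norm t)\<^sup>2)) * (norm (ift G t))\<^sup>2)"
    and "integrable (lborel \<Otimes>\<^sub>M lborel) (\<lambda>(x, y). G x * cnj (G y) * of_real (gker l (x - y)))"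
    and "of_real (LINT t|lborel. exp (- (pi * l * (norm t)\<^sup>2)) * (norm (ift G t))\<^sup>2)
       = (LINT p|(lborel \<Otimes>\<^sub>M lborel). (case p of (x, y) \<Rightarrow> G x * cnj (G y) * of_real (gker l (x - y))))"
proof -
  have [measurable]: "G \<in> borel_measurable borel" using G by auto
  define e where "e t = exp (- (pi * l * (norm t)\<^sup>2))" for t :: 'a
  have [measurable]: "e \<in> borel_measurable borel" unfolding e_def by measurable
  have e: "integrable lborel (\<lambda>t. complex_of_real (e t))"
    using fourier_gaussian(1)[OF l, of "0::'a"] by (simp add: e_def scaleR_conv_of_real)
  have Gc: "integrable lborel (\<lambda>y. cnj (G y))" using G by simp
  define H where "H = (\<lambda>(t :: 'a, x, y). of_real (e t) * (G x * cnj (G y) * cis (2 * pi * ((x - y) \<bullet> t))))"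
  have P: "integrable (lborel \<Otimes>\<^sub>M lborel) (\<lambda>(x, y). G x * cnj (G y))"
    by (rule integrable_lborel_pair_mult) fact+
  have Hm[measurable]: "H \<in> borel_measurable (lborel \<Otimes>\<^sub>M (lborel \<Otimes>\<^sub>M lborel))"
    unfolding H_def by measurable
  have P': "integrable lborel (\<lambda>p. case p of (x, y) \<Rightarrow> G x * cnj (G y))"
    using P by (simp add: lborel_prod)
  have HI: "integrable (lborel \<Otimes>\<^sub>M (lborel \<Otimes>\<^sub>M lborel)) H"
  proof (rule Bochner_Integration.integrable_bound)
    show "integrable (lborel \<Otimes>\<^sub>M (lborel \<Otimes>\<^sub>M lborel)) (\<lambda>(t, p). complex_of_real (e t) * (case p of (x, y) \<Rightarrow> G x * cnj (G y)))"
      using integrable_lborel_pair_mult(1)[OF e P'] by (simp add: lborel_prod)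
    show "H \<in> borel_measurable (lborel \<Otimes>\<^sub>M (lborel \<Otimes>\<^sub>M lborel))" by (fact Hm)
  qed (auto simp: H_def norm_mult)
  have inner1: "(LINT p|(lborel \<Otimes>\<^sub>M lborel). H (t, p)) = of_real (e t * (norm (ift G t))\<^sup>2)" for t
  proof -
    define g where "g x = G x * cis (2 * pi * (x \<bullet> t))" for x
    have g: "integrable lborel g" unfolding g_def by (rule integrable_mult_cis) (use G in auto)
    have "(LINT p|(lborel \<Otimes>\<^sub>M lborel). H (t, p)) = (LINT p|(lborel \<Otimes>\<^sub>M lborel). of_real (e t) * (case p of (x, y) \<Rightarrow> g x * cnj (g y)))"
      by (intro Bochner_Integration.integral_cong)
        (auto simp: H_def g_def inner_diff_left right_diff_distrib cis_cnj cis_divide[symmetric] divide_inverse)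
    also have "\<dots> = of_real (e t) * ((LINT x|lborel. g x) * (LINT y|lborel. cnj (g y)))"
      using g by (subst integrable_lborel_pair_mult(2)[symmetric]) auto
    also have "\<dots> = of_real (e t) * (ift G t * cnj (ift G t))"
    proof -
      have "(LINT y|lborel. cnj (g y)) = cnj (LINT y|lborel. g y)"
        by (rule integral_bounded_linear[OF bounded_linear_cnj g])
      then show ?thesis by (simp only: ift_def g_def)
    qed
    also have "\<dots> = of_real (e t * (norm (ift G t))\<^sup>2)"
      by (simp only: complex_norm_square[symmetric] of_real_mult)
    finally show ?thesis .
  qed
  have inner2: "(LINT t|lborel. H (t, x, y)) = G x * cnj (G y) * of_real (gker l (x - y))" for x y
  proof -
    have "(LINT t|lborel. H (t, x, y)) = (LINT t|lborel. (G x * cnj (G y)) * (exp (- (pi * l * (norm t)\<^sup>2)) *\<^sub>R cis (2 * pi * ((x - y) \<bullet> t))))"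
      by (simp add: H_def e_def scaleR_conv_of_real mult_ac)
    also have "\<dots> = (G x * cnj (G y)) * of_real (gker l (x - y))"
      by (simp only: integral_mult_right_zero fourier_gaussian(2)[OF l] gker_def)
    finally show ?thesis .
  qed
  have inner2': "(LINT t|lborel. H (t, p)) = (case p of (x, y) \<Rightarrow> G x * cnj (G y) * of_real (gker l (x - y)))" for p
    by (cases p) (simp only: inner2 prod.case)
  interpret pair_sigma_finite "lborel :: 'a measure" "lborel \<Otimes>\<^sub>M lborel :: ('a \<times> 'a) measure"
    unfolding lborel_prod by standard
  have HI': "integrable (lborel \<Otimes>\<^sub>M (lborel \<Otimes>\<^sub>M lborel)) (\<lambda>(t, p). H (t, p))" using HI by simp
  show "integrable (lborel \<Otimes>\<^sub>M lborel) (\<lambda>(x, y). G x * cnj (G y) * of_real (gker l (x - y)))"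
    using integrable_snd[OF HI'] unfolding inner2' .
  have "integrable lborel (\<lambda>t. complex_of_real (e t * (norm (ift G t))\<^sup>2))"
    using integrable_fst[OF HI'] by (simp add: inner1)
  from integrable_norm[OF this] show "integrable lborel (\<lambda>t. exp (- (pi * l * (norm t)\<^sup>2)) * (norm (ift G t))\<^sup>2)"
    by (simp add: e_def norm_mult norm_power)
  show "of_real (LINT t|lborel. exp (- (pi * l * (norm t)\<^sup>2)) * (norm (ift G t))\<^sup>2)
       = (LINT p|(lborel \<Otimes>\<^sub>M lborel). (case p of (x, y) \<Rightarrow> G x * cnj (G y) * of_real (gker l (x - y))))"
    using Fubini_integral[OF HI'] unfolding inner1 inner2' by (simp add: e_def del: of_real_mult)
qed

text \<open>Absolute values in the kernel identity, followed by the Schur test. The weight is kept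
  free: the constant 1 leads to one half of Plancherel's theorem, the Riesz weight to Pitt's
  inequality.\<close>

lemma gaussian_mean_square_ift_le:
  fixes G :: "'a::euclidean_space \<Rightarrow> complex"
  assumes G: "integrable lborel G" and l: "l > 0"
    and [measurable]: "w \<in> borel_measurable borel" and w: "AE x in lborel. w x > 0"
  shows "(\<integral>\<^sup>+t. ennreal (exp (- (pi * l * (norm t)\<^sup>2)) * (norm (ift G t))\<^sup>2) \<partial>lborel)
    \<le> (\<integral>\<^sup>+x. ennreal ((norm (G x))\<^sup>2 / w x) * (\<integral>\<^sup>+y. ennreal (gker l (x - y) * w y) \<partial>lborel) \<partial>lborel)"
proof -
  have [measurable]: "G \<in> borel_measurable borel" using G by auto
  let ?P = "\<lambda>(x, y). G x * cnj (G y) * complex_of_real (gker l (x - y))"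
  have [measurable]: "?P \<in> borel_measurable (lborel \<Otimes>\<^sub>M lborel)" by measurable
  have "(\<integral>\<^sup>+t. ennreal (exp (- (pi * l * (norm t)\<^sup>2)) * (norm (ift G t))\<^sup>2) \<partial>lborel)
    = ennreal (LINT t|lborel. exp (- (pi * l * (norm t)\<^sup>2)) * (norm (ift G t))\<^sup>2)"
    by (rule nn_integral_eq_integral) (auto intro: gaussian_mean_square_ift(1) assms)
  also have "\<dots> \<le> ennreal (norm (complex_of_real (LINT t|lborel. exp (- (pi * l * (norm t)\<^sup>2)) * (norm (ift G t))\<^sup>2)))"
    by (intro ennreal_leI) simp
  also have "\<dots> \<le> ennreal (LINT p|(lborel \<Otimes>\<^sub>M lborel). norm (?P p))"
    unfolding gaussian_mean_square_ift(3)[OF G l] by (intro ennreal_leI integral_norm_bound)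
  also have "\<dots> = (\<integral>\<^sup>+p. ennreal (norm (?P p)) \<partial>(lborel \<Otimes>\<^sub>M lborel))"
    by (rule nn_integral_eq_integral[symmetric], rule integrable_norm, rule gaussian_mean_square_ift(2)) (auto intro: assms)
  also have "\<dots> = (\<integral>\<^sup>+x. (\<integral>\<^sup>+y. ennreal (norm (?P (x, y))) \<partial>lborel) \<partial>lborel)"
    by (rule lborel.nn_integral_fst[symmetric]) measurable
  also have "\<dots> = (\<integral>\<^sup>+x. (\<integral>\<^sup>+y. ennreal (norm (G x) * norm (G y) * gker l (x - y)) \<partial>lborel) \<partial>lborel)"
    by (simp add: norm_mult)
  also have "\<dots> \<le> (\<integral>\<^sup>+x. ennreal ((norm (G x))\<^sup>2 / w x) * (\<integral>\<^sup>+y. ennreal (gker l (x - y) * w y) \<partial>lborel) \<partial>lborel)"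
    by (rule schur_test) (use w in \<open>auto simp: gker_sym\<close>)
  finally show ?thesis .
qed

text \<open>With weight 1 the inner integral of the Schur bound is the total mass of
  \<open>gker\<close>, which is 1 for every l; Fatou lets l tend to 0.\<close>

lemma nn_integral_ift_le:
  fixes G :: "'a::euclidean_space \<Rightarrow> complex"
  assumes G: "integrable lborel G"
  shows "(\<integral>\<^sup>+t. ennreal ((norm (ift G t))\<^sup>2) \<partial>lborel) \<le> (\<integral>\<^sup>+x. ennreal ((norm (G x))\<^sup>2) \<partial>lborel)"
proof -
  have [measurable]: "G \<in> borel_measurable borel" using G by auto
  define u where "u k t = ennreal (exp (- (pi * (1 / Suc k) * (norm t)\<^sup>2)) * (norm (ift G t))\<^sup>2)" for k and t :: 'a
  have [measurable]: "u k \<in> borel_measurable borel" for k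
    unfolding u_def[abs_def] by measurable
  show ?thesis
  proof (rule nn_integral_Fatou_bound[where u = u and C = "\<lambda>_. \<integral>\<^sup>+x. ennreal ((norm (G x))\<^sup>2) \<partial>lborel"])
    show "AE t in lborel. (\<lambda>k. u k t) \<longlonglongrightarrow> ennreal ((norm (ift G t))\<^sup>2)"
    proof (rule AE_I2)
      fix t :: 'a
      have "(\<lambda>k. exp (- (pi * (1 / Suc k) * (norm t)\<^sup>2)) * (norm (ift G t))\<^sup>2) \<longlonglongrightarrow> exp (- (pi * 0 * (norm t)\<^sup>2)) * (norm (ift G t))\<^sup>2"
        by (intro tendsto_intros LIMSEQ_Suc[OF lim_1_over_n])
      then show "(\<lambda>k. u k t) \<longlonglongrightarrow> ennreal ((norm (ift G t))\<^sup>2)"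
        unfolding u_def by (intro tendsto_ennrealI) simp
    qed
    show "(\<integral>\<^sup>+t. u k t \<partial>lborel) \<le> (\<integral>\<^sup>+x. ennreal ((norm (G x))\<^sup>2) \<partial>lborel)" for k
    proof -
      have "(\<integral>\<^sup>+t. u k t \<partial>lborel) \<le> (\<integral>\<^sup>+x. ennreal ((norm (G x))\<^sup>2 / 1) * (\<integral>\<^sup>+y. ennreal (gker (1 / Suc k) (x - y) * 1) \<partial>lborel) \<partial>lborel)"
        unfolding u_def by (rule gaussian_mean_square_ift_le) (use G in auto)
      also have "\<dots> = (\<integral>\<^sup>+x. ennreal ((norm (G x))\<^sup>2) \<partial>lborel)"
      proof -
        have "1 / real (Suc k) > 0" by simp
        then show ?thesis by (simp only: nn_integral_gker mult_1_right div_by_1)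
      qed
      finally show ?thesis .
    qed
  qed auto
qed

text \<open>The factor by which the superposed kernels act on the Riesz weight, apart from
  |x|^\<alpha>, divided by the constant
  \<open>Gamma (\<alpha> / 2) * pi powr - (\<alpha> / 2)\<close> that relates |t|^(-\<alpha>) to its
  superposition of Gaussians.\<close>

definition pitt_const :: "real \<Rightarrow> real \<Rightarrow> real" where
  "pitt_const n \<alpha> = pi powr \<alpha> * (Gamma ((n - \<alpha>) / 4) / Gamma ((n + \<alpha>) / 4))\<^sup>2"

theorem pitt_inequality:
  fixes G :: "'a::euclidean_space \<Rightarrow> complex"
  assumes G: "integrable lborel G" and a: "0 < \<alpha>" "\<alpha> < real DIM('a)"
  shows "(\<integral>\<^sup>+t. ennreal (norm t powr - \<alpha> * (norm (ift G t))\<^sup>2) \<partial>lborel)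
    \<le> ennreal (pitt_const (real DIM('a)) \<alpha>) * (\<integral>\<^sup>+x. ennreal (norm x powr \<alpha> * (norm (G x))\<^sup>2) \<partial>lborel)"
proof -
  have [measurable]: "G \<in> borel_measurable borel" using G by auto
  define n where "n = real DIM('a)"
  have n: "n > 0" "\<alpha> < n" using a by (auto simp: n_def)
  define p where "p = \<alpha> / 2"
  have p: "p > 0" using a by (simp add: p_def)
  have Gp: "Gamma p > 0" "Gamma ((n - \<alpha>) / 4) > 0" "Gamma ((n + \<alpha>) / 4) > 0"
    using n a by (auto intro!: Gamma_real_pos simp: p_def)
  define I where "I = (indicator {0<..} :: real \<Rightarrow> ennreal)"
  have [measurable]: "I \<in> borel_measurable borel" by (simp add: I_def)
  define w where "w = (riesz_weight \<alpha> :: 'a \<Rightarrow> real)"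
  have [measurable]: "w \<in> borel_measurable borel" by (simp add: w_def)
  have w: "AE x in lborel. w x > 0"
    unfolding w_def by (intro eventually_mono[OF AE_lborel_singleton[of "0::'a"]] riesz_weight_pos a)
  define f where "f t l = ennreal (l powr (p - 1)) * I l * ennreal (exp (- (pi * l * (norm t)\<^sup>2)) * (norm (ift G t))\<^sup>2)" for t :: 'a and l
  have fm: "(\<lambda>(t, l). f t l) \<in> borel_measurable (lborel \<Otimes>\<^sub>M lborel)"
    unfolding f_def by measurable
  define g where "g x l = ennreal (l powr (p - 1)) * I l * (ennreal ((norm (G x))\<^sup>2 / w x) * (\<integral>\<^sup>+y. ennreal (gker l (x - y) * w y) \<partial>lborel))" for x :: 'a and l
  have gm: "(\<lambda>(x, l). g x l) \<in> borel_measurable (lborel \<Otimes>\<^sub>M lborel)"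
    unfolding g_def by measurable
  \<comment> \<open>Integrating l^(p - 1) exp (- pi l |t|^2) over l > 0 yields \<open>c\<close>
    times |t|^(-\<alpha>).\<close>
  define c where "c = Gamma p * pi powr - p"
  have c: "c > 0" using Gp by (simp add: c_def)
  have "ennreal c * (\<integral>\<^sup>+t. ennreal (norm t powr - \<alpha> * (norm (ift G t))\<^sup>2) \<partial>lborel) = (\<integral>\<^sup>+t. ennreal c * ennreal (norm t powr - \<alpha> * (norm (ift G t))\<^sup>2) \<partial>lborel)"
    by (rule nn_integral_cmult[symmetric]) auto
  also have "\<dots> = (\<integral>\<^sup>+t. (\<integral>\<^sup>+l. f t l \<partial>lborel) \<partial>lborel)"
  proof (intro nn_integral_cong_AE eventually_mono[OF AE_lborel_singleton[of "0::'a"]])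
    fix t :: 'a assume t: "t \<noteq> 0"
    have nt: "norm t powr - \<alpha> = ((norm t)\<^sup>2) powr - p"
      using t by (simp add: p_def powr_powr flip: powr_numeral)
    have "(\<integral>\<^sup>+l. f t l \<partial>lborel) = (\<integral>\<^sup>+l. ennreal ((norm (ift G t))\<^sup>2) * (ennreal (l powr (p - 1) * exp (- ((pi * (norm t)\<^sup>2) * l))) * I l) \<partial>lborel)"
      by (intro nn_integral_cong) (simp add: f_def ennreal_mult' mult_ac)
    also have "\<dots> = ennreal ((norm (ift G t))\<^sup>2) * ennreal (Gamma p * (pi * (norm t)\<^sup>2) powr - p)"
      using t p by (subst nn_integral_cmult) (auto simp: I_def nn_integral_Gamma_scaled)
    also have "\<dots> = ennreal ((norm (ift G t))\<^sup>2 * (Gamma p * (pi * (norm t)\<^sup>2) powr - p))"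
      by (rule ennreal_mult'[symmetric]) simp
    also have "(norm (ift G t))\<^sup>2 * (Gamma p * (pi * (norm t)\<^sup>2) powr - p) = c * (norm t powr - \<alpha> * (norm (ift G t))\<^sup>2)"
      unfolding nt by (simp add: c_def powr_mult)
    finally show "ennreal c * ennreal (norm t powr - \<alpha> * (norm (ift G t))\<^sup>2) = (\<integral>\<^sup>+l. f t l \<partial>lborel)"
      using c by (simp add: ennreal_mult')
  qed
  also have "\<dots> = (\<integral>\<^sup>+l. (\<integral>\<^sup>+t. f t l \<partial>lborel) \<partial>lborel)"
    by (rule lborel_pair.Fubini'[symmetric]) fact
  also have "\<dots> \<le> (\<integral>\<^sup>+l. (\<integral>\<^sup>+x. g x l \<partial>lborel) \<partial>lborel)"
  proof (rule nn_integral_mono)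
    fix l :: real
    show "(\<integral>\<^sup>+t. f t l \<partial>lborel) \<le> (\<integral>\<^sup>+x. g x l \<partial>lborel)"
    proof (cases "l > 0")
      case True
      show ?thesis unfolding f_def g_def
        using gaussian_mean_square_ift_le[OF G True _ w]
        by (subst (1 2) nn_integral_cmult) (auto intro!: mult_left_mono)
    qed (auto simp: f_def I_def)
  qed
  also have "\<dots> = (\<integral>\<^sup>+x. (\<integral>\<^sup>+l. g x l \<partial>lborel) \<partial>lborel)"
    by (rule lborel_pair.Fubini') fact
  also have "\<dots> = (\<integral>\<^sup>+x. ennreal (c * pitt_const n \<alpha>) * ennreal (norm x powr \<alpha> * (norm (G x))\<^sup>2) \<partial>lborel)"
  proof (intro nn_integral_cong_AE eventually_mono[OF AE_lborel_singleton[of "0::'a"]])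
    fix x :: 'a assume x: "x \<noteq> 0"
    define N where "N = pi * (norm x)\<^sup>2"
    have N: "N > 0" using x by (simp add: N_def)
    define R where "R = Gamma ((n - \<alpha>) / 4)" define S where "S = Gamma ((n + \<alpha>) / 4)"
    have S: "S > 0" "R > 0" using Gp by (auto simp: R_def S_def)
    have "(\<integral>\<^sup>+l. g x l \<partial>lborel) = (\<integral>\<^sup>+l. ennreal ((norm (G x))\<^sup>2 / w x) * (ennreal (l powr (\<alpha> / 2 - 1)) * (\<integral>\<^sup>+y. ennreal (gker l (x - y) * w y) \<partial>lborel) * indicator {0<..} l) \<partial>lborel)"
      by (intro nn_integral_cong) (simp add: g_def I_def p_def mult_ac)
    also have "\<dots> = ennreal ((norm (G x))\<^sup>2 / w x) * ennreal (Gamma p * R\<^sup>2 / S * N powr - ((n - \<alpha>) / 4))"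
      using nn_integral_gker_riesz_weight[OF a x]
      by (subst nn_integral_cmult) (auto simp: w_def R_def S_def N_def n_def p_def)
    also have "\<dots> = ennreal ((norm (G x))\<^sup>2 / w x * (Gamma p * R\<^sup>2 / S * N powr - ((n - \<alpha>) / 4)))"
      using riesz_weight_pos[OF a(1) x] by (intro ennreal_mult'[symmetric]) (simp add: w_def)
    also have "(norm (G x))\<^sup>2 / w x * (Gamma p * R\<^sup>2 / S * N powr - ((n - \<alpha>) / 4)) = c * pitt_const n \<alpha> * (norm x powr \<alpha> * (norm (G x))\<^sup>2)"
    proof -
      have wx: "w x = S * N powr - ((n + \<alpha>) / 4)"
        by (simp add: w_def riesz_weight_def S_def N_def n_def)
      \<comment> \<open>The eigenfunction property: the kernel changes the exponent of the weight
        from - (n + \<alpha>) / 4 to - (n - \<alpha>) / 4, and the quotient is the power of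
        \<open>N\<close> that becomes |x|^\<alpha>.\<close>
      have e1: "N powr - ((n - \<alpha>) / 4) / N powr - ((n + \<alpha>) / 4) = N powr p"
        unfolding powr_diff[symmetric] by (simp add: p_def diff_divide_distrib add_divide_distrib)
      have e2: "N powr p = pi powr p * norm x powr \<alpha>"
        using x by (simp add: N_def powr_mult p_def powr_powr flip: powr_numeral)
      have e3: "pi powr \<alpha> * pi powr - p = pi powr p"
        unfolding powr_add[symmetric] by (simp add: p_def)
      have "(norm (G x))\<^sup>2 / w x * (Gamma p * R\<^sup>2 / S * N powr - ((n - \<alpha>) / 4))
        = (norm (G x))\<^sup>2 * Gamma p * (R / S)\<^sup>2 * (N powr - ((n - \<alpha>) / 4) / N powr - ((n + \<alpha>) / 4))"
        unfolding wx using S N by (simp add: field_simps power2_eq_square)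
      also have "\<dots> = (norm (G x))\<^sup>2 * Gamma p * (R / S)\<^sup>2 * (pi powr \<alpha> * pi powr - p) * norm x powr \<alpha>"
        unfolding e1 e2 e3 by simp
      also have "\<dots> = c * pitt_const n \<alpha> * (norm x powr \<alpha> * (norm (G x))\<^sup>2)"
        by (simp add: c_def pitt_const_def R_def S_def mult_ac)
      finally show ?thesis .
    qed
    finally show "(\<integral>\<^sup>+l. g x l \<partial>lborel) = ennreal (c * pitt_const n \<alpha>) * ennreal (norm x powr \<alpha> * (norm (G x))\<^sup>2)"
      using c by (simp add: ennreal_mult'[symmetric] pitt_const_def)
  qed
  also have "\<dots> = ennreal c * (ennreal (pitt_const n \<alpha>) * (\<integral>\<^sup>+x. ennreal (norm x powr \<alpha> * (norm (G x))\<^sup>2) \<partial>lborel))"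
    using c by (subst nn_integral_cmult) (auto simp: ennreal_mult' mult.assoc)
  finally have "ennreal (1 / c) * (ennreal c * (\<integral>\<^sup>+t. ennreal (norm t powr - \<alpha> * (norm (ift G t))\<^sup>2) \<partial>lborel))
    \<le> ennreal (1 / c) * (ennreal c * (ennreal (pitt_const n \<alpha>) * (\<integral>\<^sup>+x. ennreal (norm x powr \<alpha> * (norm (G x))\<^sup>2) \<partial>lborel)))"
    by (rule mult_left_mono) simp
  moreover have "ennreal (1 / c) * (ennreal c * X) = X" for X
    using c by (simp add: mult.assoc[symmetric] ennreal_mult'[symmetric])
  ultimately show ?thesis by (simp add: n_def)
qed

subsection \<open>Plancherel's theorem\<close>

text \<open>Young's inequality on the mixed term. Integrated, it takes the place of the triangle
  inequality in L2: for small \<open>e\<close> the first factor stays near 1, while the second term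
  is one that can be sent to 0 with \<open>e\<close> fixed. Where only finiteness or a rate is
  wanted, \<open>e = 1\<close> is taken.\<close>

lemma norm_add_square_le:
  fixes a b :: "'b::real_normed_vector" and e :: real
  assumes e: "e > 0"
  shows "(norm (a + b))\<^sup>2 \<le> (1 + e) * (norm a)\<^sup>2 + (1 + 1 / e) * (norm b)\<^sup>2"
proof -
  have "(norm (a + b))\<^sup>2 \<le> (norm a + norm b)\<^sup>2"
    by (intro power_mono norm_triangle_ineq) simp
  also have "\<dots> = (norm a)\<^sup>2 + (norm b)\<^sup>2 + 2 * (norm a * norm b)"
    by (simp add: power2_sum)
  also have "2 * (norm a * norm b) \<le> e * (norm a)\<^sup>2 + 1 / e * (norm b)\<^sup>2"
  proof -
    have "0 \<le> (e * norm a - norm b)\<^sup>2 / e" using e by simp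
    then show ?thesis using e by (simp add: power2_diff field_simps power2_eq_square)
  qed
  finally show ?thesis by (simp add: algebra_simps)
qed

lemma nn_integral_norm_add_square_le:
  fixes a b :: "'a \<Rightarrow> 'b::{real_normed_vector, second_countable_topology}" and e :: real
  assumes e: "e > 0" and [measurable]: "a \<in> borel_measurable M" "b \<in> borel_measurable M"
  shows "(\<integral>\<^sup>+x. ennreal ((norm (a x + b x))\<^sup>2) \<partial>M)
    \<le> ennreal (1 + e) * (\<integral>\<^sup>+x. ennreal ((norm (a x))\<^sup>2) \<partial>M) + ennreal (1 + 1 / e) * (\<integral>\<^sup>+x. ennreal ((norm (b x))\<^sup>2) \<partial>M)"
proof -
  have "(\<integral>\<^sup>+x. ennreal ((norm (a x + b x))\<^sup>2) \<partial>M)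
    \<le> (\<integral>\<^sup>+x. ennreal (1 + e) * ennreal ((norm (a x))\<^sup>2) + ennreal (1 + 1 / e) * ennreal ((norm (b x))\<^sup>2) \<partial>M)"
  proof (rule nn_integral_mono)
    fix x
    have "ennreal ((norm (a x + b x))\<^sup>2) \<le> ennreal ((1 + e) * (norm (a x))\<^sup>2 + (1 + 1 / e) * (norm (b x))\<^sup>2)"
      by (intro ennreal_leI norm_add_square_le e)
    also have "\<dots> = ennreal (1 + e) * ennreal ((norm (a x))\<^sup>2) + ennreal (1 + 1 / e) * ennreal ((norm (b x))\<^sup>2)"
      using e by (simp only: ennreal_mult'[symmetric] ennreal_plus[symmetric] mult_nonneg_nonneg zero_le_power2 add_nonneg_nonneg zero_le_one less_imp_le zero_le_divide_1_iff)
    finally show "ennreal ((norm (a x + b x))\<^sup>2) \<le> ennreal (1 + e) * ennreal ((norm (a x))\<^sup>2) + ennreal (1 + 1 / e) * ennreal ((norm (b x))\<^sup>2)" .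
  qed
  also have "\<dots> = ennreal (1 + e) * (\<integral>\<^sup>+x. ennreal ((norm (a x))\<^sup>2) \<partial>M) + ennreal (1 + 1 / e) * (\<integral>\<^sup>+x. ennreal ((norm (b x))\<^sup>2) \<partial>M)"
    by (subst nn_integral_add) (auto simp: nn_integral_cmult)
  finally show ?thesis .
qed

lemma ennreal_le_of_all_factors:
  fixes X Y :: ennreal
  assumes "\<And>e::real. e > 0 \<Longrightarrow> X \<le> ennreal ((1 + e)\<^sup>2) * Y"
  shows "X \<le> Y"
proof (cases "Y = top")
  case False
  have "(\<lambda>k. ennreal ((1 + 1 / Suc k)\<^sup>2) * Y) \<longlonglongrightarrow> ennreal ((1 + 0)\<^sup>2) * Y"
    using False by (intro tendsto_mult_ennreal tendsto_const tendsto_ennrealI tendsto_intros LIMSEQ_Suc[OF lim_1_over_n]) auto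
  moreover have "X \<le> ennreal ((1 + 1 / Suc k)\<^sup>2) * Y" for k
    by (rule assms) simp
  ultimately show ?thesis
    by (intro LIMSEQ_le_const[where X = "\<lambda>k. ennreal ((1 + 1 / Suc k)\<^sup>2) * Y"]) auto
qed simp

lemma ift_diff:
  assumes "integrable lborel F" "integrable lborel G"
  shows "ift (\<lambda>x. F x - G x) t = ift F t - ift G t"
  unfolding ift_def left_diff_distrib
  by (rule Bochner_Integration.integral_diff; rule integrable_mult_cis) (use assms in auto)

lemma ift_add_scale:
  assumes "integrable lborel F" "integrable lborel G"
  shows "ift (\<lambda>x. F x + c * G x) t = ift F t + c * ift G t"
proof -
  have "ift (\<lambda>x. F x + c * G x) t = (LINT x|lborel. F x * cis (2 * pi * (x \<bullet> t)) + c * (G x * cis (2 * pi * (x \<bullet> t))))"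
    by (simp add: ift_def algebra_simps)
  also have "\<dots> = ift F t + (LINT x|lborel. c * (G x * cis (2 * pi * (x \<bullet> t))))"
    unfolding ift_def
    by (rule Bochner_Integration.integral_add; (rule integrable_mult_right)?; rule integrable_mult_cis) (use assms in auto)
  finally show ?thesis
    unfolding ift_def integral_mult_right_zero .
qed

text \<open>The differences \<open>h k - G\<close> tend to 0 in L2, and by
  \<open>nn_integral_ift_le\<close> so do their transforms. Young's inequality is spent once on each
  side, which costs (1 + e)^2; k goes to infinity with e fixed, and
  \<open>ennreal_le_of_all_factors\<close> removes e.\<close>

lemma plancherel_ge_closure:
  fixes G :: "'a::euclidean_space \<Rightarrow> complex" and h :: "nat \<Rightarrow> 'a \<Rightarrow> complex"
  assumes G: "integrable lborel G" and h: "\<And>k. integrable lborel (h k)"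
    and lim: "(\<lambda>k. \<integral>\<^sup>+x. ennreal ((norm (h k x - G x))\<^sup>2) \<partial>lborel) \<longlonglongrightarrow> 0"
    and ge: "\<And>k. (\<integral>\<^sup>+x. ennreal ((norm (h k x))\<^sup>2) \<partial>lborel) \<le> (\<integral>\<^sup>+t. ennreal ((norm (ift (h k) t))\<^sup>2) \<partial>lborel)"
  shows "(\<integral>\<^sup>+x. ennreal ((norm (G x))\<^sup>2) \<partial>lborel) \<le> (\<integral>\<^sup>+t. ennreal ((norm (ift G t))\<^sup>2) \<partial>lborel)"
proof (rule ennreal_le_of_all_factors)
  fix e :: real assume e: "e > 0"
  have [measurable]: "G \<in> borel_measurable borel" "h k \<in> borel_measurable borel" for k
    using G h[of k] by auto
  let ?G = "\<integral>\<^sup>+x. ennreal ((norm (G x))\<^sup>2) \<partial>lborel"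
  let ?F = "\<integral>\<^sup>+t. ennreal ((norm (ift G t))\<^sup>2) \<partial>lborel"
  define d where "d k = (\<integral>\<^sup>+x. ennreal ((norm (h k x - G x))\<^sup>2) \<partial>lborel)" for k
  have le: "?G \<le> ennreal (1 + e) * (ennreal (1 + e) * ?F + ennreal (1 + 1 / e) * d k) + ennreal (1 + 1 / e) * d k" for k
  proof -
    have "?G \<le> ennreal (1 + e) * (\<integral>\<^sup>+x. ennreal ((norm (h k x))\<^sup>2) \<partial>lborel) + ennreal (1 + 1 / e) * d k"
      using nn_integral_norm_add_square_le[OF e, of "h k" lborel "\<lambda>x. G x - h k x"]
      by (simp add: d_def norm_minus_commute)
    also have "(\<integral>\<^sup>+x. ennreal ((norm (h k x))\<^sup>2) \<partial>lborel) \<le> (\<integral>\<^sup>+t. ennreal ((norm (ift (h k) t))\<^sup>2) \<partial>lborel)"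
      by (rule ge)
    also have "\<dots> = (\<integral>\<^sup>+t. ennreal ((norm (ift G t + ift (\<lambda>x. h k x - G x) t))\<^sup>2) \<partial>lborel)"
      by (simp add: ift_diff[OF h G])
    also have "\<dots> \<le> ennreal (1 + e) * ?F + ennreal (1 + 1 / e) * (\<integral>\<^sup>+t. ennreal ((norm (ift (\<lambda>x. h k x - G x) t))\<^sup>2) \<partial>lborel)"
      by (rule nn_integral_norm_add_square_le[OF e]) auto
    also have "(\<integral>\<^sup>+t. ennreal ((norm (ift (\<lambda>x. h k x - G x) t))\<^sup>2) \<partial>lborel) \<le> d k"
      unfolding d_def by (rule nn_integral_ift_le) (use G h in auto)
    finally show ?thesis
      by (simp add: add_right_mono add_left_mono mult_left_mono)
  qed
  have d: "d \<longlonglongrightarrow> 0" using lim unfolding d_def .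
  have "(\<lambda>k. ennreal (1 + e) * (ennreal (1 + e) * ?F + ennreal (1 + 1 / e) * d k) + ennreal (1 + 1 / e) * d k)
      \<longlonglongrightarrow> ennreal (1 + e) * (ennreal (1 + e) * ?F + ennreal (1 + 1 / e) * 0) + ennreal (1 + 1 / e) * 0"
    by (intro tendsto_add ennreal_tendsto_cmult tendsto_const d) auto
  from LIMSEQ_le_const[OF this] le
  have "?G \<le> ennreal (1 + e) * (ennreal (1 + e) * ?F + ennreal (1 + 1 / e) * 0) + ennreal (1 + 1 / e) * 0"
    by blast
  also have "\<dots> = ennreal ((1 + e)\<^sup>2) * ?F"
  proof -
    have "ennreal ((1 + e)\<^sup>2) = ennreal (1 + e) * ennreal (1 + e)"
      unfolding power2_eq_square using e by (intro ennreal_mult') simp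
    then show ?thesis by (simp only: mult_zero_right add_0_right mult.assoc)
  qed
  finally show "?G \<le> ennreal ((1 + e)\<^sup>2) * ?F" .
qed

text \<open>The Gaussian mean squares of \<open>ift g\<close> are at most the full integral, and
  they equal the pairing of \<open>g\<close> with the convolution of \<open>cnj g\<close> and
  \<open>gker\<close>. As the Gaussian in t flattens, \<open>gker\<close> concentrates, and for a
  bounded continuous \<open>g\<close> the convolution tends to \<open>cnj g\<close>
  pointwise.\<close>

lemma plancherel_ge_continuous:
  fixes g :: "'a::euclidean_space \<Rightarrow> complex"
  assumes g: "integrable lborel g" and cont: "continuous_on UNIV g" and bdd: "\<And>x. norm (g x) \<le> M"
  shows "(\<integral>\<^sup>+x. ennreal ((norm (g x))\<^sup>2) \<partial>lborel) \<le> (\<integral>\<^sup>+t. ennreal ((norm (ift g t))\<^sup>2) \<partial>lborel)"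
proof -
  have [measurable]: "g \<in> borel_measurable borel" using g by auto
  have M: "M \<ge> 0" using bdd[of 0] norm_ge_zero order.trans by blast
  define e where "e z = exp (- (pi * 1 * (norm z)\<^sup>2))" for z :: 'a
  have [measurable]: "e \<in> borel_measurable borel" unfolding e_def[abs_def] by measurable
  have e: "integrable lborel e" "(LINT z|lborel. complex_of_real (e z)) = 1"
    using integrable_norm[OF fourier_gaussian(1)[of 1 "0::'a"]] fourier_gaussian(2)[of 1 "0::'a"]
    by (simp_all add: e_def[abs_def] scaleR_conv_of_real)
  define c where "c k = 1 / real (Suc k)" for k
  have c: "c k > 0" for k by (simp add: c_def)
  have c0: "c \<longlonglongrightarrow> 0" unfolding c_def by (intro LIMSEQ_Suc lim_1_over_n)
  define l where "l k = (c k)\<^sup>2" for k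
  have l: "l k > 0" for k using c[of k] by (simp add: l_def)
  define I where "I k = (LINT t|lborel. exp (- (pi * l k * (norm t)\<^sup>2)) * (norm (ift g t))\<^sup>2)" for k
  \<comment> \<open>The convolution of \<open>cnj g\<close> with \<open>gker (l k)\<close> after y =
    x + c k z. Since \<open>l k\<close> is the square of \<open>c k\<close>, the kernel becomes the
    fixed Gaussian \<open>e\<close>, and k is left only in the argument of \<open>g\<close>; thus
    \<open>M * e\<close> dominates for all k.\<close>
  define \<phi> where "\<phi> k x = (LINT z|lborel. cnj (g (x + c k *\<^sub>R z)) * of_real (e z))" for k x
  have \<phi>m[measurable]: "\<phi> k \<in> borel_measurable borel" for k unfolding \<phi>_def[abs_def] by measurable
  have eI: "integrable lborel (\<lambda>z. M * e z)" using e by simp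
  have \<phi>_lim: "(\<lambda>k. \<phi> k x) \<longlonglongrightarrow> cnj (g x)" for x
  proof -
    have "(\<lambda>k. \<phi> k x) \<longlonglongrightarrow> (LINT z|lborel. cnj (g x) * of_real (e z))"
      unfolding \<phi>_def
    proof (rule integral_dominated_convergence[where w = "\<lambda>z. M * e z"])
      show "AE z in lborel. (\<lambda>k. cnj (g (x + c k *\<^sub>R z)) * of_real (e z)) \<longlonglongrightarrow> cnj (g x) * of_real (e z)"
      proof (rule AE_I2)
        fix z :: 'a
        have "(\<lambda>k. x + c k *\<^sub>R z) \<longlonglongrightarrow> x + 0 *\<^sub>R z"
          by (intro tendsto_intros c0)
        then have "(\<lambda>k. g (x + c k *\<^sub>R z)) \<longlonglongrightarrow> g x"
          using cont by (auto intro!: continuous_on_tendsto_compose[OF cont])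
        then show "(\<lambda>k. cnj (g (x + c k *\<^sub>R z)) * of_real (e z)) \<longlonglongrightarrow> cnj (g x) * of_real (e z)"
          by (intro tendsto_intros)
      qed
      show "AE z in lborel. norm (cnj (g (x + c k *\<^sub>R z)) * complex_of_real (e z)) \<le> M * e z" for k
        by (rule AE_I2) (auto simp: norm_mult e_def intro!: mult_right_mono bdd)
    qed (use eI in auto)
    then show ?thesis using e(2) by simp
  qed
  have \<phi>_bdd: "norm (\<phi> k x) \<le> M * (LINT z|lborel. e z)" for k x
  proof -
    have "norm (\<phi> k x) \<le> (LINT z|lborel. M * e z)"
      unfolding \<phi>_def
    proof (rule Bochner_Integration.integral_norm_bound_integral[OF _ eI])
      have *: "norm (cnj (g (x + c k *\<^sub>R z)) * complex_of_real (e z)) \<le> M * e z" for z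
        by (auto simp: norm_mult e_def intro!: mult_right_mono bdd)
      show "norm (cnj (g (x + c k *\<^sub>R z)) * complex_of_real (e z)) \<le> M * e z" for z by (rule *)
      show "integrable lborel (\<lambda>z. cnj (g (x + c k *\<^sub>R z)) * complex_of_real (e z))"
        by (rule Bochner_Integration.integrable_bound[OF eI]) (use * in \<open>auto intro: order.trans[OF _ abs_ge_self]\<close>)
    qed
    then show ?thesis by simp
  qed
  have inner: "(LINT y|lborel. g x * cnj (g y) * of_real (gker (l k) (x - y))) = g x * \<phi> k x" for k x
  proof -
    have "(LINT y|lborel. cnj (g y) * complex_of_real (gker (l k) (x - y)))
       = (LINT y|density (distr lborel borel (\<lambda>z. x + c k *\<^sub>R z)) (\<lambda>_. ennreal (\<bar>c k\<bar> ^ DIM('a))). cnj (g y) * complex_of_real (gker (l k) (x - y)))"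
      using lborel_affine[of "c k" x] c[of k] by simp
    also have "\<dots> = (LINT z|lborel. (\<bar>c k\<bar> ^ DIM('a)) *\<^sub>R (cnj (g (x + c k *\<^sub>R z)) * complex_of_real (gker (l k) (x - (x + c k *\<^sub>R z)))))"
      by (subst integral_density) (auto simp: integral_distr)
    also have "\<dots> = \<phi> k x" unfolding \<phi>_def
    proof (intro Bochner_Integration.integral_cong refl)
      fix z :: 'a
      have "\<bar>c k\<bar> ^ DIM('a) * gker (l k) (x - (x + c k *\<^sub>R z)) = e z"
      proof -
        have "(c k)\<^sup>2 powr (- real DIM('a) / 2) = c k powr (- real DIM('a))"
          using c[of k] by (simp add: powr_powr flip: powr_numeral)
        then have "\<bar>c k\<bar> ^ DIM('a) * (c k)\<^sup>2 powr (- real DIM('a) / 2) = 1"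
          using c[of k] by (simp add: powr_minus powr_realpow)
        moreover have "pi * (norm (x - (x + c k *\<^sub>R z)))\<^sup>2 / l k = pi * 1 * (norm z)\<^sup>2"
          using c[of k] by (simp add: l_def power_mult_distrib)
        ultimately show ?thesis unfolding gker_def e_def l_def
          by (simp add: mult.assoc[symmetric])
      qed
      then have "complex_of_real (e z) = of_real (\<bar>c k\<bar> ^ DIM('a)) * of_real (gker (l k) (x - (x + c k *\<^sub>R z)))"
        by (simp only: of_real_mult[symmetric])
      then show "(\<bar>c k\<bar> ^ DIM('a)) *\<^sub>R (cnj (g (x + c k *\<^sub>R z)) * complex_of_real (gker (l k) (x - (x + c k *\<^sub>R z)))) = cnj (g (x + c k *\<^sub>R z)) * of_real (e z)"
        by (simp only: scaleR_conv_of_real mult_ac)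
    qed
    finally have *: "(LINT y|lborel. cnj (g y) * complex_of_real (gker (l k) (x - y))) = \<phi> k x" .
    show ?thesis
      unfolding mult.assoc integral_mult_right_zero * ..
  qed
  have I_eq: "complex_of_real (I k) = (LINT x|lborel. g x * \<phi> k x)" for k
    unfolding I_def gaussian_mean_square_ift(3)[OF g l]
    using lborel_pair.integral_fst'[OF gaussian_mean_square_ift(2)[OF g l], of k]
    by (simp add: inner)
  have sq: "integrable lborel (\<lambda>x. (norm (g x))\<^sup>2)"
  proof (rule Bochner_Integration.integrable_bound)
    show "integrable lborel (\<lambda>x. M * norm (g x))" using g by simp
    show "AE x in lborel. norm ((norm (g x))\<^sup>2) \<le> norm (M * norm (g x))"
      using bdd M by (intro AE_I2) (auto simp: power2_eq_square intro!: mult_right_mono)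
  qed auto
  have "(\<lambda>k. complex_of_real (I k)) \<longlonglongrightarrow> (LINT x|lborel. g x * cnj (g x))"
    unfolding I_eq
  proof (rule integral_dominated_convergence[where w = "\<lambda>x. norm (g x) * (M * (LINT z|lborel. e z))"])
    show "AE x in lborel. (\<lambda>k. g x * \<phi> k x) \<longlonglongrightarrow> g x * cnj (g x)"
      by (intro AE_I2 tendsto_intros \<phi>_lim)
    show "AE x in lborel. norm (g x * \<phi> k x) \<le> norm (g x) * (M * (LINT z|lborel. e z))" for k
      by (intro AE_I2) (auto simp: norm_mult intro!: mult_left_mono \<phi>_bdd)
  qed (use g in auto)
  also have "(LINT x|lborel. g x * cnj (g x)) = of_real (LINT x|lborel. (norm (g x))\<^sup>2)"
    by (simp only: complex_norm_square[symmetric] integral_complex_of_real)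
  finally have lim: "I \<longlonglongrightarrow> (LINT x|lborel. (norm (g x))\<^sup>2)"
    by (simp only: tendsto_of_real_iff)
  have "(\<lambda>k. ennreal (I k)) \<longlonglongrightarrow> ennreal (LINT x|lborel. (norm (g x))\<^sup>2)"
    using lim by (rule tendsto_ennrealI)
  moreover have "ennreal (I k) \<le> (\<integral>\<^sup>+t. ennreal ((norm (ift g t))\<^sup>2) \<partial>lborel)" for k
  proof -
    have "ennreal (I k) = (\<integral>\<^sup>+t. ennreal (exp (- (pi * l k * (norm t)\<^sup>2)) * (norm (ift g t))\<^sup>2) \<partial>lborel)"
      unfolding I_def by (rule nn_integral_eq_integral[symmetric]) (auto intro: gaussian_mean_square_ift(1) g l)
    also have "\<dots> \<le> (\<integral>\<^sup>+t. ennreal ((norm (ift g t))\<^sup>2) \<partial>lborel)"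
    proof (intro nn_integral_mono ennreal_leI)
      fix t :: 'a
      have "exp (- (pi * l k * (norm t)\<^sup>2)) \<le> 1" using l[of k] by simp
      then show "exp (- (pi * l k * (norm t)\<^sup>2)) * (norm (ift g t))\<^sup>2 \<le> (norm (ift g t))\<^sup>2"
        by (rule mult_left_le_one_le[rotated 2]) auto
    qed
    finally show ?thesis .
  qed
  ultimately have "ennreal (LINT x|lborel. (norm (g x))\<^sup>2) \<le> (\<integral>\<^sup>+t. ennreal ((norm (ift g t))\<^sup>2) \<partial>lborel)"
    by (intro LIMSEQ_le_const2[where X = "\<lambda>k. ennreal (I k)"]) auto
  then show ?thesis
    using nn_integral_eq_integral[OF sq] by simp
qed

text \<open>Measurability supplies continuous functions converging to \<open>G\<close> almost
  everywhere. Cut down in value by \<open>P\<close> and in space by \<open>q\<close>, they share one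
  bound and one bounded support, so the convergence also holds in L2 and
  \<open>plancherel_ge_closure\<close> applies.\<close>

lemma plancherel_ge_bounded:
  fixes G :: "'a::euclidean_space \<Rightarrow> complex"
  assumes [measurable]: "G \<in> borel_measurable borel" and M: "\<And>x. norm (G x) \<le> M"
    and R: "\<And>x. norm x > R \<Longrightarrow> G x = 0"
  shows "(\<integral>\<^sup>+x. ennreal ((norm (G x))\<^sup>2) \<partial>lborel) \<le> (\<integral>\<^sup>+t. ennreal ((norm (ift G t))\<^sup>2) \<partial>lborel)"
proof -
  define L where "L = max 1 M"
  have L: "L > 0" "\<And>x. norm (G x) \<le> L" using M by (auto simp: L_def le_max_iff_disj)
  have "G \<in> borel_measurable lebesgue" by (simp add: measurable_completion)
  then have "G measurable_on UNIV" by (rule lebesgue_measurable_imp_measurable_on) simp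
  then obtain N g where N: "negligible N" and cont: "\<And>k::nat. continuous_on UNIV (g k)"
    and lim: "\<And>x. x \<notin> N \<Longrightarrow> (\<lambda>k. g k x) \<longlonglongrightarrow> G x"
    unfolding measurable_on_def by auto
  \<comment> \<open>The radial retraction onto the disc of radius \<open>L\<close>; as
    \<open>L\<close> is at least 1, the quotient is safe even for \<open>M = 0\<close>. It fixes the
    values of \<open>G\<close>, so the limit is not altered.\<close>
  define P where "P z = (L / max L (norm z)) *\<^sub>R z" for z :: complex
  have P_cont: "continuous_on UNIV P" unfolding P_def using L by (intro continuous_intros) (auto simp: max_def)
  have P_bdd: "norm (P z) \<le> L" for z
    using L by (auto simp: P_def max_def field_simps)
  have P_id: "norm z \<le> L \<Longrightarrow> P z = z" for z using L by (simp add: P_def max_def)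
  \<comment> \<open>A continuous cutoff, 1 up to radius \<open>R\<close> and 0 from
    \<open>R + 1\<close> on; \<open>G\<close> already vanishes in between.\<close>
  define q where "q x = max 0 (min 1 (R + 1 - norm x))" for x :: 'a
  have q_cont: "continuous_on UNIV q" unfolding q_def by (intro continuous_intros)
  have q: "0 \<le> q x" "q x \<le> 1" for x by (auto simp: q_def)
  define h where "h k x = q x *\<^sub>R P (g k x)" for k x
  let ?B = "cball (0::'a) (\<bar>R\<bar> + 1)"
  have h_cont: "continuous_on UNIV (h k)" for k
    unfolding h_def by (intro continuous_intros q_cont continuous_on_compose2[OF P_cont cont]) auto
  have [measurable]: "h k \<in> borel_measurable borel" for k
    by (intro borel_measurable_continuous_onI h_cont)
  have h_ind: "norm (h k x) \<le> L * indicator ?B x" for k x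
  proof (cases "x \<in> ?B")
    case True
    have "q x * norm (P (g k x)) \<le> 1 * L"
      using q[of x] P_bdd by (intro mult_mono) auto
    then show ?thesis using True q[of x] by (simp add: h_def)
  next
    case False
    then have "q x = 0" by (auto simp: q_def)
    then show ?thesis using L(1) by (simp add: h_def)
  qed
  have G_ind: "norm (G x) \<le> L * indicator ?B x" for x
    using L(2)[of x] R[of x] by (cases "x \<in> ?B") auto
  have [measurable]: "?B \<in> sets borel" by (intro borel_closed closed_cball)
  have Bfin: "emeasure lborel ?B < \<infinity>" by (intro emeasure_bounded_finite bounded_cball)
  have ind: "integrable lborel (\<lambda>x. L * indicator ?B x)"
    by (intro integrable_mult_right integrable_real_indicator) (use Bfin in auto)
  have GI: "integrable lborel G"
    by (rule Bochner_Integration.integrable_bound[OF ind]) (use G_ind L(1) in auto)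
  have hI: "integrable lborel (h k)" for k
    by (rule Bochner_Integration.integrable_bound[OF ind]) (use h_ind L(1) in auto)
  have AE: "AE x in lborel. x \<notin> N"
    using N by (metis AE_completion_iff AE_not_in negligible_iff_null_sets)
  have "(\<lambda>k. \<integral>\<^sup>+x. ennreal ((norm (h k x - G x))\<^sup>2) \<partial>lborel) \<longlonglongrightarrow> (\<integral>\<^sup>+x. 0 \<partial>(lborel :: 'a measure))"
  proof (rule nn_integral_dominated_convergence[where w = "\<lambda>x. ennreal ((2 * L)\<^sup>2) * indicator ?B x"])
    show "AE x in lborel. ennreal ((norm (h k x - G x))\<^sup>2) \<le> ennreal ((2 * L)\<^sup>2) * indicator ?B x" for k
    proof (rule AE_I2)
      fix x
      have "norm (h k x - G x) \<le> 2 * L * indicator ?B x"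
        using norm_triangle_ineq4[of "h k x" "G x"] h_ind[of k x] G_ind[of x] by linarith
      then have "(norm (h k x - G x))\<^sup>2 \<le> (2 * L * indicator ?B x)\<^sup>2"
        by (rule power_mono) simp
      then show "ennreal ((norm (h k x - G x))\<^sup>2) \<le> ennreal ((2 * L)\<^sup>2) * indicator ?B x"
        by (cases "x \<in> ?B") (auto intro: ennreal_leI)
    qed
    show "(\<integral>\<^sup>+x. ennreal ((2 * L)\<^sup>2) * indicator ?B x \<partial>lborel) < \<infinity>"
      using Bfin by (subst nn_integral_cmult) (auto simp: ennreal_mult_less_top)
    show "AE x in lborel. (\<lambda>k. ennreal ((norm (h k x - G x))\<^sup>2)) \<longlonglongrightarrow> 0"
      using AE
    proof eventually_elim
      fix x assume "x \<notin> N"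
      then have gl: "(\<lambda>k. g k x) \<longlonglongrightarrow> G x" by (rule lim)
      have "(\<lambda>k. P (g k x)) \<longlonglongrightarrow> P (G x)"
        by (rule continuous_on_tendsto_compose[OF P_cont gl]) auto
      then have "(\<lambda>k. h k x) \<longlonglongrightarrow> q x *\<^sub>R P (G x)"
        unfolding h_def by (intro tendsto_intros)
      also have "q x *\<^sub>R P (G x) = G x"
      proof (cases "norm x > R")
        case True then show ?thesis using R[OF True] by (simp add: P_def)
      next
        case False then show ?thesis using P_id[OF L(2)] by (simp add: q_def)
      qed
      finally have "(\<lambda>k. (norm (h k x - G x))\<^sup>2) \<longlonglongrightarrow> (norm (G x - G x))\<^sup>2"
        by (intro tendsto_intros)
      then show "(\<lambda>k. ennreal ((norm (h k x - G x))\<^sup>2)) \<longlonglongrightarrow> 0"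
        using tendsto_ennrealI by fastforce
    qed
  qed auto
  then have hlim: "(\<lambda>k. \<integral>\<^sup>+x. ennreal ((norm (h k x - G x))\<^sup>2) \<partial>lborel) \<longlonglongrightarrow> 0" by simp
  show ?thesis
  proof (rule plancherel_ge_closure[OF GI hI hlim])
    fix k
    have "norm (h k x) \<le> L" for x
      using h_ind[of k x] L(1) by (cases "x \<in> ?B") auto
    then show "(\<integral>\<^sup>+x. ennreal ((norm (h k x))\<^sup>2) \<partial>lborel) \<le> (\<integral>\<^sup>+t. ennreal ((norm (ift (h k) t))\<^sup>2) \<partial>lborel)"
      by (rule plancherel_ge_continuous[OF hI h_cont])
  qed
qed

text \<open>The difference is 0 or \<open>- G x\<close>, so |G|^2 dominates. Cutting both the values
  and the argument makes the truncations bounded with bounded support, hence integrable, which a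
  square integrable \<open>G\<close> itself may fail to be.\<close>

lemma truncation_tendsto_L2:
  fixes G :: "'a::euclidean_space \<Rightarrow> complex"
  assumes [measurable]: "G \<in> borel_measurable borel" and fin: "(\<integral>\<^sup>+x. ennreal ((norm (G x))\<^sup>2) \<partial>lborel) < \<infinity>"
  shows "(\<lambda>k. \<integral>\<^sup>+x. ennreal ((norm ((if norm (G x) \<le> real k \<and> norm x \<le> real k then G x else 0) - G x))\<^sup>2) \<partial>lborel) \<longlonglongrightarrow> 0"
proof -
  define h where "h k x = (if norm (G x) \<le> real k \<and> norm x \<le> real k then G x else 0)" for k x
  have [measurable]: "h k \<in> borel_measurable borel" for k unfolding h_def[abs_def] by measurable
  have "(\<lambda>k. \<integral>\<^sup>+x. ennreal ((norm (h k x - G x))\<^sup>2) \<partial>lborel) \<longlonglongrightarrow> (\<integral>\<^sup>+x. 0 \<partial>(lborel :: 'a measure))"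
  proof (rule nn_integral_dominated_convergence[where w = "\<lambda>x. ennreal ((norm (G x))\<^sup>2)"])
    show "AE x in lborel. (\<lambda>k. ennreal ((norm (h k x - G x))\<^sup>2)) \<longlonglongrightarrow> 0"
    proof (rule AE_I2)
      fix x
      obtain K where K: "norm (G x) + norm x \<le> real K" using real_arch_simple by blast
      have "h k x = G x" if "k \<ge> K" for k
      proof -
        have "real K \<le> real k" using that by simp
        with K have "norm (G x) \<le> real k \<and> norm x \<le> real k"
          using norm_ge_zero[of x] norm_ge_zero[of "G x"] by linarith
        then show ?thesis by (simp add: h_def)
      qed
      then have "\<forall>\<^sub>F k in sequentially. ennreal ((norm (h k x - G x))\<^sup>2) = 0"
        by (intro eventually_sequentiallyI[of K]) auto
      then show "(\<lambda>k. ennreal ((norm (h k x - G x))\<^sup>2)) \<longlonglongrightarrow> 0"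
        by (rule tendsto_eventually)
    qed
    show "AE x in lborel. ennreal ((norm (h k x - G x))\<^sup>2) \<le> ennreal ((norm (G x))\<^sup>2)" for k
      by (rule AE_I2) (auto simp: h_def)
  qed (use fin in auto)
  then show ?thesis by (simp add: h_def)
qed

theorem plancherel:
  fixes G :: "'a::euclidean_space \<Rightarrow> complex"
  assumes G: "integrable lborel G" and sq: "integrable lborel (\<lambda>x. (norm (G x))\<^sup>2)"
  shows "(\<integral>\<^sup>+t. ennreal ((norm (ift G t))\<^sup>2) \<partial>lborel) = (\<integral>\<^sup>+x. ennreal ((norm (G x))\<^sup>2) \<partial>lborel)"
proof (rule antisym[OF nn_integral_ift_le[OF G]])
  have [measurable]: "G \<in> borel_measurable borel" using G by auto
  have fin: "(\<integral>\<^sup>+x. ennreal ((norm (G x))\<^sup>2) \<partial>lborel) < \<infinity>"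
    using sq by (simp add: integrable_iff_bounded)
  show "(\<integral>\<^sup>+x. ennreal ((norm (G x))\<^sup>2) \<partial>lborel) \<le> (\<integral>\<^sup>+t. ennreal ((norm (ift G t))\<^sup>2) \<partial>lborel)"
  proof (rule plancherel_ge_closure[OF G _ truncation_tendsto_L2[OF _ fin]])
    fix k :: nat
    let ?h = "\<lambda>x. if norm (G x) \<le> real k \<and> norm x \<le> real k then G x else 0"
    show "integrable lborel ?h"
      by (rule Bochner_Integration.integrable_bound[OF G]) auto
    show "(\<integral>\<^sup>+x. ennreal ((norm (?h x))\<^sup>2) \<partial>lborel) \<le> (\<integral>\<^sup>+t. ennreal ((norm (ift ?h t))\<^sup>2) \<partial>lborel)"
      by (rule plancherel_ge_bounded[where M = "real k" and R = "real k"]) auto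
  qed auto
qed

section \<open>Polarization and Parseval's identity\<close>

lemma integrable_mult_cnj_L2:
  fixes F G :: "'a \<Rightarrow> complex"
  assumes [measurable]: "F \<in> borel_measurable M" "G \<in> borel_measurable M"
    and "integrable M (\<lambda>x. (norm (F x))\<^sup>2)" "integrable M (\<lambda>x. (norm (G x))\<^sup>2)"
  shows "integrable M (\<lambda>x. F x * cnj (G x))"
proof (rule Bochner_Integration.integrable_bound)
  show "integrable M (\<lambda>x. (norm (F x))\<^sup>2 + (norm (G x))\<^sup>2)" using assms by auto
  show "AE x in M. norm (F x * cnj (G x)) \<le> norm ((norm (F x))\<^sup>2 + (norm (G x))\<^sup>2)"
  proof (rule AE_I2)
    fix x
    have "norm (F x) * norm (G x) \<le> (norm (F x))\<^sup>2 + (norm (G x))\<^sup>2"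
      using sum_squares_bound[of "norm (F x)" "norm (G x)"] mult_nonneg_nonneg[of "norm (F x)" "norm (G x)"]
        norm_ge_zero[of "F x"] norm_ge_zero[of "G x"] by linarith
    then show "norm (F x * cnj (G x)) \<le> norm ((norm (F x))\<^sup>2 + (norm (G x))\<^sup>2)"
      by (simp add: norm_mult)
  qed
qed auto

text \<open>For c over the fourth roots of unity, c |F + c G|^2 contains F cnj(G) with factor c
  cnj(c) = 1, while the other terms carry c or c^2 and sum to 0.\<close>

lemma integral_mult_cnj_polarization:
  fixes F G :: "'a \<Rightarrow> complex"
  assumes [measurable]: "F \<in> borel_measurable M" "G \<in> borel_measurable M"
    and F: "integrable M (\<lambda>x. (norm (F x))\<^sup>2)" and G: "integrable M (\<lambda>x. (norm (G x))\<^sup>2)"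
  shows "\<And>c. integrable M (\<lambda>x. (norm (F x + c * G x))\<^sup>2)"
    and "4 * (LINT x|M. F x * cnj (G x)) = (\<Sum>c\<in>{1, -1, \<i>, -\<i>}. c * of_real (LINT x|M. (norm (F x + c * G x))\<^sup>2))"
proof -
  show I: "integrable M (\<lambda>x. (norm (F x + c * G x))\<^sup>2)" for c
  proof (rule Bochner_Integration.integrable_bound)
    show "integrable M (\<lambda>x. (1 + 1) * (norm (F x))\<^sup>2 + (1 + 1 / 1) * ((norm c)\<^sup>2 * (norm (G x))\<^sup>2))"
      using F G by (intro Bochner_Integration.integrable_add integrable_mult_right)
    show "AE x in M. norm ((norm (F x + c * G x))\<^sup>2) \<le> norm ((1 + 1) * (norm (F x))\<^sup>2 + (1 + 1 / 1) * ((norm c)\<^sup>2 * (norm (G x))\<^sup>2))"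
    proof (rule AE_I2)
      fix x
      show "norm ((norm (F x + c * G x))\<^sup>2) \<le> norm ((1 + 1) * (norm (F x))\<^sup>2 + (1 + 1 / 1) * ((norm c)\<^sup>2 * (norm (G x))\<^sup>2))"
        using norm_add_square_le[of 1 "F x" "c * G x"] by (simp add: norm_mult power_mult_distrib)
    qed
  qed auto
  have pt: "4 * (a * cnj b) = (\<Sum>c\<in>{1, -1, \<i>, -\<i>}. c * of_real ((norm (a + c * b))\<^sup>2))" for a b :: complex
  proof -
    have "(\<Sum>c\<in>{1, -1, \<i>, -\<i>}. c * of_real ((norm (a + c * b))\<^sup>2)) = (\<Sum>c\<in>{1, -1, \<i>, -\<i>}. c * ((a + c * b) * cnj (a + c * b)))"
      by (simp only: complex_norm_square)
    also have "\<dots> = 4 * (a * cnj b)"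
      by (simp add: complex_eq_iff algebra_simps)
    finally show ?thesis ..
  qed
  have "4 * (LINT x|M. F x * cnj (G x)) = (LINT x|M. (\<Sum>c\<in>{1, -1, \<i>, -\<i>}. c * of_real ((norm (F x + c * G x))\<^sup>2)))"
    unfolding pt[symmetric] by simp
  also have "\<dots> = (\<Sum>c\<in>{1, -1, \<i>, -\<i>}. (LINT x|M. c * of_real ((norm (F x + c * G x))\<^sup>2)))"
    using I by (intro Bochner_Integration.integral_sum integrable_mult_right integrable_of_real)
  also have "\<dots> = (\<Sum>c\<in>{1, -1, \<i>, -\<i>}. c * of_real (LINT x|M. (norm (F x + c * G x))\<^sup>2))"
    by (simp only: integral_mult_right_zero integral_complex_of_real)
  finally show "4 * (LINT x|M. F x * cnj (G x)) = (\<Sum>c\<in>{1, -1, \<i>, -\<i>}. c * of_real (LINT x|M. (norm (F x + c * G x))\<^sup>2))" .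
qed

lemma integrable_ift_square:
  fixes G :: "'a::euclidean_space \<Rightarrow> complex"
  assumes G: "integrable lborel G" and sq: "integrable lborel (\<lambda>x. (norm (G x))\<^sup>2)"
  shows "integrable lborel (\<lambda>t. (norm (ift G t))\<^sup>2)"
    and "(LINT t|lborel. (norm (ift G t))\<^sup>2) = (LINT x|lborel. (norm (G x))\<^sup>2)"
proof -
  have [measurable]: "G \<in> borel_measurable borel" using G by auto
  have "(\<integral>\<^sup>+x. ennreal ((norm (G x))\<^sup>2) \<partial>lborel) < \<infinity>"
    using sq by (simp add: integrable_iff_bounded)
  then show I: "integrable lborel (\<lambda>t. (norm (ift G t))\<^sup>2)"
    using plancherel[OF assms] by (intro integrableI_bounded) auto
  show "(LINT t|lborel. (norm (ift G t))\<^sup>2) = (LINT x|lborel. (norm (G x))\<^sup>2)"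
    using plancherel[OF assms] by (subst (1 2) integral_eq_nn_integral) auto
qed

theorem parseval:
  fixes F G :: "'a::euclidean_space \<Rightarrow> complex"
  assumes F: "integrable lborel F" "integrable lborel (\<lambda>x. (norm (F x))\<^sup>2)"
    and G: "integrable lborel G" "integrable lborel (\<lambda>x. (norm (G x))\<^sup>2)"
  shows "(LINT t|lborel. ift F t * cnj (ift G t)) = (LINT x|lborel. F x * cnj (G x))"
proof -
  have [measurable]: "F \<in> borel_measurable borel" "G \<in> borel_measurable borel" using F G by auto
  have "4 * (LINT t|lborel. ift F t * cnj (ift G t)) = (\<Sum>c\<in>{1, -1, \<i>, -\<i>}. c * of_real (LINT t|lborel. (norm (ift F t + c * ift G t))\<^sup>2))"
    by (rule integral_mult_cnj_polarization) (auto intro: integrable_ift_square F G)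
  also have "\<dots> = (\<Sum>c\<in>{1, -1, \<i>, -\<i>}. c * of_real (LINT x|lborel. (norm (F x + c * G x))\<^sup>2))"
  proof (intro sum.cong refl arg_cong2[where f = "(*)"] arg_cong[where f = of_real])
    fix c :: complex
    have "(LINT t|lborel. (norm (ift F t + c * ift G t))\<^sup>2) = (LINT t|lborel. (norm (ift (\<lambda>x. F x + c * G x) t))\<^sup>2)"
      by (simp add: ift_add_scale[OF F(1) G(1)])
    also have "\<dots> = (LINT x|lborel. (norm (F x + c * G x))\<^sup>2)"
      using F G by (intro integrable_ift_square integral_mult_cnj_polarization(1) Bochner_Integration.integrable_add integrable_mult_right) auto
    finally show "(LINT t|lborel. (norm (ift F t + c * ift G t))\<^sup>2) = (LINT x|lborel. (norm (F x + c * G x))\<^sup>2)" .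
  qed
  also have "\<dots> = 4 * (LINT x|lborel. F x * cnj (G x))"
    by (rule integral_mult_cnj_polarization(2)[symmetric]) (use F G in auto)
  finally show ?thesis by simp
qed

subsection \<open>The Fourier transform of square integrable functions\<close>

lemma lborel_distr_uminus_euclidean: "distr lborel borel uminus = (lborel :: 'a::euclidean_space measure)"
  using lborel_affine[of "-1" "0::'a"] by (simp add: density_1)

lemma nn_integral_lborel_uminus:
  fixes h :: "'a::euclidean_space \<Rightarrow> ennreal"
  assumes [measurable]: "h \<in> borel_measurable borel"
  shows "(\<integral>\<^sup>+x. h (- x) \<partial>lborel) = (\<integral>\<^sup>+x. h x \<partial>lborel)"
proof -
  have "(\<integral>\<^sup>+x. h (- x) \<partial>lborel) = (\<integral>\<^sup>+x. h x \<partial>(distr lborel borel uminus))"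
    by (subst nn_integral_distr) auto
  then show ?thesis unfolding lborel_distr_uminus_euclidean .
qed

lemma integral_lborel_uminus:
  fixes h :: "'a::euclidean_space \<Rightarrow> 'b::{banach, second_countable_topology}"
  assumes [measurable]: "h \<in> borel_measurable borel"
  shows "(LINT x|lborel. h (- x)) = (LINT x|lborel. h x)"
proof -
  have "(LINT x|lborel. h (- x)) = (LINT x|distr lborel borel uminus. h x)"
    by (subst integral_distr) auto
  then show ?thesis unfolding lborel_distr_uminus_euclidean .
qed

lemma integrable_lborel_uminus:
  fixes h :: "'a::euclidean_space \<Rightarrow> 'b::{banach, second_countable_topology}"
  assumes "integrable lborel h"
  shows "integrable lborel (\<lambda>x. h (- x))"
proof -
  have "integrable (distr lborel borel uminus) h" using assms by (simp add: lborel_distr_uminus_euclidean)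
  then show ?thesis by (subst (asm) integrable_distr_eq) (use assms in auto)
qed

text \<open>\<open>fourier\<close> integrates over the completed measure and its argument may fail
  to be Borel, while the results on \<open>ift\<close> live on \<open>lborel\<close>. A Borel
  representative bridges the two, since the integral ignores null sets.\<close>

lemma fourier_eq_ift_AE:
  fixes f f' :: "'a::euclidean_space \<Rightarrow> complex"
  assumes [measurable]: "f \<in> borel_measurable lebesgue" "f' \<in> borel_measurable borel"
    and AE: "AE x in lborel. f x = f' x"
  shows "fourier f \<xi> = ift f' (- \<xi>)"
proof -
  have c: "exp (- 2 * complex_of_real pi * \<i> * complex_of_real (\<xi> \<bullet> x)) = cis (2 * pi * (x \<bullet> - \<xi>))" for x
    by (simp add: cis_conv_exp inner_commute mult_ac)
  have m: "(\<lambda>x. cis (2 * pi * (x \<bullet> - \<xi>))) \<in> borel_measurable borel" by measurable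
  then have m': "(\<lambda>x. cis (2 * pi * (x \<bullet> - \<xi>))) \<in> borel_measurable lebesgue"
    by (simp add: measurable_completion)
  have f': "f' \<in> borel_measurable lebesgue" by (simp add: measurable_completion)
  have "fourier f \<xi> = (LINT x|lebesgue. f' x * cis (2 * pi * (x \<bullet> - \<xi>)))"
    unfolding fourier_def c
    by (rule integral_cong_AE) (use m' f' AE in \<open>auto simp: AE_completion_iff elim: eventually_mono\<close>)
  also have "\<dots> = ift f' (- \<xi>)"
    unfolding ift_def by (rule integral_completion) (use m in measurable)
  finally show ?thesis .
qed

lemma fourier_eq_ift:
  fixes f :: "'a::euclidean_space \<Rightarrow> complex"
  assumes "f \<in> borel_measurable borel"
  shows "fourier f \<xi> = ift f (- \<xi>)"
  using assms by (intro fourier_eq_ift_AE) (auto simp: measurable_completion)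

lemma borel_representative_complex:
  fixes f :: "'a::euclidean_space \<Rightarrow> complex"
  assumes f: "f \<in> borel_measurable lebesgue"
  obtains f' where "f' \<in> borel_measurable borel" "AE x in lborel. f x = f' x"
proof -
  have "(\<lambda>x. Re (f x)) \<in> borel_measurable lebesgue" "(\<lambda>x. Im (f x)) \<in> borel_measurable lebesgue"
    using f by measurable
  then obtain u v where u: "u \<in> borel_measurable lborel" "AE x in lborel. Re (f x) = u x"
    and v: "v \<in> borel_measurable lborel" "AE x in lborel. Im (f x) = v x"
    by (metis completion_ex_borel_measurable_real)
  show thesis
  proof
    show "(\<lambda>x. of_real (u x) + \<i> * of_real (v x)) \<in> borel_measurable borel" using u v by measurable
    show "AE x in lborel. f x = of_real (u x) + \<i> * of_real (v x)"
      using u(2) v(2) by eventually_elim (simp add: complex_eq_iff)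
  qed
qed

lemma integrable_lebesgue_iff_lborel:
  fixes f f' :: "'a::euclidean_space \<Rightarrow> 'b::{banach, second_countable_topology}"
  assumes "f \<in> borel_measurable lebesgue" "f' \<in> borel_measurable borel"
    and AE: "AE x in lborel. f x = f' x"
  shows "integrable lebesgue f \<longleftrightarrow> integrable lborel f'"
proof -
  have f': "f' \<in> borel_measurable lebesgue" using assms(2) by (simp add: measurable_completion)
  have "integrable lebesgue f \<longleftrightarrow> integrable lebesgue f'"
    by (rule integrable_cong_AE) (use assms f' in \<open>auto simp: AE_completion_iff\<close>)
  also have "\<dots> \<longleftrightarrow> integrable lborel f'"
    by (rule integrable_completion) (use assms(2) in auto)
  finally show ?thesis .
qed

lemma square_integrable_iff_lborel:
  fixes f f' :: "'a::euclidean_space \<Rightarrow> complex"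
  assumes f: "f \<in> borel_measurable lebesgue" and f': "f' \<in> borel_measurable borel"
    and AE: "AE x in lborel. f x = f' x"
  shows "square_integrable f \<longleftrightarrow> integrable lborel (\<lambda>x. (norm (f' x))\<^sup>2)"
proof -
  have "integrable lebesgue (\<lambda>x. (norm (f x))\<^sup>2) \<longleftrightarrow> integrable lborel (\<lambda>x. (norm (f' x))\<^sup>2)"
    by (rule integrable_lebesgue_iff_lborel) (use assms in \<open>auto elim: eventually_mono\<close>)
  then show ?thesis using f by (simp add: square_integrable_def)
qed

text \<open>Completeness of L2 for a Cauchy sequence with geometric rate; such a rate can be
  arranged by passing to a subsequence. Pointwise convergence comes from a summable series, and
  Fatou upgrades it to convergence in L2.\<close>

lemma riesz_fischer_fast:
  fixes u :: "nat \<Rightarrow> 'a \<Rightarrow> 'b::{banach, second_countable_topology}"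
  assumes [measurable]: "\<And>k. u k \<in> borel_measurable M"
    and le: "\<And>j k. (\<integral>\<^sup>+x. ennreal ((norm (u j x - u k x))\<^sup>2) \<partial>M) \<le> ennreal (C * ((1/8)^j + (1/8)^k))"
    and C: "C \<ge> 0"
  obtains g where "g \<in> borel_measurable M" "(\<lambda>k. \<integral>\<^sup>+x. ennreal ((norm (u k x - g x))\<^sup>2) \<partial>M) \<longlonglongrightarrow> 0"
proof
  define d where "d k x = (norm (u (Suc k) x - u k x))\<^sup>2" for k x
  have [measurable]: "d k \<in> borel_measurable M" for k unfolding d_def[abs_def] by measurable
  define g where "g x = lim (\<lambda>k. u k x)" for x
  show gm[measurable]: "g \<in> borel_measurable M" unfolding g_def[abs_def] by measurable
  \<comment> \<open>The squared increments have integrals of order 8^(-k), so the weight 4^k is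
    affordable. Finiteness of the weighted series at x then bounds the increments by a multiple of
    2^(-k), which is summable.\<close>
  have "(\<integral>\<^sup>+x. (\<Sum>k. ennreal (4^k * d k x)) \<partial>M) = (\<Sum>k. \<integral>\<^sup>+x. ennreal (4^k * d k x) \<partial>M)"
    by (rule nn_integral_suminf) simp
  also have "\<dots> \<le> (\<Sum>k. ennreal (2 * C * (1/2)^k))"
  proof (rule suminf_le)
    fix k
    have "(\<integral>\<^sup>+x. ennreal (4^k * d k x) \<partial>M) = ennreal (4^k) * (\<integral>\<^sup>+x. ennreal (d k x) \<partial>M)"
      by (subst nn_integral_cmult[symmetric]) (auto simp: ennreal_mult')
    also have "\<dots> \<le> ennreal (4^k) * ennreal (C * ((1/8)^Suc k + (1/8)^k))"
      unfolding d_def by (intro mult_left_mono le) simp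
    also have "\<dots> = ennreal (4^k * (C * ((1/8)^Suc k + (1/8)^k)))"
      by (rule ennreal_mult'[symmetric]) simp
    also have "\<dots> \<le> ennreal (2 * C * (1/2)^k)"
    proof (rule ennreal_leI)
      have "4^k * (C * ((1/8)^Suc k + (1/8)^k)) = (9/8 * C) * (4^k * (1/8)^k)"
        by (simp add: algebra_simps)
      also have "(4::real)^k * (1/8)^k = (1/2)^k"
        by (simp flip: power_mult_distrib)
      also have "(9/8 * C) * (1/2)^k \<le> 2 * C * (1/2)^k"
        using C by (intro mult_right_mono) auto
      finally show "4^k * (C * ((1/8)^Suc k + (1/8)^k)) \<le> 2 * C * (1/2)^k" .
    qed
    finally show "(\<integral>\<^sup>+x. ennreal (4^k * d k x) \<partial>M) \<le> ennreal (2 * C * (1/2)^k)" .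
  qed auto
  also have "\<dots> < \<infinity>"
  proof -
    have "(\<Sum>k. ennreal (2 * C * (1/2)^k)) = ennreal (\<Sum>k. 2 * C * (1/2)^k)"
      using C by (intro suminf_ennreal2 summable_mult summable_geometric) auto
    then show ?thesis by simp
  qed
  finally have "AE x in M. (\<Sum>k. ennreal (4^k * d k x)) \<noteq> \<infinity>"
    by (intro nn_integral_noteq_infinite) auto
  then have lim: "AE x in M. (\<lambda>k. u k x) \<longlonglongrightarrow> g x"
  proof eventually_elim
    fix x assume fin: "(\<Sum>k. ennreal (4^k * d k x)) \<noteq> \<infinity>"
    define K where "K = enn2real (\<Sum>k. ennreal (4^k * d k x))"
    have dle: "norm (u (Suc k) x - u k x) \<le> sqrt K * (1/2)^k" for k
    proof -
      have "ennreal (4^k * d k x) \<le> (\<Sum>k. ennreal (4^k * d k x))"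
        using sum_le_suminf[of "\<lambda>k. ennreal (4^k * d k x)" "{k}"] by simp
      also have "\<dots> = ennreal K" using fin by (simp add: K_def less_top)
      finally have "4^k * d k x \<le> K"
        by (subst (asm) ennreal_le_iff) (auto simp: K_def)
      then have "sqrt (4^k * d k x) \<le> sqrt K" by simp
      then have "2^k * norm (u (Suc k) x - u k x) \<le> sqrt K"
        by (simp add: d_def real_sqrt_mult real_sqrt_power)
      then show ?thesis by (simp add: field_simps)
    qed
    have sm: "summable (\<lambda>k. sqrt K * (1/2)^k)" by (intro summable_mult summable_geometric) auto
    have "summable (\<lambda>k. u (Suc k) x - u k x)"
      by (rule summable_comparison_test'[OF sm dle])
    then have "convergent (\<lambda>n. \<Sum>k<n. u (Suc k) x - u k x)"
      by (simp add: summable_iff_convergent)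
    then have "convergent (\<lambda>n. u n x - u 0 x)"
      by (simp only: sum_lessThan_telescope[of "\<lambda>k. u k x"])
    then have "convergent (\<lambda>n. (u n x - u 0 x) + u 0 x)"
      by (intro convergent_add convergent_const)
    then show "(\<lambda>k. u k x) \<longlonglongrightarrow> g x"
      unfolding g_def by (simp add: convergent_LIMSEQ_iff)
  qed
  have bound: "(\<integral>\<^sup>+x. ennreal ((norm (u k x - g x))\<^sup>2) \<partial>M) \<le> ennreal (C * (0 + (1/8)^k))" for k
  proof (rule nn_integral_Fatou_bound[where u = "\<lambda>j x. ennreal ((norm (u j x - u k x))\<^sup>2)" and C = "\<lambda>j. ennreal (C * ((1/8)^j + (1/8)^k))"])
    show "AE x in M. (\<lambda>j. ennreal ((norm (u j x - u k x))\<^sup>2)) \<longlonglongrightarrow> ennreal ((norm (u k x - g x))\<^sup>2)"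
      using lim
    proof eventually_elim
      fix x assume "(\<lambda>k. u k x) \<longlonglongrightarrow> g x"
      then have "(\<lambda>j. ennreal ((norm (u j x - u k x))\<^sup>2)) \<longlonglongrightarrow> ennreal ((norm (g x - u k x))\<^sup>2)"
        by (intro tendsto_ennrealI tendsto_intros)
      then show "(\<lambda>j. ennreal ((norm (u j x - u k x))\<^sup>2)) \<longlonglongrightarrow> ennreal ((norm (u k x - g x))\<^sup>2)"
        by (simp add: norm_minus_commute)
    qed
    show "(\<lambda>j. ennreal (C * ((1/8)^j + (1/8)^k))) \<longlonglongrightarrow> ennreal (C * (0 + (1/8)^k))"
      by (intro tendsto_ennrealI tendsto_intros LIMSEQ_power_zero) simp
  qed (use le in auto)
  have "(\<lambda>k. ennreal (C * (0 + (1/8)^k))) \<longlonglongrightarrow> ennreal (C * (0 + 0))"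
    by (intro tendsto_ennrealI tendsto_intros LIMSEQ_power_zero) simp
  then have lim0: "(\<lambda>k. ennreal (C * (0 + (1/8)^k))) \<longlonglongrightarrow> 0" by simp
  show "(\<lambda>k. \<integral>\<^sup>+x. ennreal ((norm (u k x - g x))\<^sup>2) \<partial>M) \<longlonglongrightarrow> 0"
    by (rule tendsto_sandwich[OF _ _ tendsto_const lim0]) (intro always_eventually allI bound zero_le)+
qed

text \<open>Truncations of a Borel representative, thinned out to squared L2 error 8^(-k), have
  transforms that are Cauchy by \<open>nn_integral_ift_le\<close>, and
  \<open>riesz_fischer_fast\<close> gives their limit. Existence is what makes the choice in
  \<open>fourier_L2\<close> meaningful.\<close>

lemma ex_is_fourier_L2:
  fixes \<psi> :: "'a::euclidean_space \<Rightarrow> complex"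
  assumes "square_integrable \<psi>"
  shows "\<exists>g. is_fourier_L2 \<psi> g"
proof -
  have \<psi>: "\<psi> \<in> borel_measurable lebesgue" using assms by (simp add: square_integrable_def)
  obtain \<psi>' where [measurable]: "\<psi>' \<in> borel_measurable borel" and AE: "AE x in lborel. \<psi> x = \<psi>' x"
    by (rule borel_representative_complex[OF \<psi>])
  have sq: "integrable lborel (\<lambda>x. (norm (\<psi>' x))\<^sup>2)"
    using assms square_integrable_iff_lborel[OF \<psi> _ AE] by simp
  then have fin: "(\<integral>\<^sup>+x. ennreal ((norm (\<psi>' x))\<^sup>2) \<partial>lborel) < \<infinity>"
    by (simp add: integrable_iff_bounded)
  define T where "T k x = (if norm (\<psi>' x) \<le> real k \<and> norm x \<le> real k then \<psi>' x else 0)" for k x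
  have [measurable]: "T k \<in> borel_measurable borel" for k unfolding T_def[abs_def] by measurable
  have T0: "(\<lambda>k. \<integral>\<^sup>+x. ennreal ((norm (T k x - \<psi>' x))\<^sup>2) \<partial>lborel) \<longlonglongrightarrow> 0"
    unfolding T_def by (rule truncation_tendsto_L2[OF _ fin]) simp
  have T1: "integrable lborel (T k)" for k
  proof (rule Bochner_Integration.integrable_bound)
    show "integrable lborel (\<lambda>x. real k * indicator (cball (0::'a) (real k)) x)"
      by (intro integrable_mult_right integrable_real_indicator emeasure_bounded_finite bounded_cball) auto
  qed (auto simp: T_def indicator_def)
  have T2: "integrable lborel (\<lambda>x. (norm (T k x))\<^sup>2)" for k
    by (rule Bochner_Integration.integrable_bound[OF sq]) (auto simp: T_def)
  have "\<exists>n. (\<integral>\<^sup>+x. ennreal ((norm (T n x - \<psi>' x))\<^sup>2) \<partial>lborel) \<le> ennreal ((1/8)^k)" for k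
  proof -
    have "\<forall>\<^sub>F n in sequentially. (\<integral>\<^sup>+x. ennreal ((norm (T n x - \<psi>' x))\<^sup>2) \<partial>lborel) < ennreal ((1/8)^k)"
      by (rule order_tendstoD(2)[OF T0]) simp
    from eventually_happens'[OF sequentially_bot this] show ?thesis
      by (auto intro: less_imp_le)
  qed
  then obtain r where r: "\<And>k. (\<integral>\<^sup>+x. ennreal ((norm (T (r k) x - \<psi>' x))\<^sup>2) \<partial>lborel) \<le> ennreal ((1/8)^k)"
    by metis
  define F where "F k = T (r k)" for k
  have F1: "integrable lborel (F k)" "integrable lborel (\<lambda>x. (norm (F k x))\<^sup>2)" for k
    using T1 T2 by (auto simp: F_def)
  have [measurable]: "F k \<in> borel_measurable borel" for k by (simp add: F_def)
  have FF: "fourier (F k) = (\<lambda>\<xi>. ift (F k) (- \<xi>))" for k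
    by (rule ext, rule fourier_eq_ift) simp
  have [measurable]: "fourier (F k) \<in> borel_measurable borel" for k unfolding FF by measurable
  have cauchy: "(\<integral>\<^sup>+\<xi>. ennreal ((norm (fourier (F j) \<xi> - fourier (F k) \<xi>))\<^sup>2) \<partial>lborel) \<le> ennreal (2 * ((1/8)^j + (1/8)^k))" for j k
  proof -
    have "(\<integral>\<^sup>+\<xi>. ennreal ((norm (fourier (F j) \<xi> - fourier (F k) \<xi>))\<^sup>2) \<partial>lborel)
      = (\<integral>\<^sup>+\<xi>. ennreal ((norm (ift (\<lambda>x. F j x - F k x) (- \<xi>)))\<^sup>2) \<partial>lborel)"
      by (simp add: FF ift_diff[OF F1(1) F1(1)])
    also have "\<dots> = (\<integral>\<^sup>+\<xi>. ennreal ((norm (ift (\<lambda>x. F j x - F k x) \<xi>))\<^sup>2) \<partial>lborel)"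
      by (rule nn_integral_lborel_uminus) measurable
    also have "\<dots> \<le> (\<integral>\<^sup>+x. ennreal ((norm (F j x - F k x))\<^sup>2) \<partial>lborel)"
      by (rule nn_integral_ift_le) (use F1 in auto)
    also have "\<dots> = (\<integral>\<^sup>+x. ennreal ((norm ((F j x - \<psi>' x) + (\<psi>' x - F k x)))\<^sup>2) \<partial>lborel)"
      by simp
    also have "\<dots> \<le> ennreal (1 + 1) * (\<integral>\<^sup>+x. ennreal ((norm (F j x - \<psi>' x))\<^sup>2) \<partial>lborel) + ennreal (1 + 1 / 1) * (\<integral>\<^sup>+x. ennreal ((norm (\<psi>' x - F k x))\<^sup>2) \<partial>lborel)"
      by (rule nn_integral_norm_add_square_le) auto
    also have "\<dots> \<le> ennreal (1 + 1) * ennreal ((1/8)^j) + ennreal (1 + 1 / 1) * ennreal ((1/8)^k)"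
      using r[of j] r[of k] by (intro add_mono mult_left_mono) (auto simp: F_def norm_minus_commute)
    also have "\<dots> = ennreal (2 * ((1/8)^j + (1/8)^k))"
      by (simp add: ennreal_mult' distrib_left)
    finally show ?thesis .
  qed
  obtain g where [measurable]: "g \<in> borel_measurable lborel"
    and g: "(\<lambda>k. \<integral>\<^sup>+\<xi>. ennreal ((norm (fourier (F k) \<xi> - g \<xi>))\<^sup>2) \<partial>lborel) \<longlonglongrightarrow> 0"
    by (rule riesz_fischer_fast[where u = "\<lambda>k. fourier (F k)" and M = "lborel :: 'a measure" and C = 2]) (use cauchy in auto)
  have g': "g \<in> borel_measurable borel" by simp
  have g_sq: "integrable lborel (\<lambda>\<xi>. (norm (g \<xi>))\<^sup>2)"
  proof (rule integrableI_bounded)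
    have "\<forall>\<^sub>F k in sequentially. (\<integral>\<^sup>+\<xi>. ennreal ((norm (fourier (F k) \<xi> - g \<xi>))\<^sup>2) \<partial>lborel) < 1"
      by (rule order_tendstoD(2)[OF g]) simp
    then obtain k where k: "(\<integral>\<^sup>+\<xi>. ennreal ((norm (fourier (F k) \<xi> - g \<xi>))\<^sup>2) \<partial>lborel) < 1"
      using eventually_happens'[OF sequentially_bot] by blast
    have "integrable lborel (\<lambda>\<xi>. (norm (fourier (F k) \<xi>))\<^sup>2)"
      unfolding FF by (rule integrable_lborel_uminus[OF integrable_ift_square(1)[OF F1]])
    then have Fk: "(\<integral>\<^sup>+\<xi>. ennreal ((norm (fourier (F k) \<xi>))\<^sup>2) \<partial>lborel) < \<infinity>"
      by (simp add: integrable_iff_bounded)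
    have "(\<integral>\<^sup>+\<xi>. ennreal (norm ((norm (g \<xi>))\<^sup>2)) \<partial>lborel) = (\<integral>\<^sup>+\<xi>. ennreal ((norm (fourier (F k) \<xi> + (g \<xi> - fourier (F k) \<xi>)))\<^sup>2) \<partial>lborel)"
      by simp
    also have "\<dots> \<le> ennreal (1 + 1) * (\<integral>\<^sup>+\<xi>. ennreal ((norm (fourier (F k) \<xi>))\<^sup>2) \<partial>lborel) + ennreal (1 + 1 / 1) * (\<integral>\<^sup>+\<xi>. ennreal ((norm (g \<xi> - fourier (F k) \<xi>))\<^sup>2) \<partial>lborel)"
      by (rule nn_integral_norm_add_square_le) auto
    also have "\<dots> < \<infinity>"
      using Fk order.strict_trans[OF k ennreal_one_less_top]
      by (auto simp: ennreal_mult_less_top norm_minus_commute)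
    finally show "(\<integral>\<^sup>+\<xi>. ennreal (norm ((norm (g \<xi>))\<^sup>2)) \<partial>lborel) < \<infinity>" .
  qed simp
  have "is_fourier_L2 \<psi> g"
    unfolding is_fourier_L2_def
  proof (intro conjI exI allI)
    show "g \<in> borel_measurable borel" by (fact g')
    show "square_integrable g"
      using g_sq g' by (subst square_integrable_iff_lborel[where f' = g]) (auto simp: measurable_completion)
    show "integrable lebesgue (F k)" for k
      using F1(1)[of k] by (subst integrable_lebesgue_iff_lborel[where f' = "F k"]) (auto simp: measurable_completion)
    show "square_integrable (F k)" for k
      using F1(2)[of k] by (subst square_integrable_iff_lborel[where f' = "F k"]) (auto simp: measurable_completion)
    show "(\<lambda>k. \<integral>\<^sup>+\<xi>. ennreal ((norm (fourier (F k) \<xi> - g \<xi>))\<^sup>2) \<partial>lebesgue) \<longlonglongrightarrow> 0"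
      using g by (simp add: nn_integral_completion)
    have "(\<integral>\<^sup>+x. ennreal ((norm (F k x - \<psi> x))\<^sup>2) \<partial>lborel) = (\<integral>\<^sup>+x. ennreal ((norm (F k x - \<psi>' x))\<^sup>2) \<partial>lborel)" for k
      using AE by (intro nn_integral_cong_AE) (auto elim: eventually_mono)
    moreover have "(\<lambda>k. \<integral>\<^sup>+x. ennreal ((norm (F k x - \<psi>' x))\<^sup>2) \<partial>lborel) \<longlonglongrightarrow> 0"
    proof (rule tendsto_sandwich[OF _ _ tendsto_const])
      have "(\<lambda>k. ennreal ((1/8)^k)) \<longlonglongrightarrow> ennreal 0"
        by (intro tendsto_ennrealI LIMSEQ_power_zero) simp
      then show "(\<lambda>k. ennreal ((1/8)^k)) \<longlonglongrightarrow> 0" by simp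
    qed (use r in \<open>auto simp: F_def\<close>)
    ultimately show "(\<lambda>k. \<integral>\<^sup>+x. ennreal ((norm (F k x - \<psi> x))\<^sup>2) \<partial>lebesgue) \<longlonglongrightarrow> 0"
      by (simp add: nn_integral_completion)
  qed
  then show ?thesis by blast
qed

text \<open>Cauchy-Schwarz: the squared distance \<open>(D k)\<^sup>2\<close> of the two pairings is
  at most the product of the squared L2 norms of \<open>f\<close> and
  \<open>u k - v\<close>.\<close>

lemma tendsto_integral_mult_cnj:
  fixes f v :: "'a \<Rightarrow> complex" and u :: "nat \<Rightarrow> 'a \<Rightarrow> complex"
  assumes [measurable]: "f \<in> borel_measurable M" "v \<in> borel_measurable M" "\<And>k. u k \<in> borel_measurable M"
    and f: "integrable M (\<lambda>x. (norm (f x))\<^sup>2)" and v: "integrable M (\<lambda>x. (norm (v x))\<^sup>2)"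
    and u: "\<And>k. integrable M (\<lambda>x. (norm (u k x))\<^sup>2)"
    and lim: "(\<lambda>k. \<integral>\<^sup>+x. ennreal ((norm (u k x - v x))\<^sup>2) \<partial>M) \<longlonglongrightarrow> 0"
  shows "(\<lambda>k. LINT x|M. f x * cnj (u k x)) \<longlonglongrightarrow> (LINT x|M. f x * cnj (v x))"
proof -
  let ?d = "\<lambda>k. \<integral>\<^sup>+x. ennreal ((norm (u k x - v x))\<^sup>2) \<partial>M"
  let ?A = "\<integral>\<^sup>+x. ennreal ((norm (f x))\<^sup>2) \<partial>M"
  define D where "D k = norm ((LINT x|M. f x * cnj (u k x)) - (LINT x|M. f x * cnj (v x)))" for k
  have le: "ennreal ((D k)\<^sup>2) \<le> ?A * ?d k" for k
  proof -
    have i1: "integrable M (\<lambda>x. f x * cnj (u k x))" and i2: "integrable M (\<lambda>x. f x * cnj (v x))"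
      using f u v by (auto intro!: integrable_mult_cnj_L2)
    have "ennreal (D k) = ennreal (norm (LINT x|M. f x * cnj (u k x) - f x * cnj (v x)))"
      unfolding D_def Bochner_Integration.integral_diff[OF i1 i2] ..
    also have "\<dots> \<le> (\<integral>\<^sup>+x. ennreal (norm (f x * cnj (u k x) - f x * cnj (v x))) \<partial>M)"
      using i1 i2 by (intro integral_norm_bound_ennreal Bochner_Integration.integrable_diff)
    also have "\<dots> = (\<integral>\<^sup>+x. ennreal (norm (f x)) * ennreal (norm (u k x - v x)) \<partial>M)"
    proof (rule nn_integral_cong)
      fix x
      have "f x * cnj (u k x) - f x * cnj (v x) = f x * cnj (u k x - v x)"
        by (simp add: right_diff_distrib)
      then have "norm (f x * cnj (u k x) - f x * cnj (v x)) = norm (f x) * norm (u k x - v x)"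
        by (simp only: norm_mult complex_mod_cnj)
      then show "ennreal (norm (f x * cnj (u k x) - f x * cnj (v x))) = ennreal (norm (f x)) * ennreal (norm (u k x - v x))"
        by (simp add: ennreal_mult')
    qed
    finally have "(ennreal (D k))\<^sup>2 \<le> (\<integral>\<^sup>+x. ennreal (norm (f x)) * ennreal (norm (u k x - v x)) \<partial>M)\<^sup>2"
      by (rule power_mono) simp
    also have "\<dots> \<le> (\<integral>\<^sup>+x. (ennreal (norm (f x)))\<^sup>2 \<partial>M) * (\<integral>\<^sup>+x. (ennreal (norm (u k x - v x)))\<^sup>2 \<partial>M)"
      by (rule Cauchy_Schwarz_nn_integral) auto
    finally show ?thesis by (simp add: ennreal_power D_def)
  qed
  have "?A < top" using f by (simp add: integrable_iff_bounded)
  then have "(\<lambda>k. ?A * ?d k) \<longlonglongrightarrow> ?A * 0"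
    by (intro ennreal_tendsto_cmult lim)
  then have lim0: "(\<lambda>k. ?A * ?d k) \<longlonglongrightarrow> 0" by simp
  have "(\<lambda>k. ennreal ((D k)\<^sup>2)) \<longlonglongrightarrow> 0"
    by (rule tendsto_sandwich[OF _ _ tendsto_const lim0]) (intro always_eventually allI le zero_le)+
  then have "(\<lambda>k. (D k)\<^sup>2) \<longlonglongrightarrow> 0"
    by (subst (asm) ennreal_tendsto_0_iff) auto
  then have "(\<lambda>k. sqrt ((D k)\<^sup>2)) \<longlonglongrightarrow> sqrt 0"
    by (intro tendsto_intros)
  then have "D \<longlonglongrightarrow> 0" by (simp add: D_def[abs_def])
  then show ?thesis unfolding D_def[abs_def] by (simp add: LIM_zero_iff tendsto_norm_zero_iff)
qed

text \<open>Both pairings pass to the limit along the sequence that witnesses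
  \<open>is_fourier_L2\<close>; for its members the identity is \<open>parseval\<close>, with the
  frequency reflected because \<open>fourier\<close> is \<open>ift\<close> at the opposite
  point.\<close>

lemma parseval_fourier_L2:
  fixes f \<psi> \<psi>' :: "'a::euclidean_space \<Rightarrow> complex"
  assumes f: "integrable lborel f" "integrable lborel (\<lambda>x. (norm (f x))\<^sup>2)"
    and \<psi>: "square_integrable \<psi>" and \<psi>'[measurable]: "\<psi>' \<in> borel_measurable borel"
    and AE: "AE x in lborel. \<psi> x = \<psi>' x" and g: "is_fourier_L2 \<psi> g"
  shows "(LINT x|lborel. f x * cnj (\<psi>' x)) = (LINT \<xi>|lborel. fourier f \<xi> * cnj (g \<xi>))"
proof -
  have [measurable]: "f \<in> borel_measurable borel" using f by auto
  have \<psi>m: "\<psi> \<in> borel_measurable lebesgue" using \<psi> by (simp add: square_integrable_def)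
  obtain F where F: "\<And>k. integrable lebesgue (F k)" "\<And>k. square_integrable (F k)"
    and l1: "(\<lambda>k. \<integral>\<^sup>+x. ennreal ((norm (F k x - \<psi> x))\<^sup>2) \<partial>lborel) \<longlonglongrightarrow> 0"
    and l2: "(\<lambda>k. \<integral>\<^sup>+\<xi>. ennreal ((norm (fourier (F k) \<xi> - g \<xi>))\<^sup>2) \<partial>lborel) \<longlonglongrightarrow> 0"
    and [measurable]: "g \<in> borel_measurable borel" and g: "square_integrable g"
    using g unfolding is_fourier_L2_def nn_integral_completion by blast
  have Fm: "F k \<in> borel_measurable lebesgue" for k using F(2)[of k] by (simp add: square_integrable_def)
  have "\<exists>F'. F' \<in> borel_measurable borel \<and> (AE x in lborel. F k x = F' x)" for k
    by (rule borel_representative_complex[OF Fm[of k]]) blast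
  then obtain F' where F'[measurable]: "\<And>k. F' k \<in> borel_measurable borel" and F'AE: "\<And>k. AE x in lborel. F k x = F' k x"
    by metis
  have F'1: "integrable lborel (F' k)" for k
    using integrable_lebesgue_iff_lborel[OF Fm F' F'AE] F(1) by blast
  have F'2: "integrable lborel (\<lambda>x. (norm (F' k x))\<^sup>2)" for k
    using square_integrable_iff_lborel[OF Fm F' F'AE] F(2) by blast
  have \<psi>'2: "integrable lborel (\<lambda>x. (norm (\<psi>' x))\<^sup>2)"
    using square_integrable_iff_lborel[OF \<psi>m \<psi>' AE] \<psi> by blast
  have g2: "integrable lborel (\<lambda>x. (norm (g x))\<^sup>2)"
    using square_integrable_iff_lborel[of g g] g by (simp add: measurable_completion)
  have FF: "fourier (F k) = (\<lambda>\<xi>. ift (F' k) (- \<xi>))" for k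
    by (rule ext, rule fourier_eq_ift_AE[OF Fm F' F'AE])
  have ff: "fourier f = (\<lambda>\<xi>. ift f (- \<xi>))"
    by (rule ext, rule fourier_eq_ift) simp
  have "(\<integral>\<^sup>+x. ennreal ((norm (F k x - \<psi> x))\<^sup>2) \<partial>lborel) = (\<integral>\<^sup>+x. ennreal ((norm (F' k x - \<psi>' x))\<^sup>2) \<partial>lborel)" for k
    by (rule nn_integral_cong_AE, use F'AE[of k] AE in eventually_elim) simp
  with l1 have l1': "(\<lambda>k. \<integral>\<^sup>+x. ennreal ((norm (F' k x - \<psi>' x))\<^sup>2) \<partial>lborel) \<longlonglongrightarrow> 0" by simp
  have c1: "(\<lambda>k. LINT x|lborel. f x * cnj (F' k x)) \<longlonglongrightarrow> (LINT x|lborel. f x * cnj (\<psi>' x))"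
    by (rule tendsto_integral_mult_cnj[OF _ _ _ f(2) \<psi>'2 F'2 l1']) auto
  have c2: "(\<lambda>k. LINT \<xi>|lborel. fourier f \<xi> * cnj (fourier (F k) \<xi>)) \<longlonglongrightarrow> (LINT \<xi>|lborel. fourier f \<xi> * cnj (g \<xi>))"
  proof (rule tendsto_integral_mult_cnj[OF _ _ _ _ g2 _ l2])
    show "integrable lborel (\<lambda>\<xi>. (norm (fourier f \<xi>))\<^sup>2)" unfolding ff
      by (rule integrable_lborel_uminus[OF integrable_ift_square(1)[OF f]])
    show "integrable lborel (\<lambda>\<xi>. (norm (fourier (F k) \<xi>))\<^sup>2)" for k unfolding FF
      by (rule integrable_lborel_uminus[OF integrable_ift_square(1)[OF F'1 F'2]])
  qed (auto simp: ff FF)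
  have "(LINT \<xi>|lborel. fourier f \<xi> * cnj (fourier (F k) \<xi>)) = (LINT x|lborel. f x * cnj (F' k x))" for k
  proof -
    have "(LINT \<xi>|lborel. fourier f \<xi> * cnj (fourier (F k) \<xi>)) = (LINT \<xi>|lborel. ift f \<xi> * cnj (ift (F' k) \<xi>))"
      unfolding ff FF by (rule integral_lborel_uminus[of "\<lambda>\<xi>. ift f \<xi> * cnj (ift (F' k) \<xi>)"]) measurable
    also have "\<dots> = (LINT x|lborel. f x * cnj (F' k x))"
      by (rule parseval[OF f F'1 F'2])
    finally show ?thesis .
  qed
  with c2 have "(\<lambda>k. LINT x|lborel. f x * cnj (F' k x)) \<longlonglongrightarrow> (LINT \<xi>|lborel. fourier f \<xi> * cnj (g \<xi>))" by simp
  with c1 show ?thesis by (rule LIMSEQ_unique)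
qed

lemma is_fourier_L2_fourier_L2: "square_integrable \<psi> \<Longrightarrow> is_fourier_L2 \<psi> (fourier_L2 \<psi>)"
  unfolding fourier_L2_def by (rule someI_ex[OF ex_is_fourier_L2])

subsection \<open>Schwartz functions\<close>

text \<open>The Gamma integral writes the function as a superposition of exp (- s) times Gaussians
  in x. Integrating over space costs a factor s^(-n/2), and the Gamma integral that is left
  converges because p > n/2.\<close>

lemma integrable_inverse_polynomial:
  assumes p: "p > real DIM('a) / 2"
  shows "integrable lborel (\<lambda>x::'a::euclidean_space. (1 + (norm x)\<^sup>2) powr - p)"
proof (rule integrableI_bounded)
  define n where "n = real DIM('a)"
  have p0: "p > 0" and pn: "p - n / 2 > 0" using p by (auto simp: n_def intro: order.strict_trans1[OF _ p])
  define I where "I = (indicator {0<..} :: real \<Rightarrow> ennreal)"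
  have [measurable]: "I \<in> borel_measurable borel" by (simp add: I_def)
  have "ennreal (Gamma p) * (\<integral>\<^sup>+x. ennreal (norm ((1 + (norm (x::'a))\<^sup>2) powr - p)) \<partial>lborel)
    = (\<integral>\<^sup>+x. ennreal (Gamma p * (1 + (norm (x::'a))\<^sup>2) powr - p) \<partial>lborel)"
    using p0 by (subst nn_integral_cmult[symmetric]) (auto simp: ennreal_mult' Gamma_real_pos less_imp_le)
  also have "\<dots> = (\<integral>\<^sup>+x. (\<integral>\<^sup>+s. ennreal (s powr (p - 1) * exp (- ((1 + (norm (x::'a))\<^sup>2) * s))) * I s \<partial>lborel) \<partial>lborel)"
    unfolding I_def by (intro nn_integral_cong nn_integral_Gamma_scaled[symmetric] p0) (simp add: add_pos_nonneg)
  also have "\<dots> = (\<integral>\<^sup>+s. (\<integral>\<^sup>+x. ennreal (s powr (p - 1) * exp (- ((1 + (norm (x::'a))\<^sup>2) * s))) * I s \<partial>lborel) \<partial>lborel)"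
    by (rule lborel_pair.Fubini'[symmetric]) measurable
  also have "\<dots> = (\<integral>\<^sup>+s. ennreal (pi powr (n / 2)) * (ennreal (s powr ((p - n / 2) - 1) * exp (- (1 * s))) * I s) \<partial>lborel)"
  proof (rule nn_integral_cong)
    fix s :: real
    show "(\<integral>\<^sup>+x. ennreal (s powr (p - 1) * exp (- ((1 + (norm (x::'a))\<^sup>2) * s))) * I s \<partial>lborel)
      = ennreal (pi powr (n / 2)) * (ennreal (s powr ((p - n / 2) - 1) * exp (- (1 * s))) * I s)"
    proof (cases "s > 0")
      case True
      have "(\<integral>\<^sup>+x. ennreal (s powr (p - 1) * exp (- ((1 + (norm (x::'a))\<^sup>2) * s))) * I s \<partial>lborel)
        = (\<integral>\<^sup>+x. ennreal (s powr (p - 1) * exp (- s)) * ennreal (exp (- (s * (norm (x - (0::'a)))\<^sup>2))) \<partial>lborel)"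
        using True by (intro nn_integral_cong) (simp add: I_def ennreal_mult'[symmetric] exp_add[symmetric] ring_distribs mult_ac)
      also have "\<dots> = ennreal (s powr (p - 1) * exp (- s)) * ennreal ((pi / s) powr (n / 2))"
        using nn_integral_gaussian[OF True, of "0::'a"] by (subst nn_integral_cmult) (auto simp: n_def)
      also have "\<dots> = ennreal (s powr (p - 1) * exp (- s) * (pi / s) powr (n / 2))"
        by (rule ennreal_mult'[symmetric]) simp
      also have "s powr (p - 1) * exp (- s) * (pi / s) powr (n / 2) = pi powr (n / 2) * (s powr ((p - n / 2) - 1) * exp (- (1 * s)))"
      proof -
        have "s powr ((p - n / 2) - 1) = s powr (p - 1) / s powr (n / 2)"
          unfolding powr_diff[symmetric] by (simp add: algebra_simps)
        then show ?thesis using True by (simp add: powr_divide)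
      qed
      finally show ?thesis using True by (simp add: I_def ennreal_mult')
    qed (simp add: I_def)
  qed
  also have "\<dots> = ennreal (pi powr (n / 2)) * ennreal (Gamma (p - n / 2) * 1 powr - (p - n / 2))"
    using nn_integral_Gamma_scaled[OF pn, of 1] by (subst nn_integral_cmult) (auto simp: I_def)
  also have "\<dots> < \<infinity>" by (auto simp: ennreal_mult_less_top)
  finally show "(\<integral>\<^sup>+x. ennreal (norm ((1 + (norm (x::'a))\<^sup>2) powr - p)) \<partial>lborel) < \<infinity>"
    using Gamma_real_pos[OF p0] by (auto simp: ennreal_mult_less_top ennreal_eq_0_iff)
qed simp

section \<open>Smoothness and decay of a function, and weighted bounds for its transform\<close>

lemma ift_translate:
  fixes f :: "'a::euclidean_space \<Rightarrow> complex"
  assumes [measurable]: "f \<in> borel_measurable borel"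
  shows "ift (\<lambda>x. f (x + c)) t = cis (- (2 * pi * (c \<bullet> t))) * ift f t"
proof -
  have "ift f t = (LINT x|distr lborel borel ((+) c). f x * cis (2 * pi * (x \<bullet> t)))"
    unfolding ift_def by (simp add: lborel_distr_plus)
  also have "\<dots> = (LINT x|lborel. f (x + c) * cis (2 * pi * ((x + c) \<bullet> t)))"
    by (subst integral_distr) (auto simp: add.commute)
  also have "\<dots> = (LINT x|lborel. cis (2 * pi * (c \<bullet> t)) * (f (x + c) * cis (2 * pi * (x \<bullet> t))))"
    by (intro Bochner_Integration.integral_cong) (auto simp: inner_add_left distrib_left cis_mult[symmetric])
  also have "\<dots> = cis (2 * pi * (c \<bullet> t)) * ift (\<lambda>x. f (x + c)) t"
    unfolding ift_def integral_mult_right_zero ..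
  finally show ?thesis
    by (simp add: mult.assoc[symmetric] cis_mult)
qed

lemma norm_cis_minus_one_square: "(norm (cis x - 1))\<^sup>2 = (2 * sin (x / 2))\<^sup>2"
proof -
  have "(norm (cis x - 1))\<^sup>2 = (cos x - 1)\<^sup>2 + (sin x)\<^sup>2"
    by (simp add: cmod_power2)
  also have "\<dots> = 2 - 2 * cos x"
    using sin_cos_squared_add[of x] by (simp add: power2_diff)
  also have "cos x = 1 - 2 * (sin (x / 2))\<^sup>2"
    using cos_double_sin[of "x / 2"] by simp
  finally show ?thesis by (simp add: power_mult_distrib)
qed

lemma cis_difference_quotient:
  "(\<lambda>k. (norm (cis (x * (1 / Suc k)) - 1))\<^sup>2 * (Suc k)\<^sup>2) \<longlonglongrightarrow> x\<^sup>2"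
proof -
  have "((\<lambda>h. sin (x / 2 * h)) has_field_derivative x / 2) (at 0)"
    by (auto intro!: derivative_eq_intros)
  then have *: "((\<lambda>h. sin (x / 2 * h) / h) \<longlongrightarrow> x / 2) (at 0)"
    by (simp add: DERIV_def)
  have "filterlim (\<lambda>k. 1 / real (Suc k)) (at 0) sequentially"
    using LIMSEQ_Suc[OF lim_1_over_n] by (intro filterlim_atI) auto
  from filterlim_compose[OF * this]
  have q: "(\<lambda>k. sin (x / 2 * (1 / Suc k)) / (1 / Suc k)) \<longlonglongrightarrow> x / 2" .
  have "(\<lambda>k. 4 * (sin (x / 2 * (1 / Suc k)) / (1 / Suc k))\<^sup>2) \<longlonglongrightarrow> 4 * (x / 2)\<^sup>2"
    by (intro tendsto_mult tendsto_power tendsto_const q)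
  then show ?thesis
    by (simp add: norm_cis_minus_one_square power_mult_distrib power_divide mult_ac)
qed

text \<open>Finite directional energy of the transform, by Plancherel for difference quotients and Fatou.\<close>

lemma nn_integral_ift_derivative_bound:
  fixes f :: "'a::euclidean_space \<Rightarrow> complex"
  assumes f: "integrable lborel f" and W: "integrable lborel W"
    and bd: "\<And>x h. \<bar>h\<bar> \<le> 1 \<Longrightarrow> (norm (f (x + h *\<^sub>R b) - f x))\<^sup>2 \<le> h\<^sup>2 * W x"
  shows "(\<integral>\<^sup>+t. ennreal ((2 * pi * (b \<bullet> t))\<^sup>2 * (norm (ift f t))\<^sup>2) \<partial>lborel) \<le> (\<integral>\<^sup>+x. ennreal (W x) \<partial>lborel)"
proof -
  have [measurable]: "f \<in> borel_measurable borel" "W \<in> borel_measurable borel" using f W by auto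
  define h where "h k = 1 / real (Suc k)" for k
  define u where "u k t = ennreal ((norm (cis ((- (2 * pi * (b \<bullet> t))) * (1 / Suc k)) - 1))\<^sup>2 * (Suc k)\<^sup>2 * (norm (ift f t))\<^sup>2)" for k t
  have [measurable]: "u k \<in> borel_measurable borel" for k unfolding u_def[abs_def] by measurable
  show ?thesis
  proof (rule nn_integral_Fatou_bound[where u = u and C = "\<lambda>_. \<integral>\<^sup>+x. ennreal (W x) \<partial>lborel"])
    show "AE t in lborel. (\<lambda>k. u k t) \<longlonglongrightarrow> ennreal ((2 * pi * (b \<bullet> t))\<^sup>2 * (norm (ift f t))\<^sup>2)"
    proof (rule AE_I2)
      fix t
      have "(\<lambda>k. u k t) \<longlonglongrightarrow> ennreal ((- (2 * pi * (b \<bullet> t)))\<^sup>2 * (norm (ift f t))\<^sup>2)"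
        unfolding u_def by (intro tendsto_ennrealI tendsto_mult cis_difference_quotient tendsto_const)
      then show "(\<lambda>k. u k t) \<longlonglongrightarrow> ennreal ((2 * pi * (b \<bullet> t))\<^sup>2 * (norm (ift f t))\<^sup>2)" by simp
    qed
    show "(\<integral>\<^sup>+t. u k t \<partial>lborel) \<le> (\<integral>\<^sup>+x. ennreal (W x) \<partial>lborel)" for k
    proof -
      have fh: "integrable lborel (\<lambda>x. f (x + h k *\<^sub>R b))"
      proof -
        have "integrable (distr lborel borel ((+) (h k *\<^sub>R b))) f" using f by (simp add: lborel_distr_plus)
        then show ?thesis by (subst (asm) integrable_distr_eq) (auto simp: add.commute)
      qed
      have "(\<integral>\<^sup>+t. u k t \<partial>lborel) = (\<integral>\<^sup>+t. ennreal ((Suc k)\<^sup>2) * ennreal ((norm (ift (\<lambda>x. f (x + h k *\<^sub>R b) - f x) t))\<^sup>2) \<partial>lborel)"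
      proof (rule nn_integral_cong)
        fix t
        have "ift (\<lambda>x. f (x + h k *\<^sub>R b) - f x) t = (cis ((- (2 * pi * (b \<bullet> t))) * (1 / Suc k)) - 1) * ift f t"
          unfolding ift_diff[OF fh f] ift_translate[OF \<open>f \<in> borel_measurable borel\<close>]
          by (simp add: h_def left_diff_distrib)
        then show "u k t = ennreal ((Suc k)\<^sup>2) * ennreal ((norm (ift (\<lambda>x. f (x + h k *\<^sub>R b) - f x) t))\<^sup>2)"
          by (simp only: u_def norm_mult power_mult_distrib) (simp add: ennreal_mult'[symmetric] mult_ac)
      qed
      also have "\<dots> = ennreal ((Suc k)\<^sup>2) * (\<integral>\<^sup>+t. ennreal ((norm (ift (\<lambda>x. f (x + h k *\<^sub>R b) - f x) t))\<^sup>2) \<partial>lborel)"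
        by (rule nn_integral_cmult) measurable
      also have "\<dots> \<le> ennreal ((Suc k)\<^sup>2) * (\<integral>\<^sup>+x. ennreal ((norm (f (x + h k *\<^sub>R b) - f x))\<^sup>2) \<partial>lborel)"
        using f fh by (intro mult_left_mono nn_integral_ift_le Bochner_Integration.integrable_diff) auto
      also have "\<dots> = (\<integral>\<^sup>+x. ennreal ((Suc k)\<^sup>2) * ennreal ((norm (f (x + h k *\<^sub>R b) - f x))\<^sup>2) \<partial>lborel)"
        by (rule nn_integral_cmult[symmetric]) measurable
      also have "\<dots> \<le> (\<integral>\<^sup>+x. ennreal (W x) \<partial>lborel)"
      proof (rule nn_integral_mono)
        fix x
        have "(norm (f (x + h k *\<^sub>R b) - f x))\<^sup>2 \<le> (h k)\<^sup>2 * W x"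
          by (rule bd) (simp add: h_def)
        then have "(Suc k)\<^sup>2 * (norm (f (x + h k *\<^sub>R b) - f x))\<^sup>2 \<le> W x"
          by (simp add: h_def power_divide field_simps)
        then show "ennreal ((Suc k)\<^sup>2) * ennreal ((norm (f (x + h k *\<^sub>R b) - f x))\<^sup>2) \<le> ennreal (W x)"
          by (subst ennreal_mult'[symmetric]) (auto intro: ennreal_leI)
      qed
      finally show ?thesis .
    qed
  qed auto
qed

lemma schwartz_decay:
  fixes f :: "real ^ 'n \<Rightarrow> complex"
  assumes "schwartz f"
  obtains B where "B \<ge> 0" "\<And>x. norm (partials js f x) \<le> B * (1 + (norm x)\<^sup>2) powr - real N"
proof -
  obtain B0 where B0: "\<And>x. norm x ^ 0 * norm (partials js f x) \<le> B0"
    using assms unfolding schwartz_def by blast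
  obtain B1 where B1: "\<And>x. norm x ^ (2 * N) * norm (partials js f x) \<le> B1"
    using assms unfolding schwartz_def by blast
  have nn: "B0 \<ge> 0" "B1 \<ge> 0"
    using order.trans[OF _ B0[of 0]] order.trans[OF _ B1[of 0]] by (auto simp: zero_le_mult_iff)
  show thesis
  proof
    show "2 ^ N * (B0 + B1) \<ge> 0" using nn by simp
    fix x :: "real ^ 'n"
    define t where "t = (norm x)\<^sup>2"
    have t: "t \<ge> 0" by (simp add: t_def)
    \<comment> \<open>For t \<ge> 0 one has (1 + t)^N \<le> 2^N (1 + t^N), so the two Schwartz
      bounds with powers 0 and 2 N suffice for the weight.\<close>
    have "(1 + t) ^ N \<le> (2 * max 1 t) ^ N"
      using t by (intro power_mono) auto
    also have "\<dots> = 2 ^ N * (max 1 t) ^ N" by (simp add: power_mult_distrib)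
    also have "(max 1 t) ^ N \<le> 1 + t ^ N" using t by (auto simp: max_def)
    finally have "(1 + t) ^ N \<le> 2 ^ N * (1 + t ^ N)" by simp
    then have "(1 + t) ^ N * norm (partials js f x) \<le> 2 ^ N * (1 + t ^ N) * norm (partials js f x)"
      by (rule mult_right_mono) simp
    also have "t ^ N = norm x ^ (2 * N)"
      by (simp add: t_def power_mult)
    also have "2 ^ N * (1 + norm x ^ (2 * N)) * norm (partials js f x) = 2 ^ N * (norm x ^ 0 * norm (partials js f x) + norm x ^ (2 * N) * norm (partials js f x))"
      by (simp add: algebra_simps)
    also have "\<dots> \<le> 2 ^ N * (B0 + B1)"
      by (intro mult_left_mono add_mono B0 B1) auto
    finally have "norm (partials js f x) \<le> 2 ^ N * (B0 + B1) / (1 + t) ^ N"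
      using t by (simp add: field_simps)
    also have "\<dots> = 2 ^ N * (B0 + B1) * (1 + t) powr - real N"
      using t by (simp add: powr_minus powr_realpow divide_inverse)
    finally show "norm (partials js f x) \<le> 2 ^ N * (B0 + B1) * (1 + (norm x)\<^sup>2) powr - real N"
      by (simp add: t_def)
  qed
qed

lemma schwartz_differentiable: "schwartz f \<Longrightarrow> f differentiable (at x)"
  unfolding schwartz_def using partials.simps(1) by metis

lemma schwartz_borel [measurable_dest]:
  fixes f :: "real ^ 'n \<Rightarrow> complex"
  assumes "schwartz f" shows "f \<in> borel_measurable borel"
  using assms by (intro borel_measurable_continuous_onI continuous_at_imp_continuous_on ballI
      differentiable_imp_continuous_within schwartz_differentiable)

lemma schwartz_integrable_weighted:
  fixes f :: "real ^ 'n \<Rightarrow> complex"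
  assumes f: "schwartz f"
  shows "integrable lborel (\<lambda>x. (1 + (norm x)\<^sup>2) * norm (f x))"
    and "integrable lborel (\<lambda>x. (1 + (norm x)\<^sup>2) * (norm (f x))\<^sup>2)"
proof -
  have [measurable]: "f \<in> borel_measurable borel" using f by measurable
  define N where "N = CARD('n)"
  have N: "real N > real DIM(real ^ 'n) / 2" by (simp add: N_def)
  \<comment> \<open>One power of 1 + |x|^2 more than integrability asks for: it pays for the weight
    in the claim, and the exponent \<open>N\<close>, the dimension, still exceeds half the
    dimension.\<close>
  obtain B where B: "B \<ge> 0" "\<And>x. norm (partials [] f x) \<le> B * (1 + (norm x)\<^sup>2) powr - real (Suc N)"
    using schwartz_decay[OF f, of "[]" "Suc N"] by blast
  have I: "integrable lborel (\<lambda>x::real^'n. B * (1 + (norm x)\<^sup>2) powr - real N)"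
    by (intro integrable_mult_right integrable_inverse_polynomial N)
  have le: "(1 + (norm x)\<^sup>2) * norm (f x) \<le> B * (1 + (norm x)\<^sup>2) powr - real N" for x
  proof -
    have pos: "1 + (norm x)\<^sup>2 > 0" by (simp add: add_pos_nonneg)
    have "(1 + (norm x)\<^sup>2) * norm (f x) \<le> (1 + (norm x)\<^sup>2) * (B * (1 + (norm x)\<^sup>2) powr - real (Suc N))"
      using B(2)[of x] pos by (intro mult_left_mono) auto
    also have "\<dots> = B * ((1 + (norm x)\<^sup>2) powr 1 * (1 + (norm x)\<^sup>2) powr - real (Suc N))"
      using pos by simp
    also have "\<dots> = B * (1 + (norm x)\<^sup>2) powr - real N"
      unfolding powr_add[symmetric] by simp
    finally show ?thesis .
  qed
  show 1: "integrable lborel (\<lambda>x. (1 + (norm x)\<^sup>2) * norm (f x))"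
    by (rule Bochner_Integration.integrable_bound[OF I]) (use le B(1) in \<open>auto simp: abs_mult\<close>)
  have le2: "norm (f x) \<le> B" for x
  proof -
    have "(1 + (norm x)\<^sup>2) powr - real (Suc N) \<le> 1"
      using powr_mono[of "- real (Suc N)" 0 "1 + (norm x)\<^sup>2"] by (simp add: add_pos_nonneg less_imp_neq[symmetric])
    then show ?thesis using B(2)[of x] mult_left_le[of _ B] B(1) by fastforce
  qed
  show "integrable lborel (\<lambda>x. (1 + (norm x)\<^sup>2) * (norm (f x))\<^sup>2)"
  proof (rule Bochner_Integration.integrable_bound[OF integrable_mult_right[OF 1, of B]])
    show "AE x in lborel. norm ((1 + (norm x)\<^sup>2) * (norm (f x))\<^sup>2) \<le> norm (B * ((1 + (norm x)\<^sup>2) * norm (f x)))"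
    proof (rule AE_I2)
      fix x
      have "(1 + (norm x)\<^sup>2) * norm (f x) * norm (f x) \<le> (1 + (norm x)\<^sup>2) * norm (f x) * B"
        by (intro mult_left_mono le2) simp
      then show "norm ((1 + (norm x)\<^sup>2) * (norm (f x))\<^sup>2) \<le> norm (B * ((1 + (norm x)\<^sup>2) * norm (f x)))"
        using B(1) by (simp add: abs_mult power2_eq_square mult_ac)
    qed
  qed simp
qed

lemma schwartz_integrable:
  fixes f :: "real ^ 'n \<Rightarrow> complex"
  assumes f: "schwartz f"
  shows "integrable lborel f" and "integrable lborel (\<lambda>x. (norm (f x))\<^sup>2)"
proof -
  have [measurable]: "f \<in> borel_measurable borel" using f by measurable
  show "integrable lborel f"
    by (rule Bochner_Integration.integrable_bound[OF schwartz_integrable_weighted(1)[OF f]])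
      (auto simp: abs_mult algebra_simps)
  show "integrable lborel (\<lambda>x. (norm (f x))\<^sup>2)"
    by (rule Bochner_Integration.integrable_bound[OF schwartz_integrable_weighted(2)[OF f]])
      (auto simp: abs_mult algebra_simps)
qed

text \<open>Mean value inequality along the segment, with one bound \<open>w x\<close> for the
  derivative at all points within distance 1 of x. Uniformity in \<open>h\<close> lets a single
  integrable \<open>W\<close> serve all difference quotients in
  \<open>nn_integral_ift_derivative_bound\<close>.\<close>

lemma schwartz_difference_bound:
  fixes f :: "real ^ 'n \<Rightarrow> complex"
  assumes f: "schwartz f"
  obtains W where "integrable lborel W"
    "\<And>x h. \<bar>h\<bar> \<le> 1 \<Longrightarrow> (norm (f (x + h *\<^sub>R axis i 1) - f x))\<^sup>2 \<le> h\<^sup>2 * W x"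
proof -
  define b where "b = (axis i 1 :: real ^ 'n)"
  have b: "norm b = 1" by (simp add: b_def norm_axis_1)
  define N where "N = CARD('n)"
  have N: "real (2 * N) > real DIM(real ^ 'n) / 2" by (simp add: N_def)
  obtain B where B: "B \<ge> 0" "\<And>x. norm (partials [i] f x) \<le> B * (1 + (norm x)\<^sup>2) powr - real N"
    using schwartz_decay[OF f, of "[i]" N] by blast
  \<comment> \<open>The factor 3^N pays for moving the base point: if y is within distance 1 of x,
    then 1 + |x|^2 \<le> 3 (1 + |y|^2).\<close>
  define w where "w x = B * 3 ^ N * (1 + (norm x)\<^sup>2) powr - real N" for x :: "real ^ 'n"
  have deriv: "norm (frechet_derivative f (at (x + s *\<^sub>R b)) b) \<le> w x" if s: "\<bar>s\<bar> \<le> 1" for x s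
  proof -
    define y where "y = x + s *\<^sub>R b"
    have x: "x = y + (- (s *\<^sub>R b))" by (simp add: y_def)
    have "(norm x)\<^sup>2 \<le> 2 * (norm y)\<^sup>2 + 2 * (norm (- (s *\<^sub>R b)))\<^sup>2"
      using norm_add_square_le[of 1 y "- (s *\<^sub>R b)"] unfolding x[symmetric] by simp
    moreover have "(norm (- (s *\<^sub>R b)))\<^sup>2 \<le> 1" using s by (simp add: b abs_square_le_1)
    moreover have "1 + X \<le> 3 * (1 + Y)" if "X \<le> 2 * Y + 2 * Z" "Z \<le> 1" "0 \<le> Y" for X Y Z :: real
      using that by (simp add: algebra_simps)
    ultimately have "1 + (norm x)\<^sup>2 \<le> 3 * (1 + (norm y)\<^sup>2)"
      using zero_le_power2 by blast
    then have "(3 * (1 + (norm y)\<^sup>2)) powr - real N \<le> (1 + (norm x)\<^sup>2) powr - real N"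
      by (intro powr_mono2') (auto simp: add_pos_nonneg)
    also have "(3 * (1 + (norm y)\<^sup>2)) powr - real N = (1 + (norm y)\<^sup>2) powr - real N / 3 ^ N"
      by (subst powr_mult) (auto simp: powr_minus powr_realpow divide_inverse)
    finally have "(1 + (norm y)\<^sup>2) powr - real N \<le> 3 ^ N * (1 + (norm x)\<^sup>2) powr - real N"
      by (simp add: field_simps)
    then have "B * (1 + (norm y)\<^sup>2) powr - real N \<le> B * (3 ^ N * (1 + (norm x)\<^sup>2) powr - real N)"
      using B(1) by (rule mult_left_mono)
    with B(2)[of y] show ?thesis by (simp add: w_def y_def b_def mult.assoc)
  qed
  have w0: "w x \<ge> 0" for x using B(1) by (simp add: w_def)
  show thesis
  proof
    have "(\<lambda>x. (w x)\<^sup>2) = (\<lambda>x. (B * 3 ^ N)\<^sup>2 * (1 + (norm x)\<^sup>2) powr - real (2 * N))"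
    proof
      fix x :: "real ^ 'n"
      have "((1 + (norm x)\<^sup>2) powr - real N)\<^sup>2 = (1 + (norm x)\<^sup>2) powr - real (2 * N)"
        by (simp add: power2_eq_square powr_add[symmetric])
      then show "(w x)\<^sup>2 = (B * 3 ^ N)\<^sup>2 * (1 + (norm x)\<^sup>2) powr - real (2 * N)"
        by (simp only: w_def power_mult_distrib)
    qed
    then show "integrable lborel (\<lambda>x. (w x)\<^sup>2)"
      using integrable_inverse_polynomial[OF N] by simp
    fix x :: "real ^ 'n" and h :: real
    assume h: "\<bar>h\<bar> \<le> 1"
    have "norm (f (x + h *\<^sub>R b) - f (x + 0 *\<^sub>R b)) \<le> w x * norm (h - 0)"
    proof (rule differentiable_bound[where S = "closed_segment 0 h" and f' = "\<lambda>s u. frechet_derivative f (at (x + s *\<^sub>R b)) (u *\<^sub>R b)" and f = "\<lambda>s. f (x + s *\<^sub>R b)"])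
      fix s assume s: "s \<in> closed_segment 0 h"
      then have s1: "\<bar>s\<bar> \<le> 1" using h by (auto simp: closed_segment_eq_real_ivl split: if_splits)
      have fd: "(f has_derivative frechet_derivative f (at (x + s *\<^sub>R b))) (at (x + s *\<^sub>R b))"
        by (simp add: frechet_derivative_works[symmetric] schwartz_differentiable[OF f])
      have "((\<lambda>s. x + s *\<^sub>R b) has_derivative (\<lambda>u. u *\<^sub>R b)) (at s)"
        by (auto intro!: derivative_eq_intros)
      from has_derivative_compose[OF this fd]
      show "((\<lambda>s. f (x + s *\<^sub>R b)) has_derivative (\<lambda>u. frechet_derivative f (at (x + s *\<^sub>R b)) (u *\<^sub>R b))) (at s within closed_segment 0 h)"
        by (rule has_derivative_at_withinI)
      have lin: "linear (frechet_derivative f (at (x + s *\<^sub>R b)))"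
        using fd has_derivative_linear by blast
      show "onorm (\<lambda>u. frechet_derivative f (at (x + s *\<^sub>R b)) (u *\<^sub>R b)) \<le> w x"
      proof (rule onorm_bound)
        show "norm (frechet_derivative f (at (x + s *\<^sub>R b)) (u *\<^sub>R b)) \<le> w x * norm u" for u
          using deriv[OF s1, of x] by (simp add: linear_scale[OF lin] mult.commute mult_left_mono)
      qed (rule w0)
    qed auto
    then have "(norm (f (x + h *\<^sub>R b) - f x))\<^sup>2 \<le> (w x * \<bar>h\<bar>)\<^sup>2"
      by (intro power_mono) auto
    then show "(norm (f (x + h *\<^sub>R axis i 1) - f x))\<^sup>2 \<le> h\<^sup>2 * (w x)\<^sup>2"
      by (simp add: b_def power_mult_distrib mult.commute)
  qed
qed

lemma powr_le_one_plus_square: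
  fixes r :: real
  assumes "r \<ge> 0" "0 < \<alpha>" "\<alpha> \<le> 2"
  shows "r powr \<alpha> \<le> 1 + r\<^sup>2"
proof (cases "r \<le> 1")
  case True
  then have "r powr \<alpha> \<le> 1" using assms by (intro powr_le1) auto
  then show ?thesis using zero_le_power2[of r] by linarith
next
  case False
  then have "r powr \<alpha> \<le> r powr 2" using assms by (intro powr_mono) auto
  then show ?thesis using False by simp
qed

text \<open>The positive weight is summed over coordinates from the directional bounds. For the
  negative one, Pitt's inequality is applied to \<open>f\<close> itself: it trades the singularity
  at 0 on the transform side for a positive power of \<open>norm x\<close>, which Schwartz decay
  absorbs.\<close>

lemma schwartz_ift_integrable_weighted:
  fixes f :: "real ^ 'n \<Rightarrow> complex"
  assumes f: "schwartz f"
  shows "integrable lborel (\<lambda>t. (norm t)\<^sup>2 * (norm (ift f t))\<^sup>2)"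
    and "0 < \<alpha> \<Longrightarrow> \<alpha> < 1 \<Longrightarrow> integrable lborel (\<lambda>t. norm t powr - \<alpha> * (norm (ift f t))\<^sup>2)"
proof -
  note f1 = schwartz_integrable[OF f]
  have [measurable]: "f \<in> borel_measurable borel" using f by measurable
  have comp: "integrable lborel (\<lambda>t. (t $ i)\<^sup>2 * (norm (ift f t))\<^sup>2)" for i
  proof -
    obtain W where W: "integrable lborel W"
      "\<And>x h. \<bar>h\<bar> \<le> 1 \<Longrightarrow> (norm (f (x + h *\<^sub>R axis i 1) - f x))\<^sup>2 \<le> h\<^sup>2 * W x"
      by (rule schwartz_difference_bound[OF f, where i = i]) blast
    have "(\<integral>\<^sup>+x. ennreal (W x) \<partial>lborel) \<le> (\<integral>\<^sup>+x. ennreal (norm (W x)) \<partial>lborel)"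
      by (intro nn_integral_mono ennreal_leI) simp
    also have "\<dots> < \<infinity>" using W(1) by (simp add: integrable_iff_bounded)
    finally have "(\<integral>\<^sup>+t. ennreal ((2 * pi * (axis i 1 \<bullet> t))\<^sup>2 * (norm (ift f t))\<^sup>2) \<partial>lborel) < \<infinity>"
      using nn_integral_ift_derivative_bound[OF f1(1) W] by (rule order.strict_trans1[rotated])
    then have I: "integrable lborel (\<lambda>t. (2 * pi * (axis i 1 \<bullet> t))\<^sup>2 * (norm (ift f t))\<^sup>2)"
      by (intro integrableI_bounded) auto
    have "(\<lambda>t. (t $ i)\<^sup>2 * (norm (ift f t))\<^sup>2) = (\<lambda>t. (1 / (2 * pi)\<^sup>2) * ((2 * pi * (axis i 1 \<bullet> t))\<^sup>2 * (norm (ift f t))\<^sup>2))"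
      by (auto simp: fun_eq_iff inner_axis' power_mult_distrib)
    then show ?thesis using integrable_mult_right[OF I, of "1 / (2 * pi)\<^sup>2"] by (simp only:)
  qed
  have "(\<lambda>t. (norm t)\<^sup>2 * (norm (ift f t))\<^sup>2) = (\<lambda>t. \<Sum>i\<in>UNIV. (t $ i)\<^sup>2 * (norm (ift f t))\<^sup>2)"
    by (auto simp: fun_eq_iff norm_vec_def L2_set_def sum_nonneg sum_distrib_right)
  then show "integrable lborel (\<lambda>t. (norm t)\<^sup>2 * (norm (ift f t))\<^sup>2)"
    using comp by simp
  assume a: "0 < \<alpha>" "\<alpha> < 1"
  have D: "\<alpha> < real DIM(real ^ 'n)"
  proof -
    have "0 < CARD('n)" by simp
    then have "1 \<le> real CARD('n)" by linarith
    moreover have "DIM(real ^ 'n) = CARD('n)" by simp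
    ultimately show ?thesis using a(2) by linarith
  qed
  have "(\<integral>\<^sup>+x. ennreal (norm x powr \<alpha> * (norm (f x))\<^sup>2) \<partial>lborel) \<le> (\<integral>\<^sup>+x. ennreal (norm ((1 + (norm x)\<^sup>2) * (norm (f x))\<^sup>2)) \<partial>lborel)"
  proof (intro nn_integral_mono ennreal_leI)
    fix x :: "real ^ 'n"
    have "norm x powr \<alpha> \<le> 1 + (norm x)\<^sup>2"
      using a by (intro powr_le_one_plus_square) auto
    then have "norm x powr \<alpha> * (norm (f x))\<^sup>2 \<le> (1 + (norm x)\<^sup>2) * (norm (f x))\<^sup>2"
      by (rule mult_right_mono) simp
    then show "norm x powr \<alpha> * (norm (f x))\<^sup>2 \<le> norm ((1 + (norm x)\<^sup>2) * (norm (f x))\<^sup>2)"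
      by simp
  qed
  also have "\<dots> < \<infinity>" using schwartz_integrable_weighted(2)[OF f] unfolding integrable_iff_bounded by blast
  finally have "(\<integral>\<^sup>+t. ennreal (norm t powr - \<alpha> * (norm (ift f t))\<^sup>2) \<partial>lborel) < \<infinity>"
    using order.strict_trans1[OF pitt_inequality[OF f1(1) a(1) D]] by (simp add: ennreal_mult_less_top)
  then show "integrable lborel (\<lambda>t. norm t powr - \<alpha> * (norm (ift f t))\<^sup>2)"
    by (intro integrableI_bounded) auto
qed

subsection \<open>Shearlet matrices and changes of variables\<close>

text \<open>A change of variables with Jacobian \<open>c\<close>, stated as an equality of measures
  so that the rules for nonnegative integrals, Bochner integrals, integrability and null sets follow
  from one fact.\<close>

definition scales_lborel :: "('a::euclidean_space \<Rightarrow> 'a) \<Rightarrow> real \<Rightarrow> bool" where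
  "scales_lborel L c \<longleftrightarrow> L \<in> borel_measurable borel \<and> c > 0 \<and> lborel = density (distr lborel borel L) (\<lambda>_. ennreal c)"

lemma scales_lborelI:
  fixes L :: "'a::euclidean_space \<Rightarrow> 'a"
  assumes [measurable]: "L \<in> borel_measurable borel" and c: "c > 0"
    and eq: "\<And>F. F \<in> borel_measurable borel \<Longrightarrow> (\<integral>\<^sup>+x. F x \<partial>lborel) = ennreal c * (\<integral>\<^sup>+x. F (L x) \<partial>lborel)"
  shows "scales_lborel L c"
proof -
  have "lborel = density (distr lborel borel L) (\<lambda>_. ennreal c)"
  proof (rule measure_eqI)
    fix A :: "'a set" assume "A \<in> sets lborel"
    then have [measurable]: "A \<in> sets borel" by simp
    have "emeasure (density (distr lborel borel L) (\<lambda>_. ennreal c)) A = ennreal c * (\<integral>\<^sup>+x. indicator A (L x) \<partial>lborel)"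
      by (simp add: emeasure_density nn_integral_cmult nn_integral_distr del: nn_integral_indicator)
    also have "\<dots> = emeasure lborel A"
      using eq[of "indicator A"] by simp
    finally show "emeasure lborel A = emeasure (density (distr lborel borel L) (\<lambda>_. ennreal c)) A" ..
  qed simp
  then show ?thesis using c by (simp add: scales_lborel_def)
qed

lemma scales_lborel_nn_integral:
  assumes L: "scales_lborel L c" and [measurable]: "F \<in> borel_measurable borel"
  shows "(\<integral>\<^sup>+x. F x \<partial>lborel) = ennreal c * (\<integral>\<^sup>+x. F (L x) \<partial>lborel)"
proof -
  have [measurable]: "L \<in> borel_measurable borel" using L by (simp add: scales_lborel_def)
  have "(\<integral>\<^sup>+x. F x \<partial>lborel) = (\<integral>\<^sup>+x. F x \<partial>density (distr lborel borel L) (\<lambda>_. ennreal c))"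
    using L unfolding scales_lborel_def by metis
  also have "\<dots> = ennreal c * (\<integral>\<^sup>+x. F (L x) \<partial>lborel)"
    by (simp add: nn_integral_density nn_integral_cmult nn_integral_distr)
  finally show ?thesis .
qed

lemma scales_lborel_integral:
  fixes F :: "_ \<Rightarrow> 'b::{banach, second_countable_topology}"
  assumes L: "scales_lborel L c" and [measurable]: "F \<in> borel_measurable borel"
  shows "(LINT x|lborel. F x) = c *\<^sub>R (LINT x|lborel. F (L x))"
proof -
  have [measurable]: "L \<in> borel_measurable borel" and c: "c > 0" using L by (auto simp: scales_lborel_def)
  have "(LINT x|lborel. F x) = (LINT x|density (distr lborel borel L) (\<lambda>_. ennreal c). F x)"
    using L unfolding scales_lborel_def by metis
  also have "\<dots> = (LINT x|lborel. c *\<^sub>R F (L x))"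
    using c by (simp add: integral_density integral_distr)
  finally show ?thesis by simp
qed

lemma scales_lborel_integrable:
  fixes F :: "_ \<Rightarrow> 'b::{banach, second_countable_topology}"
  assumes L: "scales_lborel L c" and F: "integrable lborel F"
  shows "integrable lborel (\<lambda>x. F (L x))"
proof (rule integrableI_bounded)
  have [measurable]: "L \<in> borel_measurable borel" "F \<in> borel_measurable borel" and c: "c > 0" using L F by (auto simp: scales_lborel_def)
  show "(\<lambda>x. F (L x)) \<in> borel_measurable lborel" by measurable
  have "(\<integral>\<^sup>+x. ennreal (norm (F x)) \<partial>lborel) < \<infinity>" using F by (simp add: integrable_iff_bounded)
  then have "ennreal c * (\<integral>\<^sup>+x. ennreal (norm (F (L x))) \<partial>lborel) < \<infinity>"
    by (subst (asm) scales_lborel_nn_integral[OF L]) auto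
  then show "(\<integral>\<^sup>+x. ennreal (norm (F (L x))) \<partial>lborel) < \<infinity>"
    using c by (auto simp: ennreal_mult_less_top ennreal_eq_0_iff)
qed

text \<open>Serves because \<open>\<psi>\<close> agrees with its Borel representative only almost
  everywhere and enters the shearlet transform composed with the inverse map.\<close>

lemma scales_lborel_AE:
  assumes L: "scales_lborel L c" and inv: "\<And>x. L (L' x) = x" "\<And>x. L' (L x) = x"
    and [measurable]: "L' \<in> borel_measurable borel" and AE: "AE x in lborel. P x"
  shows "AE x in lborel. P (L' x)"
proof -
  have [measurable]: "L \<in> borel_measurable borel" and c: "c > 0" using L by (auto simp: scales_lborel_def)
  obtain N where N: "N \<in> null_sets lborel" "{x. \<not> P x} \<subseteq> N"
    using AE by (auto simp: eventually_ae_filter)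
  then have [measurable]: "N \<in> sets borel" by auto
  have [measurable]: "L' -` N \<in> sets borel"
    using measurable_sets[of L' borel borel N] by simp
  have "emeasure lborel (L' -` N) = (\<integral>\<^sup>+x. indicator (L' -` N) x \<partial>lborel)"
    by (rule nn_integral_indicator[symmetric]) simp
  also have "\<dots> = ennreal c * (\<integral>\<^sup>+x. indicator (L' -` N) (L x) \<partial>lborel)"
    by (rule scales_lborel_nn_integral[OF L]) measurable
  also have "(\<lambda>x. indicator (L' -` N) (L x) :: ennreal) = indicator N"
    by (simp add: fun_eq_iff indicator_def inv)
  also have "ennreal c * (\<integral>\<^sup>+x. indicator N x \<partial>lborel) = 0"
    using N(1) by (simp add: null_sets_def)
  finally have "L' -` N \<in> null_sets lborel" by (auto simp: null_sets_def)
  moreover have "{x. \<not> P (L' x)} \<subseteq> L' -` N" using N(2) by auto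
  ultimately show ?thesis by (auto simp: eventually_ae_filter)
qed

lemma scales_lborel_translate:
  assumes L: "scales_lborel L c" shows "scales_lborel (\<lambda>x. L x + t) c"
proof -
  have [measurable]: "L \<in> borel_measurable borel" and c: "c > 0" using L by (auto simp: scales_lborel_def)
  show ?thesis
  proof (rule scales_lborelI)
    fix F :: "'a \<Rightarrow> ennreal" assume [measurable]: "F \<in> borel_measurable borel"
    have "(\<integral>\<^sup>+x. F x \<partial>lborel) = (\<integral>\<^sup>+x. F x \<partial>distr lborel borel ((+) t))"
      by (simp add: lborel_distr_plus)
    also have "\<dots> = (\<integral>\<^sup>+x. F (x + t) \<partial>lborel)"
      by (subst nn_integral_distr) (auto simp: add.commute)
    also have "\<dots> = ennreal c * (\<integral>\<^sup>+x. F (L x + t) \<partial>lborel)"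
      by (rule scales_lborel_nn_integral[OF L]) measurable
    finally show "(\<integral>\<^sup>+x. F x \<partial>lborel) = ennreal c * (\<integral>\<^sup>+x. F (L x + t) \<partial>lborel)" .
  qed (use c in auto)
qed

lemma nn_integral_lborel_affine:
  fixes t :: "'a::euclidean_space"
  assumes c: "c \<noteq> 0" and [measurable]: "F \<in> borel_measurable borel"
  shows "(\<integral>\<^sup>+x. F x \<partial>lborel) = ennreal (\<bar>c\<bar> ^ DIM('a)) * (\<integral>\<^sup>+x. F (t + c *\<^sub>R x) \<partial>lborel)"
proof -
  have "(\<integral>\<^sup>+x. F x \<partial>lborel) = (\<integral>\<^sup>+x. F x \<partial>density (distr lborel borel (\<lambda>x. t + c *\<^sub>R x)) (\<lambda>_. ennreal (\<bar>c\<bar> ^ DIM('a))))"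
    using lborel_affine[OF c, of t] by simp
  also have "\<dots> = ennreal (\<bar>c\<bar> ^ DIM('a)) * (\<integral>\<^sup>+x. F (t + c *\<^sub>R x) \<partial>lborel)"
    by (simp add: nn_integral_density nn_integral_cmult nn_integral_distr)
  finally show ?thesis .
qed

section \<open>Splitting off the first coordinate\<close>

lemma borel_measurable_vecI:
  fixes f :: "'a \<Rightarrow> real ^ 'n"
  assumes "\<And>i. (\<lambda>x. f x $ i) \<in> borel_measurable M"
  shows "f \<in> borel_measurable M"
  unfolding borel_measurable_euclidean_space[where 'c = "real ^ 'n"]
  using assms by (auto simp: Basis_vec_def inner_axis)

lemma borel_measurable_vec_nth [measurable (raw)]:
  fixes f :: "'a \<Rightarrow> real ^ 'n"
  assumes [measurable]: "f \<in> borel_measurable M"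
  shows "(\<lambda>x. f x $ i) \<in> borel_measurable M"
proof -
  have "(\<lambda>x. f x \<bullet> axis i 1) \<in> borel_measurable M" by measurable
  then show ?thesis by (simp add: inner_axis)
qed

lemma sum_UNIV_option: "(\<Sum>i\<in>UNIV. f i) = f None + (\<Sum>k\<in>UNIV. f (Some k))" for f :: "'m::finite option \<Rightarrow> 'b::comm_monoid_add"
  unfolding UNIV_option_conv by (subst sum.insert) (auto simp: sum.reindex)

lemma prod_UNIV_option: "(\<Prod>i\<in>UNIV. f i) = f None * (\<Prod>k\<in>UNIV. f (Some k))" for f :: "'m::finite option \<Rightarrow> 'b::comm_monoid_mult"
  unfolding UNIV_option_conv by (subst prod.insert) (auto simp: prod.reindex)

definition pack :: "real \<Rightarrow> real ^ 'm \<Rightarrow> (real, 'm::finite option) vec" where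
  "pack u v = (\<chi> i. case i of None \<Rightarrow> u | Some k \<Rightarrow> v $ k)"

definition rest :: "(real, 'm::finite option) vec \<Rightarrow> real ^ 'm" where
  "rest x = (\<chi> k. x $ Some k)"

lemma pack_nth [simp]: "pack u v $ None = u" "pack u v $ Some k = v $ k"
  by (simp_all add: pack_def)

lemma rest_nth [simp]: "rest x $ k = x $ Some k"
  by (simp add: rest_def)

lemma rest_pack [simp]: "rest (pack u v) = v"
  by (simp add: vec_eq_iff)

lemma vec_option_eq_iff: "x = y \<longleftrightarrow> x $ None = y $ None \<and> (\<forall>k. x $ Some k = y $ Some k)"
  for x y :: "('b, 'm::finite option) vec"
  by (simp add: vec_eq_iff split_option_all)

lemma pack_rest [simp]: "pack (x $ None) (rest x) = x"
  by (simp add: vec_option_eq_iff)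

lemma borel_measurable_pack [measurable (raw)]:
  assumes [measurable]: "f \<in> borel_measurable M" "g \<in> borel_measurable M"
  shows "(\<lambda>x. pack (f x) (g x)) \<in> borel_measurable M"
proof (rule borel_measurable_vecI)
  show "(\<lambda>x. pack (f x) (g x) $ i) \<in> borel_measurable M" for i
    by (cases i) simp_all
qed

lemma borel_measurable_rest [measurable (raw)]:
  assumes [measurable]: "f \<in> borel_measurable M"
  shows "(\<lambda>x. rest (f x)) \<in> borel_measurable M"
  by (rule borel_measurable_vecI) simp

text \<open>The two measures are compared on boxes, where the volume is the edge along
  \<open>None\<close> times the product of the edges along \<open>Some k\<close>.\<close>

lemma lborel_eq_distr_pack:
  "lborel = distr (lborel \<Otimes>\<^sub>M lborel) borel (\<lambda>(u, v). pack u (v :: real ^ 'm::finite))"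
proof (rule lborel_eqI)
  have prod_Basis: "(\<Prod>b\<in>Basis. h \<bullet> b) = (\<Prod>i\<in>UNIV. h $ i)" for h :: "real ^ 'k"
  proof -
    have B: "(Basis :: (real ^ 'k) set) = range (\<lambda>i. axis i 1)" by (auto simp: Basis_vec_def)
    have inj: "inj (\<lambda>i. axis i (1::real) :: real ^ 'k)" by (auto simp: inj_def axis_eq_axis)
    show ?thesis unfolding B prod.reindex[OF inj] by (simp add: inner_axis)
  qed
  fix l u :: "(real, 'm option) vec" assume le: "\<And>b. b \<in> Basis \<Longrightarrow> l \<bullet> b \<le> u \<bullet> b"
  have le': "l $ i \<le> u $ i" for i
  proof -
    have "axis i 1 \<in> (Basis :: (real, 'm option) vec set)" by (auto simp: Basis_vec_def)
    from le[OF this] show ?thesis by (simp add: inner_axis)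
  qed
  have [measurable]: "(\<lambda>(a, v). pack a (v :: real ^ 'm)) \<in> borel_measurable (lborel \<Otimes>\<^sub>M lborel)"
    by measurable
  have vim: "(\<lambda>(a, v). pack a (v :: real ^ 'm)) -` box l u = box (l $ None) (u $ None) \<times> box (rest l) (rest u)"
    by (auto simp: mem_box Basis_vec_def inner_axis split_option_all)
  have "emeasure (distr (lborel \<Otimes>\<^sub>M lborel) borel (\<lambda>(a, v). pack a (v :: real ^ 'm))) (box l u)
    = emeasure (lborel \<Otimes>\<^sub>M lborel) (box (l $ None) (u $ None) \<times> box (rest l) (rest u))"
    by (subst emeasure_distr) (auto simp: vim space_pair_measure)
  also have "\<dots> = emeasure lborel (box (l $ None) (u $ None)) * emeasure lborel (box (rest l) (rest u))"
    by (rule lborel.emeasure_pair_measure_Times) auto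
  also have "emeasure lborel (box (l $ None) (u $ None)) = ennreal (u $ None - l $ None)"
    using le'[of None] by (simp add: emeasure_lborel_box_eq)
  also have "emeasure lborel (box (rest l) (rest u)) = ennreal (\<Prod>b\<in>Basis. (rest u - rest l) \<bullet> b)"
    using le' by (subst emeasure_lborel_box_eq) (auto simp: Basis_vec_def inner_axis)
  also have "(\<Prod>b\<in>Basis. (rest u - rest l) \<bullet> b) = (\<Prod>k\<in>UNIV. u $ Some k - l $ Some k)"
    by (simp add: prod_Basis)
  also have "ennreal (u $ None - l $ None) * ennreal (\<Prod>k\<in>UNIV. u $ Some k - l $ Some k) = ennreal (\<Prod>i\<in>UNIV. u $ i - l $ i)"
    using le'[of None] by (subst ennreal_mult'[symmetric]) (auto simp: prod_UNIV_option)
  also have "(\<Prod>i\<in>UNIV. u $ i - l $ i) = (\<Prod>b\<in>Basis. (u - l) \<bullet> b)"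
    by (simp add: prod_Basis)
  finally show "emeasure (distr (lborel \<Otimes>\<^sub>M lborel) borel (\<lambda>(u, v). pack u (v :: real ^ 'm))) (box l u) = ennreal (\<Prod>b\<in>Basis. (u - l) \<bullet> b)" .
qed simp

lemma nn_integral_pack:
  fixes F :: "(real, 'm::finite option) vec \<Rightarrow> ennreal"
  assumes [measurable]: "F \<in> borel_measurable borel"
  shows "(\<integral>\<^sup>+x. F x \<partial>lborel) = (\<integral>\<^sup>+u. (\<integral>\<^sup>+v. F (pack u v) \<partial>lborel) \<partial>lborel)"
    and "(\<integral>\<^sup>+x. F x \<partial>lborel) = (\<integral>\<^sup>+v. (\<integral>\<^sup>+u. F (pack u v) \<partial>lborel) \<partial>lborel)"
proof -
  have "(\<integral>\<^sup>+x. F x \<partial>lborel) = (\<integral>\<^sup>+x. F x \<partial>distr (lborel \<Otimes>\<^sub>M lborel) borel (\<lambda>(u, v). pack u (v :: real ^ 'm)))"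
    by (simp only: lborel_eq_distr_pack[symmetric])
  also have "\<dots> = (\<integral>\<^sup>+p. F (case p of (u, v) \<Rightarrow> pack u v) \<partial>(lborel \<Otimes>\<^sub>M lborel))"
    by (rule nn_integral_distr) measurable
  also have "\<dots> = (\<integral>\<^sup>+u. (\<integral>\<^sup>+v. F (pack u v) \<partial>lborel) \<partial>lborel)"
    by (subst lborel.nn_integral_fst[symmetric]) auto
  finally show 1: "(\<integral>\<^sup>+x. F x \<partial>lborel) = (\<integral>\<^sup>+u. (\<integral>\<^sup>+v. F (pack u v) \<partial>lborel) \<partial>lborel)" .
  show "(\<integral>\<^sup>+x. F x \<partial>lborel) = (\<integral>\<^sup>+v. (\<integral>\<^sup>+u. F (pack u v) \<partial>lborel) \<partial>lborel)"
    unfolding 1 by (rule lborel_pair.Fubini'[symmetric]) measurable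
qed

section \<open>Action and determinant of the shearlet matrices\<close>

definition dil_root :: "nat \<Rightarrow> real \<Rightarrow> real" where
  "dil_root n a = sgn a * \<bar>a\<bar> powr (1 / real n)"

lemma dil_root_nonzero [simp]: "a \<noteq> 0 \<Longrightarrow> dil_root n a \<noteq> 0"
  by (simp add: dil_root_def sgn_if)

lemma abs_dil_root: "a \<noteq> 0 \<Longrightarrow> \<bar>dil_root n a\<bar> = \<bar>a\<bar> powr (1 / real n)"
  by (simp add: dil_root_def abs_mult abs_sgn_eq)

lemma borel_measurable_dil_root [measurable]: "dil_root n \<in> borel_measurable borel"
  unfolding dil_root_def[abs_def] by measurable

lemma if_neq_swap: "(if x \<noteq> y then p else q) = (if x = y then q else p)"
  by simp

lemma shearlet_matrix_mult:
  fixes x :: "(real, 'm::finite option) vec"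
  shows "shearlet_matrix s a *v x =
    pack (a * x $ None + dil_root CARD('m option) a * (s \<bullet> rest x)) (dil_root CARD('m option) a *\<^sub>R rest x)"
proof -
  have d: "dil_matrix a *v x = pack (a * x $ None) (dil_root CARD('m option) a *\<^sub>R rest x)"
    by (simp add: vec_option_eq_iff matrix_vector_mult_def dil_matrix_def sum_UNIV_option if_distrib[where f = "\<lambda>y. y * _"] if_neq_swap cong: if_cong)
      (simp add: dil_root_def)
  have s: "shear_matrix s *v y = pack (y $ None + s \<bullet> rest y) (rest y)" for y :: "(real, 'm option) vec"
    by (simp add: vec_option_eq_iff matrix_vector_mult_def shear_matrix_def sum_UNIV_option if_distrib[where f = "\<lambda>y. y * _"] inner_vec_def cong: if_cong)
  show ?thesis
    unfolding shearlet_matrix_def matrix_vector_mul_assoc[symmetric] d s by simp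
qed

lemma transpose_shearlet_matrix_mult:
  fixes x :: "(real, 'm::finite option) vec"
  shows "transpose (shearlet_matrix s a) *v x =
    pack (a * x $ None) (dil_root CARD('m option) a *\<^sub>R (rest x + x $ None *\<^sub>R s))"
proof -
  have d: "transpose (dil_matrix a) *v y = pack (a * y $ None) (dil_root CARD('m option) a *\<^sub>R rest y)" for y :: "(real, 'm option) vec"
    by (simp add: vec_option_eq_iff matrix_vector_mult_def transpose_def dil_matrix_def sum_UNIV_option if_distrib[where f = "\<lambda>y. y * _"] if_neq_swap cong: if_cong)
      (simp add: dil_root_def)
  have s: "transpose (shear_matrix s) *v x = pack (x $ None) (rest x + x $ None *\<^sub>R s)"
    by (simp add: vec_option_eq_iff matrix_vector_mult_def transpose_def shear_matrix_def sum_UNIV_option if_distrib[where f = "\<lambda>y. y * _"] cong: if_cong)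
  show ?thesis
    unfolding shearlet_matrix_def matrix_transpose_mul matrix_vector_mul_assoc[symmetric] s d by simp
qed

text \<open>The shear matrix arises from the identity by adding to its first row a combination of
  the other rows, which leaves the determinant unchanged.\<close>

lemma det_shear_matrix: "det (shear_matrix (s :: real ^ 'm::finite)) = 1"
proof -
  let ?A = "mat 1 :: ((real, 'm option) vec, 'm option) vec"
  let ?x = "pack 0 s"
  have "?x = (\<Sum>k\<in>UNIV. s $ k *s row (Some k) ?A)"
    by (simp add: vec_option_eq_iff sum_component row_def mat_def if_distrib[where f = "\<lambda>y. _ * y"] cong: if_cong)
  also have "\<dots> \<in> vec.span {row j ?A |j. j \<noteq> None}"
    by (intro vec.span_sum vec.span_scale vec.span_base) auto
  finally have "det (\<chi> k. if k = None then row None ?A + ?x else row k ?A) = det ?A"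
    by (rule det_row_span)
  also have "(\<chi> k. if k = None then row None ?A + ?x else row k ?A) = shear_matrix s"
    by (simp add: vec_option_eq_iff row_def mat_def shear_matrix_def)
  finally show ?thesis by simp
qed

lemma det_shearlet_matrix:
  "det (shearlet_matrix (s :: real ^ 'm::finite) a) = a * dil_root CARD('m option) a ^ CARD('m)"
proof -
  have "det (dil_matrix a :: ((real, 'm option) vec, 'm option) vec) = a * dil_root CARD('m option) a ^ CARD('m)"
    by (subst det_diagonal) (auto simp: dil_matrix_def prod_UNIV_option dil_root_def)
  then show ?thesis by (simp add: shearlet_matrix_def det_mul det_shear_matrix)
qed

lemma abs_det_shearlet_matrix:
  fixes s :: "real ^ 'm::finite"
  assumes a: "a \<noteq> 0"
  shows "\<bar>det (shearlet_matrix s a)\<bar> = \<bar>a\<bar> powr (2 - 1 / real CARD('m option))"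
proof -
  have n: "real CARD('m option) = real CARD('m) + 1" by simp
  note d = abs_dil_root[OF a, of "CARD('m option)"]
  have "\<bar>det (shearlet_matrix s a)\<bar> = \<bar>a\<bar> powr 1 * (\<bar>a\<bar> powr (1 / real CARD('m option))) ^ CARD('m)"
    by (simp only: det_shearlet_matrix abs_mult power_abs d powr_one abs_ge_zero)
  also have "\<dots> = \<bar>a\<bar> powr (1 + real CARD('m) * (1 / real CARD('m option)))"
    using a by (simp add: powr_add powr_realpow[symmetric] powr_powr mult.commute)
  also have "1 + real CARD('m) * (1 / real CARD('m option)) = 2 - 1 / real CARD('m option)"
    unfolding n by (simp add: field_simps)
  finally show ?thesis .
qed

lemma matrix_inv_vector_mul:
  fixes A :: "real ^ 'n ^ 'n"
  assumes "det A \<noteq> 0"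
  shows "A *v (matrix_inv A *v x) = x" "matrix_inv A *v (A *v x) = x"
proof -
  have "invertible A" using assms by (simp add: invertible_det_nz)
  then have "A ** matrix_inv A = mat 1 \<and> matrix_inv A ** A = mat 1"
    unfolding invertible_def matrix_inv_def by (rule someI_ex)
  then show "A *v (matrix_inv A *v x) = x" "matrix_inv A *v (A *v x) = x"
    by (simp_all add: matrix_vector_mul_assoc)
qed

lemma borel_measurable_matrix_vector_mult [measurable]: "(\<lambda>x. A *v x) \<in> borel_measurable borel" for A :: "real ^ 'n ^ 'k"
  by (rule borel_measurable_continuous_onI) (rule matrix_vector_mult_linear_continuous_on)

text \<open>Each matrix is block triangular in the splitting by \<open>pack\<close>, so the
  substitution is affine in one block with the other frozen. The two call for opposite orders of
  integration: the matrix shifts the first coordinate by a function of the others, its transpose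
  shifts the others by a multiple of the first.\<close>

lemma scales_lborel_shearlet_matrix:
  fixes s :: "real ^ 'm::finite"
  assumes a: "a \<noteq> 0"
  shows "scales_lborel (\<lambda>x. shearlet_matrix s a *v x) \<bar>det (shearlet_matrix s a)\<bar>"
    and "scales_lborel (\<lambda>x. transpose (shearlet_matrix s a) *v x) \<bar>det (shearlet_matrix s a)\<bar>"
proof -
  define b where "b = dil_root CARD('m option) a"
  have b: "b \<noteq> 0" using a by (simp add: b_def)
  define c where "c = \<bar>det (shearlet_matrix s a)\<bar>"
  have c: "c = \<bar>a\<bar> * \<bar>b\<bar> ^ CARD('m)" by (simp add: c_def det_shearlet_matrix b_def abs_mult power_abs)
  have c0: "c > 0" using a b by (simp add: c)
  have cc: "ennreal c * X = ennreal \<bar>a\<bar> * (ennreal (\<bar>b\<bar> ^ CARD('m)) * X)"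
    "ennreal c * X = ennreal (\<bar>b\<bar> ^ CARD('m)) * (ennreal \<bar>a\<bar> * X)" for X
    unfolding c by (simp_all add: ennreal_mult' mult_ac)
  show "scales_lborel (\<lambda>x. shearlet_matrix s a *v x) \<bar>det (shearlet_matrix s a)\<bar>"
    unfolding c_def[symmetric]
  proof (rule scales_lborelI[OF _ c0])
    fix F :: "(real, 'm option) vec \<Rightarrow> ennreal" assume [measurable]: "F \<in> borel_measurable borel"
    have "(\<integral>\<^sup>+x. F x \<partial>lborel) = (\<integral>\<^sup>+v. (\<integral>\<^sup>+u. F (pack u v) \<partial>lborel) \<partial>lborel)"
      by (rule nn_integral_pack) measurable
    also have "\<dots> = ennreal (\<bar>b\<bar> ^ DIM(real ^ 'm)) * (\<integral>\<^sup>+v. (\<integral>\<^sup>+u. F (pack u (0 + b *\<^sub>R v)) \<partial>lborel) \<partial>lborel)"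
      by (rule nn_integral_lborel_affine[OF b]) measurable
    also have "(\<integral>\<^sup>+v. (\<integral>\<^sup>+u. F (pack u (0 + b *\<^sub>R v)) \<partial>lborel) \<partial>lborel) = (\<integral>\<^sup>+v. ennreal \<bar>a\<bar> * (\<integral>\<^sup>+u. F (pack (b * (s \<bullet> v) + a * u) (0 + b *\<^sub>R v)) \<partial>lborel) \<partial>lborel)"
      by (intro nn_integral_cong nn_integral_real_affine a) measurable
    also have "\<dots> = ennreal \<bar>a\<bar> * (\<integral>\<^sup>+v. (\<integral>\<^sup>+u. F (pack (b * (s \<bullet> v) + a * u) (0 + b *\<^sub>R v)) \<partial>lborel) \<partial>lborel)"
      by (rule nn_integral_cmult) measurable
    also have "(\<integral>\<^sup>+v. (\<integral>\<^sup>+u. F (pack (b * (s \<bullet> v) + a * u) (0 + b *\<^sub>R v)) \<partial>lborel) \<partial>lborel) = (\<integral>\<^sup>+x. F (shearlet_matrix s a *v x) \<partial>lborel)"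
      by (subst nn_integral_pack(2)) (auto simp: shearlet_matrix_mult b_def add.commute)
    finally show "(\<integral>\<^sup>+x. F x \<partial>lborel) = ennreal c * (\<integral>\<^sup>+x. F (shearlet_matrix s a *v x) \<partial>lborel)"
      by (simp add: cc(2))
  qed measurable
  show "scales_lborel (\<lambda>x. transpose (shearlet_matrix s a) *v x) \<bar>det (shearlet_matrix s a)\<bar>"
    unfolding c_def[symmetric]
  proof (rule scales_lborelI[OF _ c0])
    fix F :: "(real, 'm option) vec \<Rightarrow> ennreal" assume [measurable]: "F \<in> borel_measurable borel"
    have "(\<integral>\<^sup>+x. F x \<partial>lborel) = (\<integral>\<^sup>+u. (\<integral>\<^sup>+v. F (pack u v) \<partial>lborel) \<partial>lborel)"
      by (rule nn_integral_pack) measurable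
    also have "\<dots> = ennreal \<bar>a\<bar> * (\<integral>\<^sup>+u. (\<integral>\<^sup>+v. F (pack (0 + a * u) v) \<partial>lborel) \<partial>lborel)"
      by (intro nn_integral_real_affine a) measurable
    also have "(\<integral>\<^sup>+u. (\<integral>\<^sup>+v. F (pack (0 + a * u) v) \<partial>lborel) \<partial>lborel) = (\<integral>\<^sup>+u. ennreal (\<bar>b\<bar> ^ DIM(real ^ 'm)) * (\<integral>\<^sup>+v. F (pack (0 + a * u) (b *\<^sub>R u *\<^sub>R s + b *\<^sub>R v)) \<partial>lborel) \<partial>lborel)"
      by (intro nn_integral_cong nn_integral_lborel_affine[OF b]) measurable
    also have "\<dots> = ennreal (\<bar>b\<bar> ^ DIM(real ^ 'm)) * (\<integral>\<^sup>+u. (\<integral>\<^sup>+v. F (pack (0 + a * u) (b *\<^sub>R u *\<^sub>R s + b *\<^sub>R v)) \<partial>lborel) \<partial>lborel)"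
      by (rule nn_integral_cmult) measurable
    also have "(\<integral>\<^sup>+u. (\<integral>\<^sup>+v. F (pack (0 + a * u) (b *\<^sub>R u *\<^sub>R s + b *\<^sub>R v)) \<partial>lborel) \<partial>lborel) = (\<integral>\<^sup>+x. F (transpose (shearlet_matrix s a) *v x) \<partial>lborel)"
      unfolding transpose_shearlet_matrix_mult b_def[symmetric]
      by (subst nn_integral_pack(1)) (auto simp: scaleR_add_right add.commute)
    finally show "(\<integral>\<^sup>+x. F x \<partial>lborel) = ennreal c * (\<integral>\<^sup>+x. F (transpose (shearlet_matrix s a) *v x) \<partial>lborel)"
      by (simp add: cc(1))
  qed measurable
qed

subsection \<open>The shearlet transform on the Fourier side\<close>

lemma integral_lebesgue_cong_borel:
  fixes f f' :: "'a::euclidean_space \<Rightarrow> complex"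
  assumes f': "f' \<in> borel_measurable borel" and AE: "AE x in lborel. f x = f' x"
  shows "(LINT x|lebesgue. f x) = (LINT x|lborel. f' x)"
proof -
  have m': "f' \<in> borel_measurable lebesgue" using f' by (simp add: measurable_completion)
  have AE': "AE x in lebesgue. f' x = f x"
    using AE by (auto simp: AE_completion_iff elim: eventually_mono)
  have m: "f \<in> borel_measurable lebesgue"
    by (rule borel_measurable_AE[OF m' AE'])
  have "(LINT x|lebesgue. f x) = (LINT x|lebesgue. f' x)"
    by (rule integral_cong_AE[OF m m']) (use AE in \<open>simp add: AE_completion_iff\<close>)
  also have "\<dots> = (LINT x|lborel. f' x)"
    by (rule integral_completion) (use f' in simp)
  finally show ?thesis .
qed

text \<open>The transposed shearlet matrix applied to \<xi>, spelled out in coordinates so that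
  joint measurability in \<open>a\<close>, \<open>s\<close> and \<open>\<xi>\<close> is evident, as
  Tonelli over the group demands.\<close>

definition dual_arg :: "real \<Rightarrow> real ^ 'm \<Rightarrow> (real, 'm::finite option) vec \<Rightarrow> (real, 'm option) vec" where
  "dual_arg a s \<xi> = pack (a * \<xi> $ None) (dil_root CARD('m option) a *\<^sub>R (rest \<xi> + \<xi> $ None *\<^sub>R s))"

lemma dual_arg_eq: "dual_arg a s \<xi> = transpose (shearlet_matrix s a) *v \<xi>"
  unfolding dual_arg_def by (rule transpose_shearlet_matrix_mult[symmetric])

lemma borel_measurable_dual_arg [measurable (raw)]:
  assumes [measurable]: "f \<in> borel_measurable M" "g \<in> borel_measurable M" "h \<in> borel_measurable M"
  shows "(\<lambda>x. dual_arg (f x) (g x) (h x)) \<in> borel_measurable M"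
  unfolding dual_arg_def by measurable

text \<open>The Fourier transform in \<open>t\<close> of the shearlet transform of \<open>f\<close>, when \<open>g\<close> is that of \<open>\<psi>\<close>;
  the factor is the square root of the determinant.\<close>

definition shearlet_spectrum ::
    "((real, 'm::finite option) vec \<Rightarrow> complex) \<Rightarrow> ((real, 'm option) vec \<Rightarrow> complex) \<Rightarrow>
     real \<Rightarrow> real ^ 'm \<Rightarrow> (real, 'm option) vec \<Rightarrow> complex" where
  "shearlet_spectrum f g a s \<xi> =
     of_real ((\<bar>a\<bar> powr (2 - 1 / real CARD('m option))) powr (1 / 2)) * (fourier f \<xi> * cnj (g (dual_arg a s \<xi>)))"

lemma borel_measurable_fourier:
  fixes f :: "'a::euclidean_space \<Rightarrow> complex"
  assumes [measurable]: "f \<in> borel_measurable borel"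
  shows "fourier f \<in> borel_measurable borel"
proof -
  have "fourier f = (\<lambda>\<xi>. ift f (- \<xi>))" by (rule ext, rule fourier_eq_ift) simp
  then show ?thesis by simp
qed

text \<open>The substitution x = M y + t: the inner product of x with \<xi> splits into that of y
  with the transpose of M applied to \<xi>, which is \<open>dual_arg a s \<xi>\<close>, and the
  phase coming from t.\<close>

lemma fourier_shear:
  fixes f :: "(real, 'm::finite option) vec \<Rightarrow> complex"
  assumes [measurable]: "f \<in> borel_measurable borel" and a: "a \<noteq> 0"
  shows "\<bar>det (shearlet_matrix s a)\<bar> *\<^sub>R fourier (\<lambda>y. f (shearlet_matrix s a *v y + t)) (dual_arg a s \<xi>)
    = cis (2 * pi * (\<xi> \<bullet> t)) * fourier f \<xi>"
proof -
  let ?M = "shearlet_matrix s a"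
  let ?L = "\<lambda>y. ?M *v y + t"
  have L: "scales_lborel ?L \<bar>det ?M\<bar>"
    by (intro scales_lborel_translate scales_lborel_shearlet_matrix a)
  have "fourier f \<xi> = (LINT x|lborel. f x * cis (2 * pi * (x \<bullet> - \<xi>)))"
    by (subst fourier_eq_ift) (auto simp: ift_def)
  also have "\<dots> = \<bar>det ?M\<bar> *\<^sub>R (LINT y|lborel. f (?L y) * cis (2 * pi * (?L y \<bullet> - \<xi>)))"
    by (rule scales_lborel_integral[OF L]) measurable
  also have "(LINT y|lborel. f (?L y) * cis (2 * pi * (?L y \<bullet> - \<xi>)))
    = (LINT y|lborel. cis (- (2 * pi * (\<xi> \<bullet> t))) * (f (?L y) * cis (2 * pi * (y \<bullet> - dual_arg a s \<xi>))))"
  proof (intro Bochner_Integration.integral_cong refl)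
    fix y
    have "(?M *v y) \<bullet> \<xi> = y \<bullet> dual_arg a s \<xi>"
      unfolding dual_arg_eq by (metis dot_lmul_matrix inner_commute transpose_matrix_vector)
    then have "2 * pi * (?L y \<bullet> - \<xi>) = - (2 * pi * (\<xi> \<bullet> t)) + 2 * pi * (y \<bullet> - dual_arg a s \<xi>)"
      by (simp add: inner_add_left inner_commute[of t] algebra_simps)
    then show "f (?L y) * cis (2 * pi * (?L y \<bullet> - \<xi>)) = cis (- (2 * pi * (\<xi> \<bullet> t))) * (f (?L y) * cis (2 * pi * (y \<bullet> - dual_arg a s \<xi>)))"
      by (simp only: cis_mult[symmetric] mult_ac)
  qed
  also have "\<dots> = cis (- (2 * pi * (\<xi> \<bullet> t))) * fourier (\<lambda>y. f (?L y)) (dual_arg a s \<xi>)"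
    unfolding integral_mult_right_zero by (subst fourier_eq_ift) (auto simp: ift_def)
  finally show ?thesis
    by (simp add: scaleR_conv_of_real mult.left_commute[of "cis _"] mult.assoc[symmetric] cis_mult)
qed

text \<open>The substitution x = M y + t moves matrix and translation from \<open>\<psi>\<close> to
  \<open>f\<close>. Parseval can then be used with \<open>\<psi>\<close> as it stands, whose L2
  transform \<open>g\<close> is given, while the transform of the dilated \<open>f\<close> is
  computed by \<open>fourier_shear\<close>. A second substitution on the frequency side restores the
  variable \<xi>.\<close>

lemma shearlet_transform_eq_ift:
  fixes f \<psi> :: "(real, 'm::finite option) vec \<Rightarrow> complex"
  assumes f: "integrable lborel f" "integrable lborel (\<lambda>x. (norm (f x))\<^sup>2)"
    and \<psi>: "square_integrable \<psi>" and g: "is_fourier_L2 \<psi> g" and a: "a \<noteq> 0"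
  shows "shearlet_transform \<psi> f a s t = ift (shearlet_spectrum f g a s) t"
proof -
  have [measurable]: "f \<in> borel_measurable borel" using f by auto
  have [measurable]: "g \<in> borel_measurable borel" using g by (simp add: is_fourier_L2_def)
  have \<psi>m: "\<psi> \<in> borel_measurable lebesgue" using \<psi> by (simp add: square_integrable_def)
  obtain \<psi>' where \<psi>'[measurable]: "\<psi>' \<in> borel_measurable borel" and AE: "AE x in lborel. \<psi> x = \<psi>' x"
    by (rule borel_representative_complex[OF \<psi>m])
  define M where "M = shearlet_matrix s a"
  define D where "D = \<bar>det M\<bar>"
  have D: "D = \<bar>a\<bar> powr (2 - 1 / real CARD('m option))"
    unfolding D_def M_def by (rule abs_det_shearlet_matrix[OF a])
  have D0: "D > 0" using a by (simp add: D)
  define c where "c = D powr (- (1/2))"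
  define L where "L y = M *v y + t" for y
  define L' where "L' x = matrix_inv M *v (x - t)" for x
  have Lm[measurable]: "L \<in> borel_measurable borel" unfolding L_def[abs_def] by measurable
  have L'm[measurable]: "L' \<in> borel_measurable borel" unfolding L'_def[abs_def] by measurable
  have detM: "det M \<noteq> 0" using D0 by (auto simp: D_def)
  have inv: "L (L' x) = x" "L' (L x) = x" for x
    by (simp_all add: L_def L'_def matrix_inv_vector_mul[OF detM])
  have L: "scales_lborel L D"
    unfolding L_def[abs_def] D_def M_def by (intro scales_lborel_translate scales_lborel_shearlet_matrix a)
  define f1 where "f1 y = f (L y)" for y
  have f1: "integrable lborel f1" "integrable lborel (\<lambda>y. (norm (f1 y))\<^sup>2)"
    unfolding f1_def[abs_def] using scales_lborel_integrable[OF L f(1)] scales_lborel_integrable[OF L f(2)] by simp_all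
  have [measurable]: "f1 \<in> borel_measurable borel" using f1 by auto
  have Fm[measurable]: "fourier f \<in> borel_measurable borel" "fourier f1 \<in> borel_measurable borel" by (rule borel_measurable_fourier; simp)+
  have "shearlet_transform \<psi> f a s t = (LINT x|lebesgue. f x * cnj (of_real c * \<psi> (L' x)))"
    unfolding shearlet_transform_def shearlet_def c_def D_def M_def L'_def ..
  also have "\<dots> = (LINT x|lborel. f x * cnj (of_real c * \<psi>' (L' x)))"
  proof (rule integral_lebesgue_cong_borel)
    show "AE x in lborel. f x * cnj (of_real c * \<psi> (L' x)) = f x * cnj (of_real c * \<psi>' (L' x))"
      using scales_lborel_AE[OF L inv L'm AE] by eventually_elim simp
  qed measurable
  also have "\<dots> = D *\<^sub>R (LINT y|lborel. f (L y) * cnj (of_real c * \<psi>' (L' (L y))))"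
    by (rule scales_lborel_integral[OF L]) measurable
  also have "(LINT y|lborel. f (L y) * cnj (of_real c * \<psi>' (L' (L y)))) = (LINT y|lborel. of_real c * (f1 y * cnj (\<psi>' y)))"
    by (intro Bochner_Integration.integral_cong refl) (simp add: f1_def inv)
  also have "\<dots> = of_real c * (LINT y|lborel. f1 y * cnj (\<psi>' y))"
    by (rule integral_mult_right_zero)
  also have "(LINT y|lborel. f1 y * cnj (\<psi>' y)) = (LINT \<zeta>|lborel. fourier f1 \<zeta> * cnj (g \<zeta>))"
    by (rule parseval_fourier_L2[OF f1 \<psi> \<psi>' AE g])
  also have "\<dots> = D *\<^sub>R (LINT \<xi>|lborel. fourier f1 (dual_arg a s \<xi>) * cnj (g (dual_arg a s \<xi>)))"
    unfolding dual_arg_eq D_def M_def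
    by (rule scales_lborel_integral[OF scales_lborel_shearlet_matrix(2)[OF a]]) measurable
  also have "\<dots> = (LINT \<xi>|lborel. D *\<^sub>R (fourier f1 (dual_arg a s \<xi>) * cnj (g (dual_arg a s \<xi>))))"
    by simp
  also have "\<dots> = (LINT \<xi>|lborel. cis (2 * pi * (\<xi> \<bullet> t)) * fourier f \<xi> * cnj (g (dual_arg a s \<xi>)))"
  proof (intro Bochner_Integration.integral_cong refl)
    fix \<xi>
    have "D *\<^sub>R fourier f1 (dual_arg a s \<xi>) = cis (2 * pi * (\<xi> \<bullet> t)) * fourier f \<xi>"
      unfolding D_def M_def f1_def[abs_def] L_def by (rule fourier_shear) (simp_all add: a)
    then show "D *\<^sub>R (fourier f1 (dual_arg a s \<xi>) * cnj (g (dual_arg a s \<xi>))) = cis (2 * pi * (\<xi> \<bullet> t)) * fourier f \<xi> * cnj (g (dual_arg a s \<xi>))"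
      by (simp only: mult_scaleR_left[symmetric])
  qed
  also have "D *\<^sub>R (complex_of_real c * \<dots>) = of_real (D * c) * \<dots>"
    by (simp add: scaleR_conv_of_real)
  \<comment> \<open>This \<open>D\<close> is the Jacobian in y and \<open>c\<close> is the
    normalisation D^(-1/2) of the shearlet; the Jacobian on the frequency side has been absorbed by
    \<open>fourier_shear\<close>.\<close>
  also have "D * c = D powr (1/2)"
  proof -
    have "D * c = D powr 1 * D powr (- (1/2))" using D0 by (simp add: c_def)
    then show ?thesis unfolding powr_add[symmetric] by simp
  qed
  also have "of_real (D powr (1/2)) * (LINT \<xi>|lborel. cis (2 * pi * (\<xi> \<bullet> t)) * fourier f \<xi> * cnj (g (dual_arg a s \<xi>)))
    = ift (shearlet_spectrum f g a s) t"
    unfolding ift_def shearlet_spectrum_def D[symmetric] integral_mult_right_zero[symmetric]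
    by (intro Bochner_Integration.integral_cong refl) (simp add: mult_ac)
  finally show ?thesis .
qed

lemma norm_shearlet_spectrum_square:
  "(norm (shearlet_spectrum f g a (s :: real ^ 'm::finite) \<xi>))\<^sup>2 =
    \<bar>a\<bar> powr (2 - 1 / real CARD('m option)) * ((norm (fourier f \<xi>))\<^sup>2 * (norm (g (dual_arg a s \<xi>)))\<^sup>2)"
proof -
  have "((\<bar>a\<bar> powr (2 - 1 / real CARD('m option))) powr (1 / 2))\<^sup>2 = \<bar>a\<bar> powr (2 - 1 / real CARD('m option))"
    by (simp add: powr_half_sqrt)
  then show ?thesis
    unfolding shearlet_spectrum_def norm_mult complex_mod_cnj power_mult_distrib norm_of_real power2_abs by simp
qed

lemma borel_measurable_shearlet_spectrum [measurable (raw)]: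
  fixes f g :: "(real, 'm::finite option) vec \<Rightarrow> complex"
  assumes [measurable]: "u \<in> borel_measurable M" "v \<in> borel_measurable M" "w \<in> borel_measurable M"
    and [measurable]: "fourier f \<in> borel_measurable borel" "g \<in> borel_measurable borel"
  shows "(\<lambda>x. shearlet_spectrum f g (u x) (v x) (w x)) \<in> borel_measurable M"
  unfolding shearlet_spectrum_def by measurable

lemma integrable_fourier_square:
  fixes f :: "'a::euclidean_space \<Rightarrow> complex"
  assumes f: "integrable lborel f" "integrable lborel (\<lambda>x. (norm (f x))\<^sup>2)"
  shows "integrable lborel (\<lambda>\<xi>. (norm (fourier f \<xi>))\<^sup>2)"
    and "(LINT \<xi>|lborel. (norm (fourier f \<xi>))\<^sup>2) = (LINT x|lborel. (norm (f x))\<^sup>2)"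
    and "norm (fourier f \<xi>) \<le> (LINT x|lborel. norm (f x))"
proof -
  have [measurable]: "f \<in> borel_measurable borel" using f by auto
  have F: "fourier f = (\<lambda>\<xi>. ift f (- \<xi>))" by (rule ext, rule fourier_eq_ift) simp
  show "integrable lborel (\<lambda>\<xi>. (norm (fourier f \<xi>))\<^sup>2)"
    unfolding F by (rule integrable_lborel_uminus[OF integrable_ift_square(1)[OF f]])
  show "(LINT \<xi>|lborel. (norm (fourier f \<xi>))\<^sup>2) = (LINT x|lborel. (norm (f x))\<^sup>2)"
    unfolding F integrable_ift_square(2)[OF f, symmetric]
    by (rule integral_lborel_uminus[of "\<lambda>\<xi>. (norm (ift f \<xi>))\<^sup>2"]) measurable
  show "norm (fourier f \<xi>) \<le> (LINT x|lborel. norm (f x))"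
    unfolding F by (rule norm_ift_le[OF f(1)])
qed

text \<open>The transform of \<open>f\<close> is both bounded and square integrable. Against the
  square integrable dilate of \<open>g\<close>, the second property makes the product integrable and
  the first makes it square integrable; Plancherel and Pitt then apply for each fixed
  \<open>(a, s)\<close>.\<close>

lemma shearlet_spectrum_integrable:
  fixes f g :: "(real, 'm::finite option) vec \<Rightarrow> complex"
  assumes f: "integrable lborel f" "integrable lborel (\<lambda>x. (norm (f x))\<^sup>2)"
    and gm[measurable]: "g \<in> borel_measurable borel" and g: "integrable lborel (\<lambda>x. (norm (g x))\<^sup>2)"
    and a: "a \<noteq> 0"
  shows "integrable lborel (shearlet_spectrum f g a s)"
    and "integrable lborel (\<lambda>\<xi>. (norm (shearlet_spectrum f g a s \<xi>))\<^sup>2)"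
proof -
  have [measurable]: "f \<in> borel_measurable borel" using f by auto
  have Fm[measurable]: "fourier f \<in> borel_measurable borel" by (rule borel_measurable_fourier) simp
  have gd: "integrable lborel (\<lambda>\<xi>. (norm (g (dual_arg a s \<xi>)))\<^sup>2)"
    unfolding dual_arg_eq using scales_lborel_integrable[OF scales_lborel_shearlet_matrix(2)[OF a] g] .
  show "integrable lborel (shearlet_spectrum f g a s)"
    unfolding shearlet_spectrum_def[abs_def]
    by (intro integrable_mult_right integrable_mult_cnj_L2 integrable_fourier_square f gd) measurable
  define K where "K = (LINT x|lborel. norm (f x))"
  define D where "D = \<bar>a\<bar> powr (2 - 1 / real CARD('m option))"
  show "integrable lborel (\<lambda>\<xi>. (norm (shearlet_spectrum f g a s \<xi>))\<^sup>2)"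
  proof (rule Bochner_Integration.integrable_bound)
    show "integrable lborel (\<lambda>\<xi>. D * (K\<^sup>2 * (norm (g (dual_arg a s \<xi>)))\<^sup>2))"
      by (intro integrable_mult_right gd)
    show "AE \<xi> in lborel. norm ((norm (shearlet_spectrum f g a s \<xi>))\<^sup>2) \<le> norm (D * (K\<^sup>2 * (norm (g (dual_arg a s \<xi>)))\<^sup>2))"
    proof (rule AE_I2)
      fix \<xi>
      have "(norm (fourier f \<xi>))\<^sup>2 \<le> K\<^sup>2"
        unfolding K_def by (intro power_mono integrable_fourier_square(3) f) simp
      then have "D * ((norm (fourier f \<xi>))\<^sup>2 * (norm (g (dual_arg a s \<xi>)))\<^sup>2) \<le> D * (K\<^sup>2 * (norm (g (dual_arg a s \<xi>)))\<^sup>2)"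
        by (intro mult_left_mono mult_right_mono) (auto simp: D_def)
      then show "norm ((norm (shearlet_spectrum f g a s \<xi>))\<^sup>2) \<le> norm (D * (K\<^sup>2 * (norm (g (dual_arg a s \<xi>)))\<^sup>2))"
        unfolding norm_shearlet_spectrum_square D_def[symmetric] by (simp add: D_def)
    qed
  qed measurable
qed

section \<open>The admissibility integral as a function of the frequency\<close>

lemma dil_root_mult: "dil_root n (a * b) = dil_root n a * dil_root n b"
  by (simp add: dil_root_def sgn_mult abs_mult powr_mult)

definition adm :: "((real, 'm::finite option) vec \<Rightarrow> complex) \<Rightarrow> (real, 'm option) vec \<Rightarrow> ennreal" where
  "adm g \<xi> = (\<integral>\<^sup>+s. (\<integral>\<^sup>+a. indicator (- {0}) a * ennreal ((norm (g (dual_arg a (s :: real ^ 'm) \<xi>)))\<^sup>2 /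
      \<bar>a\<bar> powr (((real CARD('m option))\<^sup>2 - real CARD('m option) + 1) / real CARD('m option))) \<partial>lborel) \<partial>lborel)"

lemma admissibility_integral_eq_adm: "admissibility_integral \<psi> \<xi> = adm (fourier_L2 \<psi>) \<xi>"
  unfolding admissibility_integral_def adm_def dual_arg_eq ..

text \<open>The substitution \<open>a \<rightarrow> a / \<xi>\<^sub>1\<close> followed by an affine one in \<open>s\<close>.\<close>

lemma adm_const:
  fixes g :: "(real, 'm::finite option) vec \<Rightarrow> complex"
  assumes [measurable]: "g \<in> borel_measurable borel" and \<xi>: "\<xi> $ None \<noteq> 0"
  shows "adm g \<xi> = adm g (pack 1 0)"
proof -
  define n where "n = real CARD('m option)"
  have n: "n = real CARD('m) + 1" by (simp add: n_def)
  define \<kappa> where "\<kappa> = (n\<^sup>2 - n + 1) / n"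
  define x where "x = \<xi> $ None"
  have x: "x \<noteq> 0" using \<xi> by (simp add: x_def)
  define \<rho> where "\<rho> = dil_root CARD('m option)"
  have [measurable]: "\<rho> \<in> borel_measurable borel" by (simp add: \<rho>_def)
  define H where "H a s = indicator (- {0}) a * ennreal ((norm (g (pack a (\<rho> a *\<^sub>R s))))\<^sup>2 / \<bar>a\<bar> powr \<kappa>)" for a and s :: "real ^ 'm"
  have [measurable]: "(\<lambda>p. H (fst p) (snd p)) \<in> borel_measurable (borel \<Otimes>\<^sub>M borel)"
    unfolding H_def by measurable
  have Hm[measurable (raw)]: "(\<lambda>p. H (u p) (v p)) \<in> borel_measurable M" if [measurable]: "u \<in> borel_measurable M" "v \<in> borel_measurable M" for u v and M :: "'z measure"
    unfolding H_def by measurable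
  define \<Theta> where "\<Theta> s = (\<integral>\<^sup>+a. H a s \<partial>lborel)" for s
  have [measurable]: "\<Theta> \<in> borel_measurable borel" unfolding \<Theta>_def[abs_def] by measurable
  have one: "adm g (pack 1 0) = (\<integral>\<^sup>+s. \<Theta> s \<partial>lborel)"
    unfolding adm_def \<Theta>_def H_def dual_arg_def \<kappa>_def n_def \<rho>_def by simp
  define r where "r = \<rho> (1 / x)"
  have r: "r \<noteq> 0" "\<bar>r\<bar> = \<bar>x\<bar> powr (- (1 / n))"
    using x by (auto simp: r_def \<rho>_def abs_dil_root n_def powr_divide powr_minus_divide)
  \<comment> \<open>The substitution in \<open>a\<close> leaves |x| to the power \<kappa> - 1 = (n -
    1)^2 / n. The one in \<open>s\<close> scales n - 1 coordinates by r x, of modulus |x|^(1 - 1/n),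
    so its Jacobian is exactly this power and the dependence on \<xi> disappears.\<close>
  have k1: "\<kappa> - 1 = real CARD('m) * (1 - 1 / n)"
    unfolding \<kappa>_def using n by (simp add: field_simps power2_eq_square)
  have "adm g \<xi> = (\<integral>\<^sup>+s. ennreal (\<bar>x\<bar> powr (\<kappa> - 1)) * \<Theta> (r *\<^sub>R rest \<xi> + (r * x) *\<^sub>R s) \<partial>lborel)"
    unfolding adm_def
  proof (rule nn_integral_cong)
    fix s :: "real ^ 'm"
    let ?h = "\<lambda>a. indicator (- {0}) a * ennreal ((norm (g (dual_arg a s \<xi>)))\<^sup>2 / \<bar>a\<bar> powr (((real CARD('m option))\<^sup>2 - real CARD('m option) + 1) / real CARD('m option)))"
    have "(\<integral>\<^sup>+a. ?h a \<partial>lborel) = ennreal \<bar>1 / x\<bar> * (\<integral>\<^sup>+a. ?h (0 + 1 / x * a) \<partial>lborel)"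
      by (rule nn_integral_real_affine) (use x in auto)
    also have "\<dots> = ennreal \<bar>1 / x\<bar> * (\<integral>\<^sup>+a. ennreal (\<bar>x\<bar> powr \<kappa>) * H a (r *\<^sub>R rest \<xi> + (r * x) *\<^sub>R s) \<partial>lborel)"
    proof (rule arg_cong[where f = "(*) (ennreal \<bar>1 / x\<bar>)"], rule nn_integral_cong)
      fix a :: real
      show "?h (0 + 1 / x * a) = ennreal (\<bar>x\<bar> powr \<kappa>) * H a (r *\<^sub>R rest \<xi> + (r * x) *\<^sub>R s)"
      proof (cases "a = 0")
        case False
        have "\<rho> (1 / x * a) = r * \<rho> a" unfolding \<rho>_def r_def by (rule dil_root_mult)
        then have arg: "dual_arg (1 / x * a) s \<xi> = pack a (\<rho> a *\<^sub>R (r *\<^sub>R rest \<xi> + (r * x) *\<^sub>R s))"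
          using x unfolding dual_arg_def \<rho>_def[symmetric] x_def[symmetric]
          by (simp add: scaleR_add_right mult_ac)
        have p: "\<bar>1 / x * a\<bar> powr \<kappa> = \<bar>a\<bar> powr \<kappa> / \<bar>x\<bar> powr \<kappa>"
          by (simp add: abs_mult powr_divide)
        have i: "indicator (- {0}) (1 / x * a) = (1 :: ennreal)" "indicator (- {0}) a = (1 :: ennreal)"
          using False x by (auto simp: indicator_def)
        show ?thesis
          unfolding H_def i n_def[symmetric] \<kappa>_def[symmetric] add_0_left arg p
          by (simp add: ennreal_mult'[symmetric] mult.commute)
      qed (simp add: H_def)
    qed
    also have "\<dots> = ennreal \<bar>1 / x\<bar> * (ennreal (\<bar>x\<bar> powr \<kappa>) * \<Theta> (r *\<^sub>R rest \<xi> + (r * x) *\<^sub>R s))"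
      unfolding \<Theta>_def by (subst nn_integral_cmult) auto
    also have "\<dots> = ennreal (\<bar>1 / x\<bar> * \<bar>x\<bar> powr \<kappa>) * \<Theta> (r *\<^sub>R rest \<xi> + (r * x) *\<^sub>R s)"
      by (simp only: ennreal_mult'[OF abs_ge_zero] mult.assoc)
    also have "\<bar>1 / x\<bar> * \<bar>x\<bar> powr \<kappa> = \<bar>x\<bar> powr (\<kappa> - 1)"
      using x by (simp add: powr_diff)
    finally show "(\<integral>\<^sup>+a. ?h a \<partial>lborel) = ennreal (\<bar>x\<bar> powr (\<kappa> - 1)) * \<Theta> (r *\<^sub>R rest \<xi> + (r * x) *\<^sub>R s)" .
  qed
  also have "\<dots> = ennreal (\<bar>x\<bar> powr (\<kappa> - 1)) * (\<integral>\<^sup>+s. \<Theta> (r *\<^sub>R rest \<xi> + (r * x) *\<^sub>R s) \<partial>lborel)"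
    by (rule nn_integral_cmult) measurable
  also have "\<bar>x\<bar> powr (\<kappa> - 1) = \<bar>r * x\<bar> ^ DIM(real ^ 'm)"
  proof -
    have "\<bar>r * x\<bar> = \<bar>x\<bar> powr (- (1 / n)) * \<bar>x\<bar> powr 1"
      using r(2) by (simp add: abs_mult)
    also have "\<dots> = \<bar>x\<bar> powr (1 - 1 / n)"
      unfolding powr_add[symmetric] by simp
    finally have "\<bar>r * x\<bar> ^ CARD('m) = \<bar>x\<bar> powr (real CARD('m) * (1 - 1 / n))"
      using x by (simp add: powr_realpow[symmetric] powr_powr mult.commute)
    then show ?thesis by (simp add: k1)
  qed
  also have "ennreal (\<bar>r * x\<bar> ^ DIM(real ^ 'm)) * (\<integral>\<^sup>+s. \<Theta> (r *\<^sub>R rest \<xi> + (r * x) *\<^sub>R s) \<partial>lborel) = (\<integral>\<^sup>+s. \<Theta> s \<partial>lborel)"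
    using r x by (intro nn_integral_lborel_affine[symmetric]) auto
  finally show ?thesis unfolding one .
qed

subsection \<open>Integration over the shearlet group\<close>

lemma ext_integral_eq_integral:
  assumes g: "integrable M g"
  shows "ext_integral M g = ereal (LINT x|M. g x)"
proof -
  have [measurable]: "g \<in> borel_measurable M" using g by auto
  have fin: "(\<integral>\<^sup>+x. ennreal (norm (g x)) \<partial>M) < \<infinity>" using g by (simp add: integrable_iff_bounded)
  have P: "(\<integral>\<^sup>+x. ennreal (g x) \<partial>M) < \<infinity>"
    by (rule order.strict_trans1[OF _ fin]) (auto intro!: nn_integral_mono ennreal_leI)
  have N: "(\<integral>\<^sup>+x. ennreal (- g x) \<partial>M) < \<infinity>"
    by (rule order.strict_trans1[OF _ fin]) (auto intro!: nn_integral_mono ennreal_leI)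
  have e: "enn2ereal X = ereal (enn2real X)" if "X < \<infinity>" for X
    using that by (cases X) auto
  have "(\<integral>\<^sup>+x. ennreal (- g x) \<partial>M) \<noteq> \<infinity>" using N by simp
  then show ?thesis
    unfolding ext_integral_def Let_def real_lebesgue_integral_def[OF g] e[OF P] e[OF N] by simp
qed

lemma ext_integral_cong_AE:
  assumes "AE x in M. g x = h x"
  shows "ext_integral M g = ext_integral M h"
proof -
  have "(\<integral>\<^sup>+x. ennreal (g x) \<partial>M) = (\<integral>\<^sup>+x. ennreal (h x) \<partial>M)" "(\<integral>\<^sup>+x. ennreal (- g x) \<partial>M) = (\<integral>\<^sup>+x. ennreal (- h x) \<partial>M)"
    using assms by (auto intro!: nn_integral_cong_AE elim: eventually_mono)
  then show ?thesis unfolding ext_integral_def by simp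
qed

lemma ln_ge_powr:
  fixes r :: real
  assumes "r > 0" "\<alpha> > 0" shows "(1 - r powr - \<alpha>) / \<alpha> \<le> ln r"
proof -
  have "1 - \<alpha> * ln r \<le> exp (- (\<alpha> * ln r))"
    using exp_ge_add_one_self[of "- (\<alpha> * ln r)"] by simp
  also have "\<dots> = r powr - \<alpha>" using assms by (simp add: powr_def)
  finally show ?thesis using assms by (simp add: field_simps)
qed

text \<open>The power bound on the logarithm is an integrable minorant, so the negative part has
  finite integral. Either the positive part has infinite integral and the claim is trivial, or the
  function is integrable and the integrals can be compared.\<close>

lemma ext_integral_ln_ge:
  fixes T q :: "'a \<Rightarrow> real"
  assumes [measurable]: "T \<in> borel_measurable M"
    and T: "AE x in M. T x > 0" and q0: "\<And>x. q x \<ge> 0" and \<alpha>: "\<alpha> > 0"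
    and q: "integrable M q" and Tq: "integrable M (\<lambda>x. T x powr - \<alpha> * q x)"
  shows "ereal (((LINT x|M. q x) - (LINT x|M. T x powr - \<alpha> * q x)) / \<alpha>) \<le> ext_integral M (\<lambda>x. ln (T x) * q x)"
proof -
  have [measurable]: "q \<in> borel_measurable M" using q by auto
  let ?g = "\<lambda>x. ln (T x) * q x"
  have low: "AE x in M. (q x - T x powr - \<alpha> * q x) / \<alpha> \<le> ?g x"
    using T
  proof eventually_elim
    fix x assume "T x > 0"
    from mult_right_mono[OF ln_ge_powr[OF this \<alpha>] q0[of x]]
    show "(q x - T x powr - \<alpha> * q x) / \<alpha> \<le> ln (T x) * q x"
      by (simp add: left_diff_distrib)
  qed
  have N: "(\<integral>\<^sup>+x. ennreal (- ?g x) \<partial>M) < \<infinity>"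
  proof (rule order.strict_trans1)
    show "(\<integral>\<^sup>+x. ennreal (- ?g x) \<partial>M) \<le> (\<integral>\<^sup>+x. ennreal (norm (1 / \<alpha> * (T x powr - \<alpha> * q x))) \<partial>M)"
    proof (rule nn_integral_mono_AE, use low in eventually_elim, rule ennreal_leI)
      fix x assume *: "(q x - T x powr - \<alpha> * q x) / \<alpha> \<le> ?g x"
      have "q x / \<alpha> \<ge> 0" using q0[of x] \<alpha> by simp
      with * have "- ?g x \<le> 1 / \<alpha> * (T x powr - \<alpha> * q x)"
        by (simp add: diff_divide_distrib)
      then show "- ?g x \<le> norm (1 / \<alpha> * (T x powr - \<alpha> * q x))"
        unfolding real_norm_def by (rule order.trans[OF _ abs_ge_self])
    qed
    show "(\<integral>\<^sup>+x. ennreal (norm (1 / \<alpha> * (T x powr - \<alpha> * q x))) \<partial>M) < \<infinity>"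
      using integrable_mult_right[OF Tq, of "1 / \<alpha>"] unfolding integrable_iff_bounded by blast
  qed
  show ?thesis
  proof (cases "(\<integral>\<^sup>+x. ennreal (?g x) \<partial>M) = \<infinity>")
    case True
    have "(\<integral>\<^sup>+x. ennreal (- ?g x) \<partial>M) \<noteq> \<infinity>" using N by simp
    then have "ext_integral M ?g = \<infinity>"
      unfolding ext_integral_def Let_def True using N by (cases "\<integral>\<^sup>+x. ennreal (- ?g x) \<partial>M") auto
    then show ?thesis by simp
  next
    case False
    have I: "integrable M ?g"
      using False N by (intro real_integrable_def[THEN iffD2]) auto
    have "((LINT x|M. q x) - (LINT x|M. T x powr - \<alpha> * q x)) / \<alpha> = (LINT x|M. (q x - T x powr - \<alpha> * q x) / \<alpha>)"
      using q Tq by simp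
    also have "\<dots> \<le> (LINT x|M. ?g x)"
      using q Tq I low by (intro integral_mono_AE) auto
    finally show ?thesis using ext_integral_eq_integral[OF I] by simp
  qed
qed

lemma AE_lborel_nonzero_component:
  fixes k :: "'a::euclidean_space"
  assumes "k \<in> Basis" shows "AE x in lborel. x \<bullet> k \<noteq> 0"
proof -
  have "negligible {x. x \<bullet> k = 0}" using assms by (rule negligible_standard_hyperplane)
  then have "AE x in lebesgue. x \<notin> {x. x \<bullet> k = 0}"
    by (intro AE_not_in) (simp add: negligible_iff_null_sets)
  then show ?thesis by (simp add: AE_completion_iff)
qed

definition shearlet_weight :: "nat \<Rightarrow> real \<Rightarrow> ennreal" where
  "shearlet_weight n a = indicator (- {0}) a * ennreal (1 / \<bar>a\<bar> ^ (n + 1))"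

lemma borel_measurable_shearlet_weight [measurable]: "shearlet_weight n \<in> borel_measurable borel"
  unfolding shearlet_weight_def[abs_def] by measurable

lemma borel_measurable_shearlet_weight_fst:
  "(\<lambda>p. shearlet_weight n (fst p)) \<in> borel_measurable (borel :: (real \<times> 'b::euclidean_space) measure)"
proof -
  have "fst \<in> (borel :: (real \<times> 'b) measure) \<rightarrow>\<^sub>M borel"
    by (intro borel_measurable_continuous_onI continuous_intros)
  then show ?thesis by (rule measurable_compose) simp
qed

lemma shearlet_measure_eq:
  "(shearlet_measure :: (real \<times> (real ^ 'm) \<times> (real, 'm::finite option) vec) measure) =
    density lborel (\<lambda>p. shearlet_weight CARD('m option) (fst p))"
  unfolding shearlet_measure_def shearlet_weight_def by (simp add: case_prod_unfold)

lemma nn_integral_shearlet_measure: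
  fixes h :: "real \<times> (real ^ 'm) \<times> (real, 'm::finite option) vec \<Rightarrow> ennreal"
  assumes [measurable]: "h \<in> borel_measurable borel"
  shows "(\<integral>\<^sup>+p. h p \<partial>shearlet_measure) =
    (\<integral>\<^sup>+a. (\<integral>\<^sup>+s. shearlet_weight CARD('m option) a * (\<integral>\<^sup>+t. h (a, s, t) \<partial>lborel) \<partial>lborel) \<partial>lborel)"
proof -
  define w where "w = shearlet_weight CARD('m option)"
  have [measurable]: "w \<in> borel_measurable borel" by (simp add: w_def)
  have hm[measurable]: "h \<in> borel_measurable (borel \<Otimes>\<^sub>M (borel \<Otimes>\<^sub>M borel))"
    using assms by (simp add: borel_prod)
  have wm: "(\<lambda>p. w (fst p)) \<in> borel_measurable (borel :: (real \<times> (real ^ 'm) \<times> (real, 'm option) vec) measure)"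
    unfolding w_def by (rule borel_measurable_shearlet_weight_fst)
  have whm: "(\<lambda>p. w (fst p) * h p) \<in> borel_measurable lborel"
    using borel_measurable_times_ennreal[OF wm assms] by simp
  have "(\<integral>\<^sup>+p. h p \<partial>shearlet_measure) = (\<integral>\<^sup>+p. w (fst p) * h p \<partial>lborel)"
    using wm unfolding shearlet_measure_eq w_def by (intro nn_integral_density) (use assms in simp_all)
  also have "\<dots> = (\<integral>\<^sup>+p. w (fst p) * h p \<partial>(lborel \<Otimes>\<^sub>M (lborel \<Otimes>\<^sub>M lborel)))"
    by (simp add: lborel_prod)
  also have "\<dots> = (\<integral>\<^sup>+a. (\<integral>\<^sup>+r. w a * h (a, r) \<partial>(lborel \<Otimes>\<^sub>M lborel)) \<partial>lborel)"
  proof -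
    have "(\<integral>\<^sup>+a. (\<integral>\<^sup>+r. w (fst (a, r)) * h (a, r) \<partial>lborel) \<partial>lborel) = (\<integral>\<^sup>+p. w (fst p) * h p \<partial>(lborel \<Otimes>\<^sub>M lborel))"
      by (rule lborel.nn_integral_fst) (use whm in \<open>simp only: lborel_prod\<close>)
    then show ?thesis by (simp add: lborel_prod)
  qed
  also have "\<dots> = (\<integral>\<^sup>+a. (\<integral>\<^sup>+s. (\<integral>\<^sup>+t. w a * h (a, s, t) \<partial>lborel) \<partial>lborel) \<partial>lborel)"
    by (subst lborel.nn_integral_fst[symmetric]) auto
  also have "\<dots> = (\<integral>\<^sup>+a. (\<integral>\<^sup>+s. w a * (\<integral>\<^sup>+t. h (a, s, t) \<partial>lborel) \<partial>lborel) \<partial>lborel)"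
    by (intro nn_integral_cong nn_integral_cmult) auto
  finally show ?thesis unfolding w_def .
qed

text \<open>The density vanishes at a = 0, and the points with t = 0 lie in a hyperplane. These are
  the exceptional points of the spectral formula for the transform and of the logarithm.\<close>

lemma AE_shearlet_measure:
  "AE p in (shearlet_measure :: (real \<times> (real ^ 'm) \<times> (real, 'm::finite option) vec) measure). fst p \<noteq> 0 \<and> snd (snd p) \<noteq> 0"
proof -
  define k where "k = (0 :: real, 0 :: real ^ 'm, axis None 1 :: (real, 'm option) vec)"
  have "axis None 1 \<in> (Basis :: (real, 'm option) vec set)" by (auto simp: Basis_vec_def)
  then have "(0, axis None 1) \<in> (Basis :: ((real ^ 'm) \<times> (real, 'm option) vec) set)"
    by (subst Basis_prod_def) (intro UnI2 imageI)
  then have "k \<in> Basis"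
    unfolding k_def by (subst Basis_prod_def) (intro UnI2 imageI)
  from AE_lborel_nonzero_component[OF this]
  have "AE p in (lborel :: (real \<times> (real ^ 'm) \<times> (real, 'm option) vec) measure). snd (snd p) \<noteq> 0"
    by eventually_elim (auto simp: k_def inner_prod_def)
  then show ?thesis
    unfolding shearlet_measure_eq
  proof (subst AE_density)
    show "(\<lambda>p. shearlet_weight CARD('m option) (fst p)) \<in> borel_measurable (lborel :: (real \<times> (real ^ 'm) \<times> (real, 'm option) vec) measure)"
      using borel_measurable_shearlet_weight_fst by simp
  qed (auto simp: shearlet_weight_def elim!: eventually_mono split: split_indicator)
qed

text \<open>Tonelli brings the integral over \<open>(a, s)\<close> inside. The determinant and the
  density of the group measure combine to the exponent 2 - 1/n - (n + 1) = - (n^2 - n + 1) / n, that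
  of the admissibility condition, so the inner integral is \<open>adm g \<xi>\<close>, constant off
  a null hyperplane. The weight \<open>v\<close> is 1 for Plancherel and a multiple of
  |\<xi>|^\<alpha> for Pitt.\<close>

lemma nn_integral_spectrum:
  fixes f g :: "(real, 'm::finite option) vec \<Rightarrow> complex"
  assumes Fm[measurable]: "fourier f \<in> borel_measurable borel" and [measurable]: "g \<in> borel_measurable borel"
    and [measurable]: "v \<in> borel_measurable borel"
  shows "(\<integral>\<^sup>+a. (\<integral>\<^sup>+s. shearlet_weight CARD('m option) a * (\<integral>\<^sup>+\<xi>. v \<xi> * ennreal ((norm (shearlet_spectrum f g a s \<xi>))\<^sup>2) \<partial>lborel) \<partial>lborel) \<partial>lborel)
    = adm g (pack 1 0) * (\<integral>\<^sup>+\<xi>. v \<xi> * ennreal ((norm (fourier f \<xi>))\<^sup>2) \<partial>lborel)"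
proof -
  define n where "n = real CARD('m option)"
  have n: "n \<ge> 1" by (simp add: n_def)
  define \<kappa> where "\<kappa> = (n\<^sup>2 - n + 1) / n"
  define w where "w = shearlet_weight CARD('m option)"
  have [measurable]: "w \<in> borel_measurable borel" by (simp add: w_def)
  define X where "X a s \<xi> = (v \<xi> * ennreal ((norm (fourier f \<xi>))\<^sup>2)) * (indicator (- {0}) a * ennreal ((norm (g (dual_arg a s \<xi>)))\<^sup>2 / \<bar>a\<bar> powr \<kappa>))" for a s \<xi>
  have Xm[measurable (raw)]: "(\<lambda>p. X (x p) (y p) (z p)) \<in> borel_measurable M"
    if [measurable]: "x \<in> borel_measurable M" "y \<in> borel_measurable M" "z \<in> borel_measurable M" for x y z and M :: "'z measure"
    unfolding X_def by measurable
  have eq: "w a * (v \<xi> * ennreal ((norm (shearlet_spectrum f g a s \<xi>))\<^sup>2)) = X a s \<xi>" for a s \<xi>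
  proof (cases "a = 0")
    case False
    have "\<bar>a\<bar> powr real (CARD('m option) + 1) = \<bar>a\<bar> ^ (CARD('m option) + 1)"
      using False by (intro powr_realpow) simp
    moreover have "real (CARD('m option) + 1) = n + 1" by (simp add: n_def)
    ultimately have "\<bar>a\<bar> powr (2 - 1 / n) / \<bar>a\<bar> ^ (CARD('m option) + 1) = \<bar>a\<bar> powr (2 - 1 / n) / \<bar>a\<bar> powr (n + 1)"
      by (simp only:)
    also have "\<dots> = \<bar>a\<bar> powr (2 - 1 / n - (n + 1))"
      by (simp only: powr_diff)
    also have "2 - 1 / n - (n + 1) = - \<kappa>"
      using n by (simp add: \<kappa>_def field_simps power2_eq_square)
    finally have e: "\<bar>a\<bar> powr (2 - 1 / n) / \<bar>a\<bar> ^ (CARD('m option) + 1) = 1 / \<bar>a\<bar> powr \<kappa>"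
      by (simp add: powr_minus_divide)
    define G where "G = (norm (g (dual_arg a s \<xi>)))\<^sup>2"
    define H where "H = (norm (fourier f \<xi>))\<^sup>2"
    define d where "d = \<bar>a\<bar> powr (2 - 1 / n)"
    define e' where "e' = \<bar>a\<bar> ^ (CARD('m option) + 1)"
    have nn: "G \<ge> 0" "H \<ge> 0" "d \<ge> 0" "e' \<ge> 0" by (simp_all add: G_def H_def d_def e'_def)
    have "w a * (v \<xi> * ennreal ((norm (shearlet_spectrum f g a s \<xi>))\<^sup>2)) = v \<xi> * (ennreal (1 / e') * ennreal (d * (H * G)))"
      using False unfolding norm_shearlet_spectrum_square n_def[symmetric] d_def[symmetric] G_def[symmetric] H_def[symmetric]
      by (simp add: w_def shearlet_weight_def e'_def mult_ac)
    also have "ennreal (1 / e') * ennreal (d * (H * G)) = ennreal (H * (G * (d / e')))"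
      using nn by (subst ennreal_mult'[symmetric]) (auto simp: mult_ac)
    also have "d / e' = 1 / \<bar>a\<bar> powr \<kappa>" using e by (simp only: d_def e'_def)
    also have "ennreal (H * (G * (1 / \<bar>a\<bar> powr \<kappa>))) = ennreal H * ennreal (G / \<bar>a\<bar> powr \<kappa>)"
      using nn by (subst ennreal_mult'[symmetric]) auto
    finally show ?thesis using False unfolding X_def G_def[symmetric] H_def[symmetric] by (simp add: mult.assoc)
  qed (simp add: X_def w_def shearlet_weight_def)
  have "(\<integral>\<^sup>+a. (\<integral>\<^sup>+s. w a * (\<integral>\<^sup>+\<xi>. v \<xi> * ennreal ((norm (shearlet_spectrum f g a s \<xi>))\<^sup>2) \<partial>lborel) \<partial>lborel) \<partial>lborel)
    = (\<integral>\<^sup>+a. (\<integral>\<^sup>+s. (\<integral>\<^sup>+\<xi>. X a s \<xi> \<partial>lborel) \<partial>lborel) \<partial>lborel)"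
    unfolding eq[symmetric] by (intro nn_integral_cong nn_integral_cmult[symmetric]) auto
  also have "\<dots> = (\<integral>\<^sup>+a. (\<integral>\<^sup>+\<xi>. (\<integral>\<^sup>+s. X a s \<xi> \<partial>lborel) \<partial>lborel) \<partial>lborel)"
    by (intro nn_integral_cong lborel_pair.Fubini') measurable
  also have "\<dots> = (\<integral>\<^sup>+\<xi>. (\<integral>\<^sup>+a. (\<integral>\<^sup>+s. X a s \<xi> \<partial>lborel) \<partial>lborel) \<partial>lborel)"
    by (rule lborel_pair.Fubini') measurable
  also have "\<dots> = (\<integral>\<^sup>+\<xi>. (\<integral>\<^sup>+s. (\<integral>\<^sup>+a. X a s \<xi> \<partial>lborel) \<partial>lborel) \<partial>lborel)"
    by (intro nn_integral_cong lborel_pair.Fubini') measurable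
  also have "\<dots> = (\<integral>\<^sup>+\<xi>. (v \<xi> * ennreal ((norm (fourier f \<xi>))\<^sup>2)) * adm g \<xi> \<partial>lborel)"
  proof (rule nn_integral_cong)
    fix \<xi> :: "(real, 'm option) vec"
    show "(\<integral>\<^sup>+s. (\<integral>\<^sup>+a. X a s \<xi> \<partial>lborel) \<partial>lborel) = (v \<xi> * ennreal ((norm (fourier f \<xi>))\<^sup>2)) * adm g \<xi>"
    proof -
      define Y where "Y a s = indicator (- {0}) a * ennreal ((norm (g (dual_arg a s \<xi>)))\<^sup>2 / \<bar>a\<bar> powr \<kappa>)" for a s
      have "(\<integral>\<^sup>+s. (\<integral>\<^sup>+a. X a s \<xi> \<partial>lborel) \<partial>lborel) = (\<integral>\<^sup>+s. (v \<xi> * ennreal ((norm (fourier f \<xi>))\<^sup>2)) * (\<integral>\<^sup>+a. Y a s \<partial>lborel) \<partial>lborel)"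
        unfolding X_def Y_def by (rule nn_integral_cong, rule nn_integral_cmult) measurable
      also have "\<dots> = (v \<xi> * ennreal ((norm (fourier f \<xi>))\<^sup>2)) * (\<integral>\<^sup>+s. (\<integral>\<^sup>+a. Y a s \<partial>lborel) \<partial>lborel)"
        unfolding Y_def by (rule nn_integral_cmult) measurable
      finally show ?thesis
        unfolding adm_def Y_def n_def \<kappa>_def .
    qed
  qed
  also have "\<dots> = (\<integral>\<^sup>+\<xi>. adm g (pack 1 0) * (v \<xi> * ennreal ((norm (fourier f \<xi>))\<^sup>2)) \<partial>lborel)"
  proof (rule nn_integral_cong_AE)
    have "axis None 1 \<in> (Basis :: (real, 'm option) vec set)" by (auto simp: Basis_vec_def)
    from AE_lborel_nonzero_component[OF this]
    show "AE \<xi> in lborel. (v \<xi> * ennreal ((norm (fourier f \<xi>))\<^sup>2)) * adm g \<xi> = adm g (pack 1 0) * (v \<xi> * ennreal ((norm (fourier f \<xi>))\<^sup>2))"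
    proof eventually_elim
      fix \<xi> :: "(real, 'm option) vec" assume "\<xi> \<bullet> axis None 1 \<noteq> 0"
      then have *: "adm g \<xi> = adm g (pack 1 0)" by (intro adm_const assms) (simp add: inner_axis)
      show "(v \<xi> * ennreal ((norm (fourier f \<xi>))\<^sup>2)) * adm g \<xi> = adm g (pack 1 0) * (v \<xi> * ennreal ((norm (fourier f \<xi>))\<^sup>2))"
        unfolding * by (rule mult.commute)
    qed
  qed
  also have "\<dots> = adm g (pack 1 0) * (\<integral>\<^sup>+\<xi>. v \<xi> * ennreal ((norm (fourier f \<xi>))\<^sup>2) \<partial>lborel)"
    by (rule nn_integral_cmult) measurable
  finally show ?thesis unfolding w_def .
qed

lemma borel_measurable_shearlet_ift:
  fixes f g :: "(real, 'm::finite option) vec \<Rightarrow> complex"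
  assumes [measurable]: "fourier f \<in> borel_measurable borel" "g \<in> borel_measurable borel"
  shows "(\<lambda>p. ift (shearlet_spectrum f g (fst p) (fst (snd p))) (snd (snd p))) \<in> borel_measurable borel"
proof -
  have "(\<lambda>p. ift (shearlet_spectrum f g (fst p) (fst (snd p))) (snd (snd p))) \<in> borel_measurable (borel \<Otimes>\<^sub>M (borel \<Otimes>\<^sub>M borel))"
    unfolding ift_def by measurable
  then show ?thesis by (simp add: borel_prod)
qed

lemma shearlet_plancherel:
  fixes f g :: "(real, 'm::finite option) vec \<Rightarrow> complex"
  assumes f: "integrable lborel f" "integrable lborel (\<lambda>x. (norm (f x))\<^sup>2)"
    and gm: "g \<in> borel_measurable borel" and g: "integrable lborel (\<lambda>x. (norm (g x))\<^sup>2)"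
  shows "(\<integral>\<^sup>+p. ennreal ((norm (ift (shearlet_spectrum f g (fst p) (fst (snd p))) (snd (snd p))))\<^sup>2) \<partial>shearlet_measure)
    = adm g (pack 1 0) * (\<integral>\<^sup>+\<xi>. ennreal ((norm (fourier f \<xi>))\<^sup>2) \<partial>lborel)"
proof -
  have Fm: "fourier f \<in> borel_measurable borel" using f by (intro borel_measurable_fourier) auto
  note m = borel_measurable_shearlet_ift[OF Fm gm]
  have "(\<integral>\<^sup>+p. ennreal ((norm (ift (shearlet_spectrum f g (fst p) (fst (snd p))) (snd (snd p))))\<^sup>2) \<partial>shearlet_measure)
    = (\<integral>\<^sup>+a. (\<integral>\<^sup>+s. shearlet_weight CARD('m option) a * (\<integral>\<^sup>+t. ennreal ((norm (ift (shearlet_spectrum f g a s) t))\<^sup>2) \<partial>lborel) \<partial>lborel) \<partial>lborel)"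
    by (rule nn_integral_shearlet_measure[of "\<lambda>p. ennreal ((norm (ift (shearlet_spectrum f g (fst p) (fst (snd p))) (snd (snd p))))\<^sup>2)", unfolded fst_conv snd_conv])
      (rule measurable_compose[OF m, of "\<lambda>z. ennreal ((norm z)\<^sup>2)" borel], measurable)
  also have "\<dots> = (\<integral>\<^sup>+a. (\<integral>\<^sup>+s. shearlet_weight CARD('m option) a * (\<integral>\<^sup>+\<xi>. 1 * ennreal ((norm (shearlet_spectrum f g a s \<xi>))\<^sup>2) \<partial>lborel) \<partial>lborel) \<partial>lborel)"
  proof (rule nn_integral_cong, rule nn_integral_cong)
    fix a :: real and s :: "real ^ 'm"
    show "shearlet_weight CARD('m option) a * (\<integral>\<^sup>+t. ennreal ((norm (ift (shearlet_spectrum f g a s) t))\<^sup>2) \<partial>lborel)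
      = shearlet_weight CARD('m option) a * (\<integral>\<^sup>+\<xi>. 1 * ennreal ((norm (shearlet_spectrum f g a s \<xi>))\<^sup>2) \<partial>lborel)"
    proof (cases "a = 0")
      case False
      then show ?thesis using plancherel[OF shearlet_spectrum_integrable[OF f gm g False, of s]] by simp
    qed (simp add: shearlet_weight_def)
  qed
  also have "\<dots> = adm g (pack 1 0) * (\<integral>\<^sup>+\<xi>. 1 * ennreal ((norm (fourier f \<xi>))\<^sup>2) \<partial>lborel)"
    by (rule nn_integral_spectrum[OF Fm gm]) simp
  finally show ?thesis by simp
qed

lemma borel_measurable_norm_powr:
  "(\<lambda>p. norm (snd (snd p) :: 'c::euclidean_space) powr c) \<in> borel_measurable (borel :: ('a::euclidean_space \<times> 'b::euclidean_space \<times> 'c) measure)"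
proof -
  have "(\<lambda>p. norm (snd (snd p) :: 'c)) \<in> borel_measurable (borel :: ('a \<times> 'b \<times> 'c) measure)"
    by (intro borel_measurable_continuous_onI continuous_intros)
  then show ?thesis by (rule measurable_compose) measurable
qed

lemma shearlet_pitt:
  fixes f g :: "(real, 'm::finite option) vec \<Rightarrow> complex"
  assumes f: "integrable lborel f" "integrable lborel (\<lambda>x. (norm (f x))\<^sup>2)"
    and gm: "g \<in> borel_measurable borel" and g: "integrable lborel (\<lambda>x. (norm (g x))\<^sup>2)"
    and \<alpha>: "0 < \<alpha>" "\<alpha> < real CARD('m option)"
  shows "(\<integral>\<^sup>+p. ennreal (norm (snd (snd p)) powr - \<alpha> * (norm (ift (shearlet_spectrum f g (fst p) (fst (snd p))) (snd (snd p))))\<^sup>2) \<partial>shearlet_measure)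
    \<le> ennreal (pitt_const (real CARD('m option)) \<alpha>) * (adm g (pack 1 0) * (\<integral>\<^sup>+\<xi>. ennreal (norm \<xi> powr \<alpha> * (norm (fourier f \<xi>))\<^sup>2) \<partial>lborel))"
proof -
  have Fm[measurable]: "fourier f \<in> borel_measurable borel" using f by (intro borel_measurable_fourier) auto
  note gm[measurable]
  note m = borel_measurable_shearlet_ift[OF Fm gm]
  define P where "P = ennreal (pitt_const (real CARD('m option)) \<alpha>)"
  have D: "\<alpha> < real DIM((real, 'm option) vec)" using \<alpha> by simp
  have "(\<integral>\<^sup>+p. ennreal (norm (snd (snd p)) powr - \<alpha> * (norm (ift (shearlet_spectrum f g (fst p) (fst (snd p))) (snd (snd p))))\<^sup>2) \<partial>shearlet_measure)
    = (\<integral>\<^sup>+a. (\<integral>\<^sup>+s. shearlet_weight CARD('m option) a * (\<integral>\<^sup>+t. ennreal (norm t powr - \<alpha> * (norm (ift (shearlet_spectrum f g a s) t))\<^sup>2) \<partial>lborel) \<partial>lborel) \<partial>lborel)"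
    by (rule nn_integral_shearlet_measure[of "\<lambda>p. ennreal (norm (snd (snd p)) powr - \<alpha> * (norm (ift (shearlet_spectrum f g (fst p) (fst (snd p))) (snd (snd p))))\<^sup>2)", unfolded fst_conv snd_conv])
      (intro measurable_compose[OF _ measurable_ennreal] borel_measurable_times borel_measurable_norm_powr borel_measurable_power measurable_compose[OF m borel_measurable_norm])
  also have "\<dots> \<le> (\<integral>\<^sup>+a. (\<integral>\<^sup>+s. shearlet_weight CARD('m option) a * (\<integral>\<^sup>+\<xi>. (P * ennreal (norm \<xi> powr \<alpha>)) * ennreal ((norm (shearlet_spectrum f g a s \<xi>))\<^sup>2) \<partial>lborel) \<partial>lborel) \<partial>lborel)"
  proof (rule nn_integral_mono, rule nn_integral_mono)
    fix a :: real and s :: "real ^ 'm"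
    show "shearlet_weight CARD('m option) a * (\<integral>\<^sup>+t. ennreal (norm t powr - \<alpha> * (norm (ift (shearlet_spectrum f g a s) t))\<^sup>2) \<partial>lborel)
      \<le> shearlet_weight CARD('m option) a * (\<integral>\<^sup>+\<xi>. (P * ennreal (norm \<xi> powr \<alpha>)) * ennreal ((norm (shearlet_spectrum f g a s \<xi>))\<^sup>2) \<partial>lborel)"
    proof (cases "a = 0")
      case False
      have "(\<integral>\<^sup>+t. ennreal (norm t powr - \<alpha> * (norm (ift (shearlet_spectrum f g a s) t))\<^sup>2) \<partial>lborel)
        \<le> P * (\<integral>\<^sup>+\<xi>. ennreal (norm \<xi> powr \<alpha> * (norm (shearlet_spectrum f g a s \<xi>))\<^sup>2) \<partial>lborel)"
        using pitt_inequality[OF shearlet_spectrum_integrable(1)[OF f gm g False, of s] \<alpha>(1) D] by (simp add: P_def)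
      also have "\<dots> = (\<integral>\<^sup>+\<xi>. P * ennreal (norm \<xi> powr \<alpha> * (norm (shearlet_spectrum f g a s \<xi>))\<^sup>2) \<partial>lborel)"
        by (rule nn_integral_cmult[symmetric]) measurable
      also have "\<dots> = (\<integral>\<^sup>+\<xi>. (P * ennreal (norm \<xi> powr \<alpha>)) * ennreal ((norm (shearlet_spectrum f g a s \<xi>))\<^sup>2) \<partial>lborel)"
        by (intro nn_integral_cong) (simp add: ennreal_mult' mult.assoc)
      finally show ?thesis by (rule mult_left_mono) simp
    qed (simp add: shearlet_weight_def)
  qed
  also have "\<dots> = adm g (pack 1 0) * (\<integral>\<^sup>+\<xi>. (P * ennreal (norm \<xi> powr \<alpha>)) * ennreal ((norm (fourier f \<xi>))\<^sup>2) \<partial>lborel)"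
    by (rule nn_integral_spectrum[OF Fm gm]) measurable
  also have "(\<integral>\<^sup>+\<xi>. (P * ennreal (norm \<xi> powr \<alpha>)) * ennreal ((norm (fourier f \<xi>))\<^sup>2) \<partial>lborel) = (\<integral>\<^sup>+\<xi>. P * ennreal (norm \<xi> powr \<alpha> * (norm (fourier f \<xi>))\<^sup>2) \<partial>lborel)"
    by (intro nn_integral_cong) (simp add: ennreal_mult' mult.assoc)
  also have "\<dots> = P * (\<integral>\<^sup>+\<xi>. ennreal (norm \<xi> powr \<alpha> * (norm (fourier f \<xi>))\<^sup>2) \<partial>lborel)"
    by (rule nn_integral_cmult) measurable
  finally show ?thesis by (simp add: P_def mult.left_commute)
qed

section \<open>Pitt's constant at \<alpha> = 0\<close>

lemma pitt_const_0:
  assumes "n > 0" shows "pitt_const n 0 = 1"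
proof -
  have "Gamma (n / 4) > 0" using assms by (intro Gamma_real_pos) simp
  then show ?thesis by (simp add: pitt_const_def)
qed

text \<open>At 0 the quotient of the Gamma values is 1, with derivative - (1/4 + 1/4) times the
  logarithmic derivative of \<open>Gamma\<close> at n/4; squaring doubles this, and pi powr \<alpha>
  contributes \<open>ln pi\<close>.\<close>

lemma pitt_const_derivative:
  assumes n: "n > 0"
  shows "(pitt_const n has_field_derivative (ln pi - deriv Gamma (n / 4) / Gamma (n / 4))) (at 0)"
proof -
  have G: "Gamma (n / 4) > 0" using n by (intro Gamma_real_pos) simp
  have nn: "n / 4 \<notin> \<int>\<^sub>\<le>\<^sub>0" using n by (auto elim!: nonpos_Ints_cases)
  have dG: "(Gamma has_field_derivative Gamma (n / 4) * Digamma (n / 4)) (at (n / 4))"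
    using has_field_derivative_Gamma[OF nn] .
  then have d: "deriv Gamma (n / 4) / Gamma (n / 4) = Digamma (n / 4)"
    using G by (simp add: DERIV_imp_deriv)
  have d1: "((\<lambda>\<alpha>. Gamma ((n - \<alpha>) / 4)) has_field_derivative (Gamma (n / 4) * Digamma (n / 4)) * (- 1 / 4)) (at 0)"
    by (rule DERIV_chain'[where g = Gamma and f = "\<lambda>\<alpha>. (n - \<alpha>) / 4"]) (use dG in \<open>auto intro!: derivative_eq_intros\<close>)
  have d2: "((\<lambda>\<alpha>. Gamma ((n + \<alpha>) / 4)) has_field_derivative (Gamma (n / 4) * Digamma (n / 4)) * (1 / 4)) (at 0)"
    by (rule DERIV_chain'[where g = Gamma and f = "\<lambda>\<alpha>. (n + \<alpha>) / 4"]) (use dG in \<open>auto intro!: derivative_eq_intros\<close>)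
  have eq: "pitt_const n = (\<lambda>\<alpha>. exp (\<alpha> * ln pi) * (Gamma ((n - \<alpha>) / 4) / Gamma ((n + \<alpha>) / 4))\<^sup>2)"
    by (auto simp: fun_eq_iff pitt_const_def powr_def)
  have d3: "((\<lambda>\<alpha>. Gamma ((n - \<alpha>) / 4) / Gamma ((n + \<alpha>) / 4)) has_field_derivative - (Digamma (n / 4) / 2)) (at 0)"
  proof (rule DERIV_cong[OF DERIV_divide[OF d1 d2]])
    show "Gamma ((n + 0) / 4) \<noteq> 0" using G by simp
    show "(Gamma (n / 4) * Digamma (n / 4) * (- 1 / 4) * Gamma ((n + 0) / 4) - Gamma ((n - 0) / 4) * (Gamma (n / 4) * Digamma (n / 4) * (1 / 4)))
        / (Gamma ((n + 0) / 4) * Gamma ((n + 0) / 4)) = - (Digamma (n / 4) / 2)"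
      using G by (simp add: divide_simps)
  qed
  have d4: "((\<lambda>\<alpha>. exp (\<alpha> * ln pi)) has_field_derivative ln pi) (at 0)"
    by (auto intro!: derivative_eq_intros)
  show ?thesis
    unfolding eq d
  proof (rule DERIV_cong[OF DERIV_mult[OF d4 DERIV_power[OF d3, where n = 2]]])
    have "Gamma ((n - 0) / 4) / Gamma ((n + 0) / 4) = 1" using G by simp
    then show "ln pi * (Gamma ((n - 0) / 4) / Gamma ((n + 0) / 4))\<^sup>2
        + real 2 * (- (Digamma (n / 4) / 2) * (Gamma ((n - 0) / 4) / Gamma ((n + 0) / 4)) ^ (2 - Suc 0)) * exp (0 * ln pi)
      = ln pi - Digamma (n / 4)"
      by simp
  qed
qed

subsection \<open>The logarithmic inequality\<close>

text \<open>Majorants for the limit \<alpha> \<rightarrow> 0: the first weight handles large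
  frequencies, the second the logarithmic singularity at the origin. The exponent 1/2 is a
  convenient choice in the interval (0, 1).\<close>

lemma schwartz_fourier_integrable_weighted:
  fixes f :: "real ^ 'n \<Rightarrow> complex"
  assumes f: "schwartz f"
  shows "integrable lborel (\<lambda>\<xi>. (1 + (norm \<xi>)\<^sup>2) * (norm (fourier f \<xi>))\<^sup>2)"
    and "integrable lborel (\<lambda>\<xi>. norm \<xi> powr - (1/2) * (norm (fourier f \<xi>))\<^sup>2)"
proof -
  have F: "fourier f = (\<lambda>\<xi>. ift f (- \<xi>))" by (rule ext, rule fourier_eq_ift) (rule schwartz_borel[OF f])
  have 2: "integrable lborel (\<lambda>\<xi>. (norm \<xi>)\<^sup>2 * (norm (fourier f \<xi>))\<^sup>2)"
    unfolding F using integrable_lborel_uminus[OF schwartz_ift_integrable_weighted(1)[OF f]] by simp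
  show "integrable lborel (\<lambda>\<xi>. norm \<xi> powr - (1/2) * (norm (fourier f \<xi>))\<^sup>2)"
    unfolding F using integrable_lborel_uminus[OF schwartz_ift_integrable_weighted(2)[OF f, of "1/2"]] by simp
  have "(\<lambda>\<xi>. (1 + (norm \<xi>)\<^sup>2) * (norm (fourier f \<xi>))\<^sup>2) = (\<lambda>\<xi>. (norm (fourier f \<xi>))\<^sup>2 + (norm \<xi>)\<^sup>2 * (norm (fourier f \<xi>))\<^sup>2)"
    by (simp add: algebra_simps)
  then show "integrable lborel (\<lambda>\<xi>. (1 + (norm \<xi>)\<^sup>2) * (norm (fourier f \<xi>))\<^sup>2)"
    using integrable_fourier_square(1)[OF schwartz_integrable[OF f]] 2 by simp
qed

text \<open>A bound uniform in \<alpha>, for dominated convergence. For r \<ge> 1 the quotient lies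
  between 0 and r^\<alpha> ln r \<le> r^2; for r < 1 it lies between ln r and 0, and - ln r \<le> 2
  r^(-1/2) because ln y \<le> y at y = r^(-1/2).\<close>

lemma powr_difference_quotient_bound:
  fixes r :: real
  assumes r: "r > 0" and a: "0 < \<alpha>" "\<alpha> \<le> 1"
  shows "\<bar>(r powr \<alpha> - 1) / \<alpha>\<bar> \<le> (1 + r\<^sup>2) + 2 * r powr - (1/2)"
proof -
  have lower: "ln r \<le> (r powr \<alpha> - 1) / \<alpha>"
    using exp_ge_add_one_self[of "\<alpha> * ln r"] r a by (simp add: powr_def field_simps)
  have pos: "r powr - (1/2) > 0" using r by simp
  show ?thesis
  proof (cases "r \<ge> 1")
    case True
    have "1 - \<alpha> * ln r \<le> r powr - \<alpha>"
      using exp_ge_add_one_self[of "- (\<alpha> * ln r)"] r by (simp add: powr_def)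
    then have "r powr \<alpha> * (1 - \<alpha> * ln r) \<le> r powr \<alpha> * r powr - \<alpha>"
      by (rule mult_left_mono) simp
    then have "r powr \<alpha> - 1 \<le> r powr \<alpha> * (\<alpha> * ln r)"
      using r by (simp add: powr_add[symmetric] algebra_simps)
    then have "(r powr \<alpha> - 1) / \<alpha> \<le> r powr \<alpha> * ln r"
      using a by (simp add: field_simps)
    also have "\<dots> \<le> r powr 1 * r"
    proof (rule mult_mono)
      show "r powr \<alpha> \<le> r powr 1" using True a by (intro powr_mono) auto
      show "ln r \<le> r" using ln_bound[OF r] by simp
    qed (use True in auto)
    finally have "(r powr \<alpha> - 1) / \<alpha> \<le> r\<^sup>2" using r by (simp add: power2_eq_square)
    moreover have "ln r \<ge> 0" using True by simp
    ultimately show ?thesis using lower pos by linarith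
  next
    case False
    have "r powr \<alpha> \<le> 1" using False r a by (intro powr_le1) auto
    then have "(r powr \<alpha> - 1) / \<alpha> \<le> 0" using a by (simp add: divide_nonpos_pos)
    moreover have "- ln r \<le> 2 * r powr - (1/2)"
    proof -
      have "ln (r powr - (1/2)) \<le> r powr - (1/2)" by (rule ln_bound[OF pos])
      then show ?thesis using r by (simp add: ln_powr)
    qed
    moreover have "1 + r\<^sup>2 \<ge> 0" by (simp add: add_nonneg_nonneg)
    ultimately show ?thesis using lower by linarith
  qed
qed

lemma powr_difference_quotient_tendsto:
  fixes r :: real
  assumes r: "r > 0" and a: "filterlim a (at 0) F"
  shows "((\<lambda>k. (r powr a k - 1) / a k) \<longlongrightarrow> ln r) F"
proof -
  have "((\<lambda>\<alpha>. exp (\<alpha> * ln r)) has_field_derivative ln r) (at 0)"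
    by (auto intro!: derivative_eq_intros)
  then have "((\<lambda>\<alpha>. (r powr \<alpha> - 1) / \<alpha>) \<longlongrightarrow> ln r) (at 0)"
    using r by (simp add: DERIV_def powr_def)
  then show ?thesis by (rule filterlim_compose[OF _ a])
qed

text \<open>With P the Pitt constant and A the weighted integral at \<open>a k\<close>, and A0 the
  integral of \<open>Q\<close>, A0 - P A = - (P - 1) A - (A - A0). After division by
  \<open>a k\<close>, the quotient of P - 1 tends to the derivative of \<open>pitt_const n\<close>
  at 0, as \<open>pitt_const n 0 = 1\<close>, and that of A - A0 to the logarithmic integral by
  dominated convergence.\<close>

lemma pitt_deficit_tendsto:
  fixes f :: "real ^ 'n \<Rightarrow> complex" and a :: "nat \<Rightarrow> real"
  assumes f: "schwartz f" and n: "n > 0" and a: "\<And>k. 0 < a k" "\<And>k. a k \<le> 1" "a \<longlonglongrightarrow> 0"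
  defines "Q \<equiv> \<lambda>\<xi>. (norm (fourier f \<xi>))\<^sup>2"
  shows "integrable lborel (\<lambda>\<xi>. ln (norm \<xi>) * Q \<xi>)"
    and "\<And>k. integrable lborel (\<lambda>\<xi>. norm \<xi> powr a k * Q \<xi>)"
    and "(\<lambda>k. ((LINT \<xi>|lborel. Q \<xi>) - pitt_const n (a k) * (LINT \<xi>|lborel. norm \<xi> powr a k * Q \<xi>)) / a k)
      \<longlonglongrightarrow> (deriv Gamma (n / 4) / Gamma (n / 4) - ln pi) * (LINT \<xi>|lborel. Q \<xi>) - (LINT \<xi>|lborel. ln (norm \<xi>) * Q \<xi>)"
proof -
  have Fm[measurable]: "fourier f \<in> borel_measurable borel"
    by (rule borel_measurable_fourier[OF schwartz_borel[OF f]])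
  have Q0: "Q \<xi> \<ge> 0" for \<xi> by (simp add: Q_def)
  have [measurable]: "Q \<in> borel_measurable borel" unfolding Q_def by measurable
  have Q: "integrable lborel Q" unfolding Q_def by (rule integrable_fourier_square(1)[OF schwartz_integrable[OF f]])
  have w1: "integrable lborel (\<lambda>\<xi>. (1 + (norm \<xi>)\<^sup>2) * Q \<xi>)" and w2: "integrable lborel (\<lambda>\<xi>. norm \<xi> powr - (1/2) * Q \<xi>)"
    unfolding Q_def using schwartz_fourier_integrable_weighted[OF f] by auto
  have at0: "filterlim a (at 0) sequentially"
    using a(1,3) by (intro filterlim_atI) (auto simp: less_imp_neq[symmetric])
  have AE0: "AE \<xi> in lborel. \<xi> \<noteq> (0 :: real ^ 'n)" by (rule AE_lborel_singleton)
  show Ak: "integrable lborel (\<lambda>\<xi>. norm \<xi> powr a k * Q \<xi>)" for k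
  proof (rule Bochner_Integration.integrable_bound[OF w1])
    show "AE \<xi> in lborel. norm (norm \<xi> powr a k * Q \<xi>) \<le> norm ((1 + (norm \<xi>)\<^sup>2) * Q \<xi>)"
      using powr_le_one_plus_square[of _ "a k"] a(1,2)[of k] Q0
      by (intro AE_I2) (auto simp: abs_mult intro!: mult_right_mono)
  qed measurable
  have lim_A: "(\<lambda>k. LINT \<xi>|lborel. norm \<xi> powr a k * Q \<xi>) \<longlonglongrightarrow> (LINT \<xi>|lborel. Q \<xi>)"
  proof (rule integral_dominated_convergence[where w = "\<lambda>\<xi>. (1 + (norm \<xi>)\<^sup>2) * Q \<xi>"])
    show "AE \<xi> in lborel. (\<lambda>k. norm \<xi> powr a k * Q \<xi>) \<longlonglongrightarrow> Q \<xi>"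
      using AE0
    proof eventually_elim
      fix \<xi> :: "real ^ 'n" assume "\<xi> \<noteq> 0"
      then have "(\<lambda>k. norm \<xi> powr a k * Q \<xi>) \<longlonglongrightarrow> norm \<xi> powr 0 * Q \<xi>"
        by (intro tendsto_intros a(3)) auto
      then show "(\<lambda>k. norm \<xi> powr a k * Q \<xi>) \<longlonglongrightarrow> Q \<xi>" using \<open>\<xi> \<noteq> 0\<close> by simp
    qed
    show "AE \<xi> in lborel. norm (norm \<xi> powr a k * Q \<xi>) \<le> (1 + (norm \<xi>)\<^sup>2) * Q \<xi>" for k
      using powr_le_one_plus_square[of _ "a k"] a(1,2)[of k] Q0
      by (intro AE_I2) (auto simp: abs_mult intro!: mult_right_mono)
  qed (use w1 in auto)
  define w where "w \<xi> = (1 + (norm \<xi>)\<^sup>2) * Q \<xi> + 2 * (norm \<xi> powr - (1/2) * Q \<xi>)" for \<xi>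
  have w: "integrable lborel w" unfolding w_def[abs_def] using w1 w2 by simp
  define d where "d k \<xi> = (norm \<xi> powr a k - 1) / a k * Q \<xi>" for k \<xi>
  have dm: "d k \<in> borel_measurable lborel" for k unfolding d_def[abs_def] by measurable
  have lm: "(\<lambda>\<xi>. ln (norm \<xi>) * Q \<xi>) \<in> borel_measurable lborel" by measurable
  have d_lim: "AE \<xi> in lborel. (\<lambda>k. d k \<xi>) \<longlonglongrightarrow> ln (norm \<xi>) * Q \<xi>"
    using AE0
  proof eventually_elim
    fix \<xi> :: "real ^ 'n" assume "\<xi> \<noteq> 0"
    then show "(\<lambda>k. d k \<xi>) \<longlonglongrightarrow> ln (norm \<xi>) * Q \<xi>"
      unfolding d_def by (intro tendsto_mult tendsto_const powr_difference_quotient_tendsto at0) simp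
  qed
  have d_bd: "AE \<xi> in lborel. norm (d k \<xi>) \<le> w \<xi>" for k
    using AE0
  proof eventually_elim
    fix \<xi> :: "real ^ 'n" assume "\<xi> \<noteq> 0"
    then have "\<bar>(norm \<xi> powr a k - 1) / a k\<bar> * Q \<xi> \<le> ((1 + (norm \<xi>)\<^sup>2) + 2 * norm \<xi> powr - (1/2)) * Q \<xi>"
      by (intro mult_right_mono powr_difference_quotient_bound a Q0) simp
    then show "norm (d k \<xi>) \<le> w \<xi>"
      using Q0[of \<xi>] by (simp add: d_def w_def abs_mult distrib_right mult.assoc)
  qed
  show "integrable lborel (\<lambda>\<xi>. ln (norm \<xi>) * Q \<xi>)"
    by (rule integrable_dominated_convergence[OF lm dm w d_lim d_bd])
  have lim_B: "(\<lambda>k. LINT \<xi>|lborel. d k \<xi>) \<longlonglongrightarrow> (LINT \<xi>|lborel. ln (norm \<xi>) * Q \<xi>)"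
    by (rule integral_dominated_convergence[OF lm dm w d_lim d_bd])
  define A where "A k = (LINT \<xi>|lborel. norm \<xi> powr a k * Q \<xi>)" for k
  define A0 where "A0 = (LINT \<xi>|lborel. Q \<xi>)"
  have dA: "(LINT \<xi>|lborel. d k \<xi>) = (A k - A0) / a k" for k
  proof -
    have "(LINT \<xi>|lborel. d k \<xi>) = (LINT \<xi>|lborel. (norm \<xi> powr a k * Q \<xi> - Q \<xi>) / a k)"
      by (simp add: d_def left_diff_distrib)
    also have "\<dots> = (A k - A0) / a k"
      using Ak[of k] Q by (simp add: A_def A0_def)
    finally show ?thesis .
  qed
  have "((\<lambda>h. (pitt_const n h - 1) / h) \<longlongrightarrow> ln pi - deriv Gamma (n / 4) / Gamma (n / 4)) (at 0)"
    using pitt_const_derivative[OF n] pitt_const_0[OF n] by (simp add: DERIV_def)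
  from filterlim_compose[OF this at0]
  have lim_P: "(\<lambda>k. (pitt_const n (a k) - 1) / a k) \<longlonglongrightarrow> ln pi - deriv Gamma (n / 4) / Gamma (n / 4)" .
  have "(\<lambda>k. - ((pitt_const n (a k) - 1) / a k * A k) - (LINT \<xi>|lborel. d k \<xi>))
    \<longlonglongrightarrow> - ((ln pi - deriv Gamma (n / 4) / Gamma (n / 4)) * A0) - (LINT \<xi>|lborel. ln (norm \<xi>) * Q \<xi>)"
    using lim_A unfolding A_def[symmetric] A0_def[symmetric]
    by (intro tendsto_diff tendsto_minus tendsto_mult lim_P lim_B)
  also have "(\<lambda>k. - ((pitt_const n (a k) - 1) / a k * A k) - (LINT \<xi>|lborel. d k \<xi>)) = (\<lambda>k. (A0 - pitt_const n (a k) * A k) / a k)"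
    unfolding dA by (simp add: fun_eq_iff diff_divide_distrib left_diff_distrib)
  also have "- ((ln pi - deriv Gamma (n / 4) / Gamma (n / 4)) * A0) = (deriv Gamma (n / 4) / Gamma (n / 4) - ln pi) * A0"
    by (simp add: left_diff_distrib)
  finally show "(\<lambda>k. ((LINT \<xi>|lborel. Q \<xi>) - pitt_const n (a k) * (LINT \<xi>|lborel. norm \<xi> powr a k * Q \<xi>)) / a k)
      \<longlonglongrightarrow> (deriv Gamma (n / 4) / Gamma (n / 4) - ln pi) * (LINT \<xi>|lborel. Q \<xi>) - (LINT \<xi>|lborel. ln (norm \<xi>) * Q \<xi>)"
    unfolding A_def A0_def .
qed

theorem theorem3p1:
  fixes \<psi> f :: "(real, 'm::finite option) vec \<Rightarrow> complex"
    and \<omega> :: "(real, 'm option) vec"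
    and n :: nat and C :: real
  assumes n: "n = CARD('m option)"
    and psi: "admissible_shearlet \<psi>"
    and omega: "\<omega> $ None \<noteq> 0"
    and C: "C = enn2real (admissibility_integral \<psi> \<omega>)"
    and f: "schwartz f"
  shows "ext_integral shearlet_measure
           (\<lambda>(a, s, t). ln (norm t) * (norm (shearlet_transform \<psi> f a s t))\<^sup>2)
         + ereal C * ext_integral lborel (\<lambda>\<xi>. ln (norm \<xi>) * (norm (fourier f \<xi>))\<^sup>2)
         \<ge> ereal (C * (deriv Gamma (real n / 4) / Gamma (real n / 4) - ln pi)
                    * (LINT x|lborel. (norm (f x))\<^sup>2))"
proof -
  have \<psi>: "square_integrable \<psi>" using psi by (simp add: admissible_shearlet_def)
  define g where "g = fourier_L2 \<psi>"
  have gF: "is_fourier_L2 \<psi> g" unfolding g_def by (rule is_fourier_L2_fourier_L2[OF \<psi>])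
  then have gm: "g \<in> borel_measurable borel" and "square_integrable g" by (auto simp: is_fourier_L2_def)
  then have g2: "integrable lborel (\<lambda>x. (norm (g x))\<^sup>2)"
    by (subst (asm) square_integrable_iff_lborel[where f' = g]) (auto simp: measurable_completion)
  define c0 where "c0 = adm g (pack 1 0)"
  have adm: "admissibility_integral \<psi> \<xi> = c0" if "\<xi> $ None \<noteq> 0" for \<xi>
    unfolding admissibility_integral_eq_adm g_def[symmetric] c0_def using gm that by (rule adm_const)
  \<comment> \<open>Admissibility provides a finite value at one frequency, and \<open>adm\<close>
    carries it to \<open>\<omega>\<close>. Finiteness matters because \<open>enn2real\<close> sends
    infinity to 0, so that \<open>C\<close> would otherwise not represent \<open>c0\<close>.\<close>
  have "c0 < \<infinity>" using psi adm unfolding admissible_shearlet_def by auto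
  then have c0: "c0 = ennreal C" using C adm[OF omega] by simp
  have C0: "C \<ge> 0" unfolding C by simp
  note f1 = schwartz_integrable[OF f]
  have Fm: "fourier f \<in> borel_measurable borel" using f1 by (intro borel_measurable_fourier) auto
  have n0: "real n > 0" "real n \<ge> 2" by (simp_all add: n)
  define Q where "Q \<xi> = (norm (fourier f \<xi>))\<^sup>2" for \<xi>
  define A where "A \<alpha> = (LINT \<xi>|lborel. norm \<xi> powr \<alpha> * Q \<xi>)" for \<alpha>
  define A0 where "A0 = (LINT \<xi>|lborel. Q \<xi>)"
  define B where "B = (LINT \<xi>|lborel. ln (norm \<xi>) * Q \<xi>)"
  \<comment> \<open>A positive null sequence inside the range of Pitt's inequality, since
    \<open>a k\<close> \<le> 1 < n.\<close>
  define a where "a k = 1 / real (Suc (Suc k))" for k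
  have a: "0 < a k" "a k \<le> 1" for k
    by (auto simp: a_def)
  then have an: "a k < real n" for k
    using n0(2) by (intro order.strict_trans1[OF a(2)]) simp
  have a_lim: "a \<longlonglongrightarrow> 0" unfolding a_def by (intro LIMSEQ_Suc lim_1_over_n)
  note lim = pitt_deficit_tendsto[OF f n0(1) a(1,2) a_lim, folded Q_def]
  have A0_eq: "A0 = (LINT x|lborel. (norm (f x))\<^sup>2)"
    unfolding A0_def Q_def by (rule integrable_fourier_square(2)[OF f1])
  have QI: "integrable lborel Q" unfolding Q_def[abs_def] by (rule integrable_fourier_square(1)[OF f1])
  define q where "q p = (norm (ift (shearlet_spectrum f g (fst p) (fst (snd p))) (snd (snd p))))\<^sup>2" for p
  define T where "T p = norm (snd (snd p))" for p :: "real \<times> (real ^ 'm) \<times> (real, 'm option) vec"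
  let ?M = "shearlet_measure :: (real \<times> (real ^ 'm) \<times> (real, 'm option) vec) measure"
  have sets_M: "sets ?M = sets borel" by (simp add: shearlet_measure_eq)
  have Mb: "borel_measurable ?M = borel_measurable borel"
    by (rule measurable_cong_sets[OF sets_M refl])
  have qm: "q \<in> borel_measurable ?M"
    unfolding Mb q_def[abs_def]
    by (rule measurable_compose[OF borel_measurable_shearlet_ift[OF Fm gm], of "\<lambda>z. (norm z)\<^sup>2" borel]) measurable
  have Tm: "T \<in> borel_measurable ?M"
    unfolding Mb T_def[abs_def] by (intro borel_measurable_continuous_onI continuous_intros)
  have q_int: "(\<integral>\<^sup>+p. ennreal (q p) \<partial>?M) = ennreal (C * A0)"
  proof -
    have "(\<integral>\<^sup>+p. ennreal (q p) \<partial>?M) = c0 * (\<integral>\<^sup>+\<xi>. ennreal (Q \<xi>) \<partial>lborel)"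
      unfolding q_def Q_def c0_def by (rule shearlet_plancherel[OF f1 gm g2])
    also have "(\<integral>\<^sup>+\<xi>. ennreal (Q \<xi>) \<partial>lborel) = ennreal A0"
      unfolding A0_def by (rule nn_integral_eq_integral[OF QI]) (simp add: Q_def)
    finally show ?thesis using C0 by (simp add: c0 ennreal_mult')
  qed
  have A0_nn: "A0 \<ge> 0" unfolding A0_def by (intro Bochner_Integration.integral_nonneg) (simp add: Q_def)
  have q: "integrable ?M q" "(LINT p|?M. q p) = C * A0"
  proof -
    show "integrable ?M q"
      using q_int qm by (intro integrableI_bounded) (auto simp: q_def)
    show "(LINT p|?M. q p) = C * A0"
      using q_int qm C0 A0_nn by (subst integral_eq_nn_integral) (auto simp: q_def)
  qed
  \<comment> \<open>The integral of \<open>q\<close> is C A0 by Plancherel over the group, and that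
    of \<open>T p powr - a k * q p\<close> is at most the Pitt constant times C A(a k);
    \<open>ext_integral_ln_ge\<close> turns the difference into a lower bound for the logarithmic
    integral.\<close>
  have low: "ereal (C * ((A0 - pitt_const (real n) (a k) * A (a k)) / a k)) \<le> ext_integral ?M (\<lambda>p. ln (T p) * q p)" for k
  proof -
    define P where "P = pitt_const (real n) (a k)"
    have P0: "P \<ge> 0" by (simp add: P_def pitt_const_def)
    have Ak0: "A (a k) \<ge> 0" unfolding A_def by (intro Bochner_Integration.integral_nonneg) (simp add: Q_def)
    have le: "(\<integral>\<^sup>+p. ennreal (T p powr - a k * q p) \<partial>?M) \<le> ennreal (P * (C * A (a k)))"
    proof -
      have "(\<integral>\<^sup>+p. ennreal (T p powr - a k * q p) \<partial>?M) \<le> ennreal P * (c0 * (\<integral>\<^sup>+\<xi>. ennreal (norm \<xi> powr a k * Q \<xi>) \<partial>lborel))"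
        unfolding q_def Q_def c0_def T_def P_def n by (rule shearlet_pitt[OF f1 gm g2]) (use a(1)[of k] an[of k] in \<open>simp_all only: n\<close>)
      also have "(\<integral>\<^sup>+\<xi>. ennreal (norm \<xi> powr a k * Q \<xi>) \<partial>lborel) = ennreal (A (a k))"
        unfolding A_def by (rule nn_integral_eq_integral[OF lim(2)]) (simp add: Q_def)
      also have "ennreal P * (c0 * ennreal (A (a k))) = ennreal (P * (C * A (a k)))"
        using P0 C0 by (simp add: c0 ennreal_mult')
      finally show ?thesis .
    qed
    have m: "(\<lambda>p. T p powr - a k * q p) \<in> borel_measurable ?M" using Tm qm by measurable
    have nn: "T p powr - a k * q p \<ge> 0" for p by (simp add: q_def)
    have I: "integrable ?M (\<lambda>p. T p powr - a k * q p)"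
      using m nn order.strict_trans1[OF le] by (intro integrableI_bounded) auto
    have "ennreal (LINT p|?M. T p powr - a k * q p) \<le> ennreal (P * (C * A (a k)))"
      using le nn_integral_eq_integral[OF I] nn by simp
    then have le': "(LINT p|?M. T p powr - a k * q p) \<le> P * (C * A (a k))"
      using P0 C0 Ak0 by (subst (asm) ennreal_le_iff) auto
    have "C * ((A0 - P * A (a k)) / a k) = (C * A0 - P * (C * A (a k))) / a k"
      by (simp add: right_diff_distrib)
    also have "\<dots> \<le> ((LINT p|?M. q p) - (LINT p|?M. T p powr - a k * q p)) / a k"
      using le' a(1)[of k] by (intro divide_right_mono) (auto simp: q(2))
    finally have "ereal (C * ((A0 - P * A (a k)) / a k)) \<le> ereal (((LINT p|?M. q p) - (LINT p|?M. T p powr - a k * q p)) / a k)"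
      by simp
    also have "\<dots> \<le> ext_integral ?M (\<lambda>p. ln (T p) * q p)"
    proof (rule ext_integral_ln_ge[OF Tm _ _ a(1) q(1) I])
      show "AE p in ?M. T p > 0" using AE_shearlet_measure by eventually_elim (simp add: T_def)
    qed (simp add: q_def)
    finally show ?thesis unfolding P_def .
  qed
  define G where "G = deriv Gamma (real n / 4) / Gamma (real n / 4) - ln pi"
  have "(\<lambda>k. ereal (C * ((A0 - pitt_const (real n) (a k) * A (a k)) / a k))) \<longlonglongrightarrow> ereal (C * (G * A0 - B))"
    using lim(3) unfolding A_def A0_def B_def G_def by (intro tendsto_intros)
  then have "ereal (C * (G * A0 - B)) \<le> ext_integral ?M (\<lambda>p. ln (T p) * q p)"
    by (rule LIMSEQ_le_const2) (use low in blast)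
  \<comment> \<open>The transform is identified with the Fourier integral of its spectrum for a
    \<noteq> 0, which is almost everywhere for the group measure.\<close>
  also have "ext_integral ?M (\<lambda>p. ln (T p) * q p) = ext_integral ?M (\<lambda>(a, s, t). ln (norm t) * (norm (shearlet_transform \<psi> f a s t))\<^sup>2)"
  proof (rule ext_integral_cong_AE)
    show "AE p in ?M. ln (T p) * q p = (case p of (a, s, t) \<Rightarrow> ln (norm t) * (norm (shearlet_transform \<psi> f a s t))\<^sup>2)"
      using AE_shearlet_measure
      by eventually_elim (auto simp: T_def q_def shearlet_transform_eq_ift[OF f1 \<psi> gF])
  qed
  finally have main: "ereal (C * (G * A0 - B)) \<le> ext_integral ?M (\<lambda>(a, s, t). ln (norm t) * (norm (shearlet_transform \<psi> f a s t))\<^sup>2)" .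
  \<comment> \<open>The frequency integral is a real number, so C B can be added to both sides even
    if the integral over the group is infinite, and no indeterminate sum arises.\<close>
  have "ext_integral lborel (\<lambda>\<xi>. ln (norm \<xi>) * (norm (fourier f \<xi>))\<^sup>2) = ereal B"
    unfolding B_def Q_def using lim(1) by (intro ext_integral_eq_integral) (simp add: Q_def)
  moreover have "ereal (C * (G * A0 - B)) + ereal (C * B) = ereal (C * G * A0)"
    by (simp add: algebra_simps)
  ultimately show ?thesis
    using add_right_mono[OF main, of "ereal (C * B)"] by (simp add: G_def A0_eq)
qed

end
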